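(* Let $\lambda\in\Lambda^+_{m|n}$. The following values are all equal to $\mathrm{longtail}(\lambda)$: (1) the maximal cardinality of an incomparable subset $S\subset\mathcal R$ such that $c_\lambda(\alpha)=1$ for all $\alpha\in S$; (2) $\max_{r\in\mathbb Z}\#\{i\in\{1,\dots,m\}\mid\overline\lambda_i\le r<k_i\}$, i.e. the maximal number of arrows going over a single point in the arrow diagram of $\lambda$; (3) the maximal number of caps going over a single point in the cap diagram of $\lambda$, i.e. $\max_{r\in\mathbb Z}\#\{i\in\{1,\dots,a\}\mid\times_i\le r<c_i\}$, where $\times_1<\dots<\times_a$ are the positions of the symbols $\times$ in $D_\lambda$ and $c_i$ is the right endpoint of the cap starting at $\times_i$.
   Context: Fix $m,n\ge 0$ and the complex Lie superalgebra $\mathfrak{gl}(m|n)$ with Cartan subalgebra $\mathfrak h$ of diagonal matrices. Let $\varepsilon_1,\dots,\varepsilon_m,\delta_1,\dots,\delta_n$ be the basis of $\mathfrak h^*$ dual to $E_{1,1},\dots,E_{m+n,m+n}$, with the symmetric bilinear form such that this basis is orthogonal, $(\varepsilon_i|\varepsilon_i)=1$, $(\delta_j|\delta_j)=-1$. The root system $\Delta$ consists of the even roots $\varepsilon_i-\varepsilon_j$, $\delta_i-\delta_j$ ($i\ne j$) and the odd roots $\pm(\varepsilon_i-\delta_j)$. A base is a linearly independent $\Sigma\subset\Delta$ such that every root is an integer combination of elements of $\Sigma$ with all coefficients $\ge0$ (positive roots for $\Sigma$) or all $\le 0$. The distinguished base is $\Sigma^{\mathrm{dist}}=\{\varepsilon_i-\varepsilon_{i+1},\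 \varepsilon_m-\delta_1,\ \delta_j-\delta_{j+1}\}$. $\mathbb S$ is the set of bases whose positive even roots are exactly $\{\varepsilon_i-\varepsilon_j,\delta_i-\delta_j\mid i<j\}$. Right odd roots: $\mathcal R=\{\varepsilon_i-\delta_j\mid 1\le i\le m,1\le j\le n\}$, partially ordered by $\varepsilon_i-\delta_j\le\varepsilon_k-\delta_l$ iff $i\ge k$ and $j\le l$. A subset of $\mathcal R$ is incomparable if no two distinct elements of it are comparable. Weights: $\nu=\sum a_i\varepsilon_i+\sum b_j\delta_j$ is written $(a_1\dots a_m|b_1\dots b_n)$, with $\nu_i:=a_i$, $\nu_{-j}:=b_j$. $\Lambda^+_{m|n}$ is the set of weights $\lambda$ with integer coordinates, $\lambda_1\ge\dots\ge\lambda_m$ and $\lambda_{-1}\ge\dots\ge\lambda_{-n}$. $L(\lambda)$ is the simple finite-dimensional $\mathfrak{gl}(m|n)$-module with highest weight $\lambda$ with respect to $\Sigma^{\mathrm{dist}}$; $\lambda_\Sigma$ is the highest weight of $L(\lambda)$ with respect to the base $\Sigma$. $\rho_\Sigma$ is half the sum of positive even roots minus half the sum of positive odd roots for $\Sigma$, shifted by $r(1\dots1|-1\dots-1)$ with $r\in\{0,\tfrac12\}$ (depending only on $m+n$) so that its coordinates are integers. $\overline\lambda_\Sigma:=\lambda_\Sigma+\rho_\Sigma$ and $\overline\lambda:=\overline\lambda_{\Sigma^{\mathrm{dist}}}$. Longtail: for an integral weight $\nu$, $s(\nu)$ is the largest cardinality of a linearly independent set $S$ of odd roots such that $(\alpha|\beta)=0$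 and $(\alpha|\nu)=0$ for all $\alpha,\beta\in S$ and such that $S\subset\Sigma'$ for some $\Sigma'\in\mathbb S$. $\mathrm{longtail}(\lambda):=\max_{\Sigma\in\mathbb S}s(\overline\lambda_\Sigma)$. Weight diagram $D_\lambda$ (for $\Sigma^{\mathrm{dist}}$): for $p\in\mathbb Z$, $D_\lambda(p)=\times$ if $p=\overline\lambda_i=-\overline\lambda_{-j}$ for some $i,j$; $>$ if $p=\overline\lambda_i$ for some $i$ only; $<$ if $p=-\overline\lambda_{-j}$ for some $j$ only; $\circ$ otherwise. Arrow diagram: define recursively for $i=m,m-1,\dots,1$ $$k_i:=\min\{c\in\mathbb Z\mid c\ge\overline\lambda_i,\ c\ne-\overline\lambda_{-j}\ \forall 1\le j\le n,\ c\ne k_{i'}\ \forall i<i'\le m\};$$ the $i$-th arrow goes from $\overline\lambda_i$ to $k_i$. Let $M_i:=\#\{j\in\{1,\dots,n\}\mid-\overline\lambda_{-j}<k_i\}$. Change tracking diagram: $c_\lambda:\mathcal R\to\{0,1\}$, $c_\lambda(\varepsilon_i-\delta_j)=1$ if $M_i-(k_i-\overline\lambda_i-1)\le j\le M_i$, and $0$ otherwise. Cap diagram: for each $p$ with $D_\lambda(p)=\times$, the cap starting at $p$ ends at the smallest $q>p$ such that the numbers of symbols $\times$ and of symbols $\circ$ of $D_\lambda$ in positions $p,p+1,\dots,q$ are equal. (Equivalently: going over the symbols $\times$ from right to left, connect each to the first position to its right containing $\circ$ that is not yet the end of a cap.) *)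

theory Defs
  imports Complex_Main "HOL-Library.Function_Algebras"
begin

section \<open>Weights and roots of \<open>gl(m|n)\<close>\<close>

text \<open>The rows and columns \<open>1, \<dots>, m\<close> are \<open>Eps 1, \<dots>, Eps m\<close>, and the rows and columns
  \<open>m+1, \<dots>, m+n\<close> are \<open>Del 1, \<dots>, Del n\<close>.\<close>

datatype idx = Eps nat | Del nat

fun odd_idx :: "idx \<Rightarrow> bool" where
  "odd_idx (Eps i) = False"
| "odd_idx (Del j) = True"

definition idxs :: "nat \<Rightarrow> nat \<Rightarrow> idx set" where
  "idxs m n = Eps ` {1..m} \<union> Del ` {1..n}"

text \<open>An element of the dual Cartan subalgebra is given by its coordinates with respect to the
  basis of the \<open>\<epsilon>\<^sub>i\<close> and \<open>\<delta>\<^sub>j\<close>; coordinates outside \<open>idxs m n\<close> are required to vanish.\<close>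

type_synonym weight = "idx \<Rightarrow> complex"

definition weights :: "nat \<Rightarrow> nat \<Rightarrow> weight set" where
  "weights m n = {\<nu>. \<forall>a. a \<notin> idxs m n \<longrightarrow> \<nu> a = 0}"

definition wscale :: "complex \<Rightarrow> weight \<Rightarrow> weight" where
  "wscale c \<nu> = (\<lambda>a. c * \<nu> a)"

interpretation wt: vector_space wscale
  by unfold_locales (auto simp: wscale_def fun_eq_iff algebra_simps)

definition unit_wt :: "idx \<Rightarrow> weight" where
  "unit_wt a = (\<lambda>b. if b = a then 1 else 0)"

abbreviation \<epsilon> :: "nat \<Rightarrow> weight" where "\<epsilon> i \<equiv> unit_wt (Eps i)"
abbreviation \<delta> :: "nat \<Rightarrow> weight" where "\<delta> j \<equiv> unit_wt (Del j)"

definition bil :: "nat \<Rightarrow> nat \<Rightarrow> weight \<Rightarrow> weight \<Rightarrow> complex" where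
  "bil m n \<mu> \<nu> = (\<Sum>i=1..m. \<mu> (Eps i) * \<nu> (Eps i)) - (\<Sum>j=1..n. \<mu> (Del j) * \<nu> (Del j))"

definition even_roots :: "nat \<Rightarrow> nat \<Rightarrow> weight set" where
  "even_roots m n =
     {\<epsilon> i - \<epsilon> j | i j. i \<in> {1..m} \<and> j \<in> {1..m} \<and> i \<noteq> j} \<union>
     {\<delta> i - \<delta> j | i j. i \<in> {1..n} \<and> j \<in> {1..n} \<and> i \<noteq> j}"

definition right_odd_roots :: "nat \<Rightarrow> nat \<Rightarrow> weight set" where
  "right_odd_roots m n = {\<epsilon> i - \<delta> j | i j. i \<in> {1..m} \<and> j \<in> {1..n}}"

definition odd_roots :: "nat \<Rightarrow> nat \<Rightarrow> weight set" where
  "odd_roots m n = right_odd_roots m n \<union> uminus ` right_odd_roots m n"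

definition roots :: "nat \<Rightarrow> nat \<Rightarrow> weight set" where
  "roots m n = even_roots m n \<union> odd_roots m n"

definition int_comb :: "(weight \<Rightarrow> int) \<Rightarrow> weight set \<Rightarrow> weight" where
  "int_comb c \<Sigma> = (\<Sum>\<beta>\<in>\<Sigma>. wscale (of_int (c \<beta>)) \<beta>)"

definition positive_roots :: "nat \<Rightarrow> nat \<Rightarrow> weight set \<Rightarrow> weight set" where
  "positive_roots m n \<Sigma> =
     {\<alpha> \<in> roots m n. \<exists>c. \<alpha> = int_comb c \<Sigma> \<and> (\<forall>\<beta>\<in>\<Sigma>. c \<beta> \<ge> 0)}"

definition is_base :: "nat \<Rightarrow> nat \<Rightarrow> weight set \<Rightarrow> bool" where
  "is_base m n \<Sigma> \<longleftrightarrow> \<Sigma> \<subseteq> roots m n \<and> wt.independent \<Sigma> \<and>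
     (\<forall>\<alpha>\<in>roots m n. \<exists>c. \<alpha> = int_comb c \<Sigma> \<and>
        ((\<forall>\<beta>\<in>\<Sigma>. c \<beta> \<ge> 0) \<or> (\<forall>\<beta>\<in>\<Sigma>. c \<beta> \<le> 0)))"

definition dist_base :: "nat \<Rightarrow> nat \<Rightarrow> weight set" where
  "dist_base m n =
     {\<epsilon> i - \<epsilon> (i + 1) | i. 1 \<le> i \<and> i < m} \<union>
     (if 1 \<le> m \<and> 1 \<le> n then {\<epsilon> m - \<delta> 1} else {}) \<union>
     {\<delta> j - \<delta> (j + 1) | j. 1 \<le> j \<and> j < n}"

definition std_even_positive :: "nat \<Rightarrow> nat \<Rightarrow> weight set" where
  "std_even_positive m n =
     {\<epsilon> i - \<epsilon> j | i j. 1 \<le> i \<and> i < j \<and> j \<le> m} \<union>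
     {\<delta> i - \<delta> j | i j. 1 \<le> i \<and> i < j \<and> j \<le> n}"

definition bases :: "nat \<Rightarrow> nat \<Rightarrow> weight set set" where
  "bases m n =
     {\<Sigma>. is_base m n \<Sigma> \<and> positive_roots m n \<Sigma> \<inter> even_roots m n = std_even_positive m n}"

definition right_le :: "nat \<Rightarrow> nat \<Rightarrow> weight \<Rightarrow> weight \<Rightarrow> bool" where
  "right_le m n \<alpha> \<beta> \<longleftrightarrow> (\<exists>i\<in>{1..m}. \<exists>j\<in>{1..n}. \<exists>k\<in>{1..m}. \<exists>l\<in>{1..n}.
     \<alpha> = \<epsilon> i - \<delta> j \<and> \<beta> = \<epsilon> k - \<delta> l \<and> i \<ge> k \<and> j \<le> l)"

definition incomparable :: "nat \<Rightarrow> nat \<Rightarrow> weight set \<Rightarrow> bool" where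
  "incomparable m n S \<longleftrightarrow> S \<subseteq> right_odd_roots m n \<and>
     (\<forall>\<alpha>\<in>S. \<forall>\<beta>\<in>S. \<alpha> \<noteq> \<beta> \<longrightarrow> \<not> right_le m n \<alpha> \<beta> \<and> \<not> right_le m n \<beta> \<alpha>)"

text \<open>The last summand is the shift by \<open>r(1 \<dots> 1 | -1 \<dots> -1)\<close>: the unshifted coordinates are
  integers if \<open>m + n\<close> is odd and lie in \<open>1/2 + \<int>\<close> if \<open>m + n\<close> is even.\<close>

definition rho :: "nat \<Rightarrow> nat \<Rightarrow> weight set \<Rightarrow> weight" where
  "rho m n \<Sigma> =
     wscale (1/2) (\<Sum>\<alpha>\<in>positive_roots m n \<Sigma> \<inter> even_roots m n. \<alpha>)
   - wscale (1/2) (\<Sum>\<alpha>\<in>positive_roots m n \<Sigma> \<inter> odd_roots m n. \<alpha>)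
   + wscale (if odd (m + n) then 0 else 1/2) ((\<Sum>i=1..m. \<epsilon> i) - (\<Sum>j=1..n. \<delta> j))"


section \<open>The Lie superalgebra \<open>gl(m|n)\<close> and its modules\<close>

type_synonym cmat = "idx \<Rightarrow> idx \<Rightarrow> complex"

definition gl :: "nat \<Rightarrow> nat \<Rightarrow> cmat set" where
  "gl m n = {X. \<forall>a b. X a b \<noteq> 0 \<longrightarrow> a \<in> idxs m n \<and> b \<in> idxs m n}"

text \<open>\<open>gl_part m n False\<close> is the even and \<open>gl_part m n True\<close> the odd part.\<close>

definition gl_part :: "nat \<Rightarrow> nat \<Rightarrow> bool \<Rightarrow> cmat set" where
  "gl_part m n p = {X \<in> gl m n. \<forall>a b. X a b \<noteq> 0 \<longrightarrow> (odd_idx a \<noteq> odd_idx b) = p}"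

definition mat_mul :: "nat \<Rightarrow> nat \<Rightarrow> cmat \<Rightarrow> cmat \<Rightarrow> cmat" where
  "mat_mul m n X Y = (\<lambda>a b. \<Sum>c\<in>idxs m n. X a c * Y c b)"

definition mat_scale :: "complex \<Rightarrow> cmat \<Rightarrow> cmat" where
  "mat_scale c X = (\<lambda>a b. c * X a b)"

definition super_sign :: "bool \<Rightarrow> bool \<Rightarrow> complex" where
  "super_sign p q = (if p \<and> q then -1 else 1)"

text \<open>The superbracket of homogeneous elements of parities \<open>p\<close> and \<open>q\<close>.\<close>

definition super_bracket :: "nat \<Rightarrow> nat \<Rightarrow> bool \<Rightarrow> bool \<Rightarrow> cmat \<Rightarrow> cmat \<Rightarrow> cmat" where
  "super_bracket m n p q X Y =
     mat_mul m n X Y - mat_scale (super_sign p q) (mat_mul m n Y X)"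

definition mat_unit :: "idx \<Rightarrow> idx \<Rightarrow> cmat" where
  "mat_unit a b = (\<lambda>c d. if c = a \<and> d = b then 1 else 0)"

definition cartan :: "nat \<Rightarrow> nat \<Rightarrow> cmat set" where
  "cartan m n = {H \<in> gl m n. \<forall>a b. a \<noteq> b \<longrightarrow> H a b = 0}"

definition wt_eval :: "nat \<Rightarrow> nat \<Rightarrow> weight \<Rightarrow> cmat \<Rightarrow> complex" where
  "wt_eval m n \<nu> H = (\<Sum>a\<in>idxs m n. \<nu> a * H a a)"

text \<open>A module is a complex vector space (the whole type \<open>'v\<close> with scalar multiplication
  \<open>scale\<close>), graded by its even part \<open>V False\<close> and its odd part \<open>V True\<close>.\<close>

locale gl_module = vector_space scale
  for scale :: "complex \<Rightarrow> 'v::ab_group_add \<Rightarrow> 'v" +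
  fixes m n :: nat
    and V :: "bool \<Rightarrow> 'v set"
    and act :: "cmat \<Rightarrow> 'v \<Rightarrow> 'v"
  assumes grading_subspace: "subspace (V p)"
    and grading_disjoint: "V False \<inter> V True = {0}"
    and grading_sum: "\<exists>x\<in>V False. \<exists>y\<in>V True. v = x + y"
    and act_linear: "X \<in> gl m n \<Longrightarrow> Vector_Spaces.linear scale scale (act X)"
    and act_add: "X \<in> gl m n \<Longrightarrow> Y \<in> gl m n \<Longrightarrow> act (X + Y) v = act X v + act Y v"
    and act_scale: "X \<in> gl m n \<Longrightarrow> act (mat_scale c X) v = scale c (act X v)"
    and act_parity: "X \<in> gl_part m n p \<Longrightarrow> v \<in> V q \<Longrightarrow> act X v \<in> V (p \<noteq> q)"
    and act_bracket: "X \<in> gl_part m n p \<Longrightarrow> Y \<in> gl_part m n q \<Longrightarrow>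
      act (super_bracket m n p q X Y) v
        = act X (act Y v) - scale (super_sign p q) (act Y (act X v))"
begin

definition submodule :: "'v set \<Rightarrow> bool" where
  "submodule W \<longleftrightarrow> subspace W \<and> (\<forall>X\<in>gl m n. \<forall>w\<in>W. act X w \<in> W) \<and>
     (\<forall>w\<in>W. \<exists>x\<in>W \<inter> V False. \<exists>y\<in>W \<inter> V True. w = x + y)"

definition simple_module :: "bool" where
  "simple_module \<longleftrightarrow> (UNIV :: 'v set) \<noteq> {0} \<and> (\<forall>W. submodule W \<longrightarrow> W = {0} \<or> W = UNIV)"

definition finite_dim :: "bool" where
  "finite_dim \<longleftrightarrow> (\<exists>B. finite B \<and> span B = UNIV)"

end

text \<open>Highest weight vectors for the Borel subalgebra of \<open>\<Sigma>\<close>; \<open>mat_unit a b\<close> spans the root space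
  of \<open>unit_wt a - unit_wt b\<close>. For a simple module the vector \<open>v\<close> generates automatically.\<close>

definition has_highest_weight ::
  "nat \<Rightarrow> nat \<Rightarrow> (complex \<Rightarrow> 'v::ab_group_add \<Rightarrow> 'v) \<Rightarrow> (cmat \<Rightarrow> 'v \<Rightarrow> 'v) \<Rightarrow> weight set \<Rightarrow> weight \<Rightarrow> bool"
where
  "has_highest_weight m n scale act \<Sigma> \<nu> \<longleftrightarrow> \<nu> \<in> weights m n \<and>
     (\<exists>v. v \<noteq> 0 \<and> (\<forall>H\<in>cartan m n. act H v = scale (wt_eval m n \<nu> H) v) \<and>
       (\<forall>a\<in>idxs m n. \<forall>b\<in>idxs m n.
          unit_wt a - unit_wt b \<in> positive_roots m n \<Sigma> \<longrightarrow> act (mat_unit a b) v = 0))"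

definition highest_weight ::
  "nat \<Rightarrow> nat \<Rightarrow> (complex \<Rightarrow> 'v::ab_group_add \<Rightarrow> 'v) \<Rightarrow> (cmat \<Rightarrow> 'v \<Rightarrow> 'v) \<Rightarrow> weight set \<Rightarrow> weight"
where
  "highest_weight m n scale act \<Sigma> = (THE \<nu>. has_highest_weight m n scale act \<Sigma> \<nu>)"

definition dominant :: "nat \<Rightarrow> nat \<Rightarrow> (idx \<Rightarrow> int) set" where
  "dominant m n = {lam. (\<forall>a. a \<notin> idxs m n \<longrightarrow> lam a = 0) \<and>
     (\<forall>i j. 1 \<le> i \<and> i \<le> j \<and> j \<le> m \<longrightarrow> lam (Eps i) \<ge> lam (Eps j)) \<and>
     (\<forall>i j. 1 \<le> i \<and> i \<le> j \<and> j \<le> n \<longrightarrow> lam (Del i) \<ge> lam (Del j))}"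

definition weight_of :: "(idx \<Rightarrow> int) \<Rightarrow> weight" where
  "weight_of lam = (\<lambda>a. of_int (lam a))"

text \<open>The given module is (a model of) \<open>L(\<lambda>)\<close>.\<close>

definition is_L ::
  "nat \<Rightarrow> nat \<Rightarrow> (idx \<Rightarrow> int) \<Rightarrow> (complex \<Rightarrow> 'v::ab_group_add \<Rightarrow> 'v) \<Rightarrow> (bool \<Rightarrow> 'v set) \<Rightarrow>
   (cmat \<Rightarrow> 'v \<Rightarrow> 'v) \<Rightarrow> bool"
where
  "is_L m n lam scale V act \<longleftrightarrow> gl_module scale m n V act \<and>
     gl_module.simple_module scale m n V act \<and> gl_module.finite_dim scale \<and>
     has_highest_weight m n scale act (dist_base m n) (weight_of lam)"


section \<open>Longtail\<close>

definition s_value :: "nat \<Rightarrow> nat \<Rightarrow> weight \<Rightarrow> nat" where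
  "s_value m n \<nu> = Max {card S | S. S \<subseteq> odd_roots m n \<and> wt.independent S \<and>
     (\<forall>\<alpha>\<in>S. \<forall>\<beta>\<in>S. bil m n \<alpha> \<beta> = 0) \<and> (\<forall>\<alpha>\<in>S. bil m n \<alpha> \<nu> = 0) \<and>
     (\<exists>\<Sigma>'\<in>bases m n. S \<subseteq> \<Sigma>')}"

definition longtail ::
  "nat \<Rightarrow> nat \<Rightarrow> (complex \<Rightarrow> 'v::ab_group_add \<Rightarrow> 'v) \<Rightarrow> (cmat \<Rightarrow> 'v \<Rightarrow> 'v) \<Rightarrow> nat"
where
  "longtail m n scale act =
     Max ((\<lambda>\<Sigma>. s_value m n (highest_weight m n scale act \<Sigma> + rho m n \<Sigma>)) ` bases m n)"


section \<open>Weight, arrow, change tracking and cap diagrams\<close>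

text \<open>The coordinates of \<open>\<lambda> + \<rho>\<close> for the distinguished base; they are integers, so the floor only
  changes the type.\<close>

definition lam_bar :: "nat \<Rightarrow> nat \<Rightarrow> (idx \<Rightarrow> int) \<Rightarrow> idx \<Rightarrow> int" where
  "lam_bar m n lam = (\<lambda>a. \<lfloor>Re ((weight_of lam + rho m n (dist_base m n)) a)\<rfloor>)"

text \<open>In the remaining definitions \<open>x\<close> stands for \<open>lam_bar m n lam\<close>.\<close>

datatype symb = Cross | Greater | Less | Circ

definition diagram :: "nat \<Rightarrow> nat \<Rightarrow> (idx \<Rightarrow> int) \<Rightarrow> int \<Rightarrow> symb" where
  "diagram m n x p =
     (if \<exists>i\<in>{1..m}. p = x (Eps i)
      then (if \<exists>j\<in>{1..n}. p = - x (Del j) then Cross else Greater)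
      else (if \<exists>j\<in>{1..n}. p = - x (Del j) then Less else Circ))"

function arrow_end :: "nat \<Rightarrow> nat \<Rightarrow> (idx \<Rightarrow> int) \<Rightarrow> nat \<Rightarrow> int" where
  "arrow_end m n x i =
     (LEAST c. c \<ge> x (Eps i) \<and> (\<forall>j\<in>{1..n}. c \<noteq> - x (Del j)) \<and>
        c \<notin> (\<lambda>i'. arrow_end m n x i') ` {i<..m})"
  by auto
termination
  by (relation "measure (\<lambda>(m, n, x, i). m - i)") auto

declare arrow_end.simps [simp del]

definition change_row :: "nat \<Rightarrow> nat \<Rightarrow> (idx \<Rightarrow> int) \<Rightarrow> nat \<Rightarrow> int" where
  "change_row m n x i = int (card {j \<in> {1..n}. - x (Del j) < arrow_end m n x i})"

definition change_tracking :: "nat \<Rightarrow> nat \<Rightarrow> (idx \<Rightarrow> int) \<Rightarrow> weight \<Rightarrow> nat" where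
  "change_tracking m n x \<alpha> =
     (if \<exists>i\<in>{1..m}. \<exists>j\<in>{1..n}. \<alpha> = \<epsilon> i - \<delta> j \<and>
          change_row m n x i - (arrow_end m n x i - x (Eps i) - 1) \<le> int j \<and>
          int j \<le> change_row m n x i
      then 1 else 0)"

definition cap_end :: "nat \<Rightarrow> nat \<Rightarrow> (idx \<Rightarrow> int) \<Rightarrow> int \<Rightarrow> int" where
  "cap_end m n x p =
     (LEAST q. q > p \<and>
        card {t \<in> {p..q}. diagram m n x t = Cross} = card {t \<in> {p..q}. diagram m n x t = Circ})"

definition max_incomparable :: "nat \<Rightarrow> nat \<Rightarrow> (idx \<Rightarrow> int) \<Rightarrow> nat" where
  "max_incomparable m n x =
     Max {card S | S. incomparable m n S \<and> (\<forall>\<alpha>\<in>S. change_tracking m n x \<alpha> = 1)}"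

definition max_arrows :: "nat \<Rightarrow> nat \<Rightarrow> (idx \<Rightarrow> int) \<Rightarrow> nat" where
  "max_arrows m n x =
     Max (range (\<lambda>r::int. card {i \<in> {1..m}. x (Eps i) \<le> r \<and> r < arrow_end m n x i}))"

definition max_caps :: "nat \<Rightarrow> nat \<Rightarrow> (idx \<Rightarrow> int) \<Rightarrow> nat" where
  "max_caps m n x =
     Max (range (\<lambda>r::int. card {p. diagram m n x p = Cross \<and> p \<le> r \<and> r < cap_end m n x p}))"

end

theory Submission
  imports Defs
begin

text \<open>Write \<open>\<epsilon>\<^sub>i - \<delta>\<^sub>j\<close> as the cell \<open>(t, j')\<close> with \<open>t = m - i\<close> and \<open>j' = j - 1\<close>, so that the order on the
  right odd roots is the componentwise one, and the bases in question correspond to the order ideals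
  of the \<open>m \<times> n\<close> rectangle. Adding a cell to the ideal is an odd reflection: it raises the two coordinates
  \<open>a\<^sub>t\<close> and \<open>b\<^sub>j\<close> (the negated \<open>\<delta>\<close>-coordinate) of \<open>\<lambda> + \<rho>\<close> by one if they agree, a hit, and leaves them
  unchanged otherwise. Processing all cells row by row therefore decides which cells are hits, and
  row \<open>t\<close> moves \<open>a\<^sub>t\<close> along the \<open>t\<close>-th arrow.

  The sign of \<open>a\<^sub>t - b\<^sub>j\<close> upon arrival at the cell is increasing in \<open>t\<close> and decreasing in \<open>j\<close>. Hence the
  cells where the coordinates for any given ideal agree are hits, which identifies the longtail
  with the largest antichain of hits; and the hits between two given hits fill a rectangle, along whose diagonal
  \<open>a\<^sub>t\<close> is constant, so that a long antichain yields many arrows over one point. Arrows and caps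
  over \<open>r\<close> are counted by the same recursion in \<open>r\<close>.\<close>

section \<open>The reflection process\<close>

text \<open>The unit step of a hit comes from comparing two changes. Passing a simple odd root
  \<alpha> adds \<alpha> to rho, while the highest weight loses \<alpha> unless it is orthogonal to
  \<alpha>, in which case it stays. So lambda + rho changes, by \<alpha>, exactly in the orthogonal
  case; as rho is orthogonal to a simple odd root, this case is the equality of two coordinates.

  An ideal can be filled in many orders. The recursion of \<open>run\<close> consults only
  componentwise smaller cells, so every value depends on its cell alone, and the weight belonging to
  an ideal can be read off from its row and column lengths.

  The longtail involves two unrelated bases: one supplies the weight, another contains the isotropic
  set. The first is eliminated by showing that an equality read at any ideal already holds on
  arrival at the cell. For the second, the minimal cells outside an ideal are simultaneously simple,
  and orthogonal simple odd roots are, up to sign, incomparable. An antichain of hits is then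
  realised by letting one base play both roles.\<close>

text \<open>\<open>run a b t j\<close> is the value of \<open>a t\<close> after row \<open>t\<close> has passed the columns below \<open>j\<close>; by symmetry
  \<open>run b a j t\<close> is the value of \<open>b j\<close> after the rows below \<open>t\<close>.\<close>

function run :: "(nat \<Rightarrow> int) \<Rightarrow> (nat \<Rightarrow> int) \<Rightarrow> nat \<Rightarrow> nat \<Rightarrow> int" where
  "run a b t 0 = a t"
| "run a b t (Suc j) = run a b t j + (if run a b t j = run b a j t then 1 else 0)"
  by pat_completeness auto
termination
  by (relation "measure (\<lambda>(a, b, t, j). t + j)") auto

abbreviation hit :: "(nat \<Rightarrow> int) \<Rightarrow> (nat \<Rightarrow> int) \<Rightarrow> nat \<Rightarrow> nat \<Rightarrow> bool" where
  "hit a b t j \<equiv> run a b t j = run b a j t"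

section \<open>Monotonicity and sign rules of the process\<close>

lemma run_mono: "j \<le> j' \<Longrightarrow> run a b t j \<le> run a b t j'"
  by (induction j' rule: dec_induct) auto

text \<open>A gap between neighbours could close only if it is one and just the left entry rises.
  But that hit also raises row \<open>t\<close> by one, so the row meets the right entry next and
  raises it as well.\<close>

lemma run_strict_mono:
  assumes "strict_mono_on {..<n} b" "j < j'" "j' < n"
  shows "run b a j t < run b a j' t"
proof -
  have step: "run b a j t < run b a (Suc j) t" if "Suc j < n" for j t
    using that
  proof (induction t)
    case 0
    then show ?case using assms(1) by (auto simp: strict_mono_on_def)
  next
    case (Suc t)
    then have "run b a j t < run b a (Suc j) t" by blast
    then show ?case by (auto simp: less_le_not_le)
  qed
  show ?thesis
    using assms(2,3)
  proof (induction j')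
    case 0 then show ?case by simp
  next
    case (Suc j')
    then show ?case using step[of j' t] by (cases "j = j'") (auto intro: less_trans)
  qed
qed

text \<open>The row rises only by meeting an earlier column, whose value lies strictly below that of
  column \<open>j\<close>, so one unit cannot carry it past. The start \<open>r\<close> is arbitrary
  because row lengths of ideals are inserted for it later.\<close>

lemma run_le_stays:
  assumes "strict_mono_on {..<n} b" "r \<le> j'" "j' \<le> j" "j < n" "run a b t r \<le> run b a j t"
  shows "run a b t j' \<le> run b a j t"
  using assms(2,3)
proof (induction j' rule: dec_induct)
  case (step j')
  then have "run a b t j' \<le> run b a j t" by simp
  moreover have "run b a j' t < run b a j t"
    using run_strict_mono[OF assms(1)] step assms(4) by simp
  ultimately show ?case by auto
qed (use assms in auto)

text \<open>Once strictly below column \<open>j\<close>, the row meets only columns that are at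
  least as high as \<open>j\<close> and never moves again.\<close>

lemma run_less_stays:
  assumes "strict_mono_on {..<n} b" "j \<le> j'" "j' \<le> n" "run a b t j < run b a j t"
  shows "run a b t j' < run b a j t"
  using assms(2,3)
proof (induction j' rule: dec_induct)
  case (step j')
  then have "run a b t j' < run b a j t" by simp
  moreover have "run b a j t \<le> run b a j' t"
    using run_strict_mono[OF assms(1), of j j' a t] step by (cases "j = j'") auto
  ultimately show ?case by auto
qed (use assms in auto)

text \<open>The sign rule along a row; exchanging \<open>a\<close> and \<open>b\<close> gives the
  rule along a column.\<close>

lemma sign_row_le:
  assumes "strict_mono_on {..<n} b" "j \<le> j'" "j' < n" "run a b t j \<le> run b a j t"
  shows "run a b t j' \<le> run b a j' t"
proof -
  have "run b a j t \<le> run b a j' t"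
    using run_strict_mono[OF assms(1), of j j' a t] assms(2,3) by (cases "j = j'") auto
  then show ?thesis
    using run_le_stays[OF assms(1), of j j' j' a t] assms by auto
qed

text \<open>On arrival, the sign of row value minus column value is largest at the corner
  \<open>(t1, j1)\<close> and smallest at \<open>(t0, j0)\<close>. Both corners are hits, so it is
  zero in between.\<close>

lemma hit_rectangle:
  assumes "strict_mono_on {..<m} a" "strict_mono_on {..<n} b"
    and "hit a b t1 j1" "hit a b t0 j0" "t0 \<le> t" "t \<le> t1" "j1 \<le> j" "j \<le> j0" "t1 < m" "j0 < n"
  shows "hit a b t j"
proof (rule antisym)
  have "run a b t j1 \<le> run b a j1 t"
  proof (rule ccontr)
    assume "\<not> run a b t j1 \<le> run b a j1 t"
    then have l: "run b a j1 t < run a b t j1" by simp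
    have "run b a j1 t1 < run a b t j1"
      using run_less_stays[OF assms(1) _ _ l, of t1] assms by auto
    moreover have "run a b t j1 \<le> run a b t1 j1"
      using run_strict_mono[OF assms(1), of t t1 b j1] assms by (cases "t = t1") auto
    ultimately show False using assms by simp
  qed
  then show "run a b t j \<le> run b a j t"
    using sign_row_le[OF assms(2)] assms by auto
  have "run b a j t0 \<le> run a b t0 j"
  proof (rule ccontr)
    assume "\<not> ?thesis"
    then have l: "run a b t0 j < run b a j t0" by simp
    have "run a b t0 j0 < run b a j t0"
      using run_less_stays[OF assms(2) _ _ l, of j0] assms by auto
    moreover have "run b a j t0 \<le> run b a j0 t0"
      using run_strict_mono[OF assms(2), of j j0 a t0] assms by (cases "j = j0") auto
    ultimately show False using assms by simp
  qed
  then show "run b a j t \<le> run a b t j"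
    using sign_row_le[OF assms(1), of t0 t b j] assms by auto
qed

text \<open>To be read with \<open>r\<close> the length of row \<open>t\<close> and \<open>s\<close> the height of column \<open>j\<close> in an order ideal.\<close>

lemma run_eq_imp_hit:
  assumes "strict_mono_on {..<m} a" "strict_mono_on {..<n} b" "t < m" "j < n"
    and "run a b t r = run b a j s" "j < r \<longleftrightarrow> t < s" "r \<le> n" "s \<le> m"
  shows "hit a b t j"
proof (cases "j < r")
  \<comment> \<open>Both values are read after the cell has been passed; a strict inequality on
    arrival would survive until then.\<close>
  case True
  then have ts: "t < s" using assms by simp
  show ?thesis
  proof (rule ccontr)
    assume "\<not> ?thesis"
    then consider "run a b t j < run b a j t" | "run b a j t < run a b t j" by linarith
    then show False
    proof cases
      case 1
      then have "run a b t r < run b a j t" using run_less_stays[OF assms(2) _ _ 1, of r] True assms by simp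
      also have "\<dots> \<le> run b a j s" using run_mono ts by simp
      finally show False using assms by simp
    next
      case 2
      then have "run b a j s < run a b t j" using run_less_stays[OF assms(1) _ _ 2, of s] ts assms by simp
      also have "\<dots> \<le> run a b t r" using run_mono True by simp
      finally show False using assms by simp
    qed
  qed
next
  \<comment> \<open>Both values are read before the cell is reached; starting from equality, neither
    side can overtake the other on the way.\<close>
  case False
  then have le: "r \<le> j" "s \<le> t" using assms by auto
  have "run a b t j \<le> run b a j t"
    by (rule run_le_stays[OF assms(2), of r]) (use le assms run_mono[of s t b a j] in auto)
  moreover have "run b a j t \<le> run a b t j"
    by (rule run_le_stays[OF assms(1), of s]) (use le assms run_mono[of r j a b t] in auto)
  ultimately show ?thesis by simp
qed

section \<open>Rows of the process as arrows\<close>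

lemma run_passes:
  assumes "a t \<le> c" "c < run a b t j"
  shows "\<exists>j'<j. run a b t j' = c \<and> run b a j' t = c"
  using assms
proof (induction j)
  case (Suc j)
  show ?case
  proof (cases "c < run a b t j")
    case True
    then show ?thesis using Suc by (auto intro: less_SucI)
  next
    case False
    then show ?thesis using Suc.prems by (intro exI[of _ j]) (auto split: if_splits)
  qed
qed simp

text \<open>If the end of the row were the value of column \<open>j\<close>, the row would be at
  most this value when it gets there. Equality would push the row beyond its own end, and from
  strictly below it never catches up.\<close>

lemma run_end_notin:
  assumes "strict_mono_on {..<n} b" "j < n"
  shows "run b a j t \<noteq> run a b t n"
proof
  assume e: "run b a j t = run a b t n"
  have "run a b t j \<le> run a b t n" "run a b t (Suc j) \<le> run a b t n"
    using assms by (auto intro!: run_mono simp del: run.simps)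
  with e have "run a b t j < run b a j t"
    by (auto split: if_splits simp: order.order_iff_strict)
  then have "run a b t n < run b a j t"
    using run_less_stays[OF assms(1), of j n a t] assms by simp
  with e show False by simp
qed

text \<open>The hits of row \<open>t\<close> sit at the values \<open>a t, ..., k - 1\<close>, where
  \<open>k\<close> is the end of the row, and are moved to \<open>a t + 1, ..., k\<close>. Above
  \<open>a t\<close> the occupied values therefore gain just \<open>k\<close>.\<close>

lemma run_set_step:
  assumes "a t < c"
  shows "(\<exists>j<n. run b a j (Suc t) = c) \<longleftrightarrow> (\<exists>j<n. run b a j t = c) \<or> c = run a b t n"
proof
  assume "\<exists>j<n. run b a j (Suc t) = c"
  then obtain j where j: "j < n" "run b a j (Suc t) = c" by blast
  show "(\<exists>j<n. run b a j t = c) \<or> c = run a b t n"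
  proof (cases "hit a b t j")
    case True
    then have "run a b t (Suc j) = c" using j by simp
    then have "c \<le> run a b t n" using j run_mono[of "Suc j" n a b t] by simp
    then show ?thesis using run_passes[of a t c b n] assms by force
  qed (use j in auto)
next
  assume "(\<exists>j<n. run b a j t = c) \<or> c = run a b t n"
  \<comment> \<open>Either the column holding \<open>c\<close> is not hit, or \<open>c\<close> is a
    value assumed by row \<open>t\<close>, possibly its last.\<close>
  then consider j where "j < n" "run b a j t = c" "\<not> hit a b t j"
    | j where "j \<le> n" "c = run a b t j"
    by (metis less_imp_le order_refl)
  then show "\<exists>j<n. run b a j (Suc t) = c"
  proof cases
    case (1 j)
    then show ?thesis by (intro exI[of _ j]) auto
  next
    case (2 j)
    \<comment> \<open>As \<open>a t < c\<close>, the row also passed \<open>c - 1\<close>, and that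
      hit raised column \<open>j'\<close> to \<open>c\<close>.\<close>
    then obtain j' where "j' < j" "run a b t j' = c - 1" "run b a j' t = c - 1"
      using run_passes[of a t "c - 1" b j] assms by auto
    then show ?thesis using 2 by (intro exI[of _ j']) auto
  qed
qed

text \<open>Identifies the occupied values with those that the recursion of \<open>arrow_end\<close>
  excludes: the original \<open>b j\<close> and the ends of the preceding rows. A row
  \<open>u\<close> can vacate only the value \<open>a u\<close>, which lies below
  \<open>a t\<close>; hence the restriction on \<open>c\<close>.\<close>

lemma run_set:
  assumes "strict_mono_on {..<m} a" "t' \<le> t" "t < m" "a t \<le> c"
  shows "(\<exists>j<n. run b a j t' = c) \<longleftrightarrow> (\<exists>j<n. b j = c) \<or> (\<exists>u<t'. c = run a b u n)"
  using assms(2)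
proof (induction t')
  case (Suc t')
  have "a t' < a t" using assms Suc by (auto simp: strict_mono_on_def)
  then have "a t' < c" using assms by simp
  then show ?case using Suc run_set_step[of a t' c n b] by (auto simp: less_Suc_eq simp del: run.simps(2))
qed auto

text \<open>With \<open>run_end_le\<close> this characterises the end of a row as a least unoccupied
  value, which is how \<open>arrow_end\<close> is defined.\<close>

lemma run_end_free:
  assumes "strict_mono_on {..<m} a" "strict_mono_on {..<n} b" "t < m"
  shows "\<forall>j<n. run a b t n \<noteq> b j" "\<forall>u<t. run a b t n \<noteq> run a b u n"
proof -
  have ge: "a t \<le> run a b t n" using run_mono[of 0 n a b t] by simp
  show "\<forall>j<n. run a b t n \<noteq> b j" "\<forall>u<t. run a b t n \<noteq> run a b u n"
    using run_set[OF assms(1) order_refl assms(3) ge, of n b] run_end_notin[OF assms(2), of _ a t]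
    by (auto simp: eq_commute)
qed

text \<open>A value can be passed only by a hit there, and an unoccupied \<open>c\<close> offers
  none.\<close>

lemma run_end_le:
  assumes "strict_mono_on {..<m} a" "t < m"
    and "a t \<le> c" "\<forall>j<n. c \<noteq> b j" "\<forall>u<t. c \<noteq> run a b u n"
  shows "run a b t n \<le> c"
proof -
  have "\<not> (\<exists>j<n. run b a j t = c)"
    using run_set[OF assms(1) order_refl assms(2,3), of n b] assms(4,5) by auto
  then show ?thesis using run_passes[of a t c b n] assms(3) by force
qed

text \<open>\<open>change_row\<close> counts the original \<open>b j\<close>, whereas hits see the
  values on arrival. A column rises in unit steps, so to cross the end of row \<open>t\<close> it
  would have to take that value first. By \<open>run_set\<close> the value would still be occupied
  when row \<open>t\<close> comes, against \<open>run_end_notin\<close>.\<close>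

lemma run_less_end_iff:
  assumes "strict_mono_on {..<m} a" "strict_mono_on {..<n} b" "t < m" "j < n" "t' \<le> t"
  shows "run b a j t' < run a b t n \<longleftrightarrow> b j < run a b t n"
  using assms(5)
proof (induction t')
  case (Suc t')
  have ge: "a t \<le> run a b t n" using run_mono[of 0 n a b t] by simp
  have "run b a j (Suc t') \<noteq> run a b t n"
  proof
    assume "run b a j (Suc t') = run a b t n"
    then have "\<exists>j<n. run b a j (Suc t') = run a b t n" using assms by blast
    then have "\<exists>j<n. run b a j t = run a b t n"
      unfolding run_set[OF assms(1) Suc.prems assms(3) ge] run_set[OF assms(1) order_refl assms(3) ge]
      using Suc.prems by (meson less_le_trans)
    then show False using run_end_notin[OF assms(2), of _ a t] by auto
  qed
  moreover have "run b a j (Suc t') = run b a j t' \<or> run b a j (Suc t') = run b a j t' + 1"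
    by simp
  moreover have "run b a j t' < run a b t n \<longleftrightarrow> b j < run a b t n"
    using Suc by simp
  ultimately show ?case by linarith
qed simp

text \<open>Every value from \<open>a t\<close> up to the end is left through a hit, and strict
  monotonicity of the columns tells in which column.\<close>

lemma hit_iff_between:
  assumes "strict_mono_on {..<n} b" "j < n"
  shows "hit a b t j \<longleftrightarrow> a t \<le> run b a j t \<and> run b a j t < run a b t n"
proof
  assume h: "hit a b t j"
  have "run a b t (Suc j) \<le> run a b t n" "run a b t 0 \<le> run a b t j"
    using assms by (auto intro!: run_mono simp del: run.simps)
  then show "a t \<le> run b a j t \<and> run b a j t < run a b t n" using h by simp
next
  assume "a t \<le> run b a j t \<and> run b a j t < run a b t n"
  then obtain j' where j': "j' < n" "run a b t j' = run b a j t" "run b a j' t = run b a j t"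
 using run_passes[of a t "run b a j t" b n] by auto
  then have "j' = j"
    using run_strict_mono[OF assms(1), of j j' a t] run_strict_mono[OF assms(1), of j' j a t] assms(2)
    by (metis less_irrefl linorder_neqE_nat)
  then show "hit a b t j" using j' by simp
qed

lemma card_below_iff:
  fixes B :: "nat \<Rightarrow> int"
  assumes "strict_mono_on {..<n} B" "j < n"
  shows "B j < c \<longleftrightarrow> j < card {j. j < n \<and> B j < c}"
proof
  assume "B j < c"
  have "{..j} \<subseteq> {j. j < n \<and> B j < c}"
  proof
    fix i assume i: "i \<in> {..j}"
    then have "B i \<le> B j" using assms unfolding strict_mono_on_def
      by (cases "i = j") (auto intro: less_imp_le)
    then show "i \<in> {j. j < n \<and> B j < c}" using i assms \<open>B j < c\<close> by auto
  qed
  then have "card {..j} \<le> card {j. j < n \<and> B j < c}" by (intro card_mono) auto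
  then show "j < card {j. j < n \<and> B j < c}" by simp
next
  assume l: "j < card {j. j < n \<and> B j < c}"
  show "B j < c"
  proof (rule ccontr)
    assume nl: "\<not> B j < c"
    have "{j. j < n \<and> B j < c} \<subseteq> {..<j}"
    proof
      fix i assume i: "i \<in> {j. j < n \<and> B j < c}"
      have "\<not> j \<le> i"
      proof
        assume "j \<le> i"
        then have "B j \<le> B i" using assms i unfolding strict_mono_on_def
          by (cases "i = j") (auto intro: less_imp_le)
        then show False using i nl by simp
      qed
      then show "i \<in> {..<j}" by simp
    qed
    then have "card {j. j < n \<and> B j < c} \<le> card {..<j}" by (intro card_mono) auto
    then show False using l by simp
  qed
qed

text \<open>When row \<open>t\<close> arrives, each value in \<open>{a t..<k}\<close> is held by
  exactly one column. The hits are therefore \<open>k - a t\<close> consecutive columns, the last of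
  which has the one-based number \<open>M\<close>; this is the interval of the change tracking
  diagram.\<close>

lemma hit_iff_change:
  assumes "strict_mono_on {..<m} a" "strict_mono_on {..<n} b" "t < m" "j < n"
  defines "k \<equiv> run a b t n"
  defines "M \<equiv> int (card {j. j < n \<and> b j < k})"
  shows "hit a b t j \<longleftrightarrow> M - (k - a t - 1) \<le> int (Suc j) \<and> int (Suc j) \<le> M"
proof -
  let ?B = "\<lambda>j. run b a j t"
  have sB: "strict_mono_on {..<n} ?B"
    using run_strict_mono[OF assms(2)] by (auto simp: strict_mono_on_def)
  have M: "M = int (card {j. j < n \<and> ?B j < k})"
    unfolding M_def k_def using run_less_end_iff[OF assms(1,2,3) _ order_refl]
    by (intro arg_cong[where f = int] arg_cong[where f = card]) auto
  have ak: "a t \<le> k" using run_mono[of 0 n a b t] by (simp add: k_def)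
  have bij: "bij_betw ?B {j. j < n \<and> a t \<le> ?B j \<and> ?B j < k} {a t..<k}"
    unfolding bij_betw_def
  proof
    show "inj_on ?B {j. j < n \<and> a t \<le> ?B j \<and> ?B j < k}"
      using strict_mono_on_imp_inj_on[OF sB] by (rule inj_on_subset) auto
    show "?B ` {j. j < n \<and> a t \<le> ?B j \<and> ?B j < k} = {a t..<k}"
    proof (intro equalityI subsetI)
      fix c assume "c \<in> {a t..<k}"
      then obtain j' where "j' < n" "?B j' = c" using run_passes[of a t c b n] by (auto simp: k_def)
      then show "c \<in> ?B ` {j. j < n \<and> a t \<le> ?B j \<and> ?B j < k}" using \<open>c \<in> _\<close> by force
    qed auto
  qed
  have split: "{j. j < n \<and> ?B j < k} = {j. j < n \<and> ?B j < a t} \<union> {j. j < n \<and> a t \<le> ?B j \<and> ?B j < k}"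
    using ak by auto
  have "card {j. j < n \<and> ?B j < k} = card {j. j < n \<and> ?B j < a t} + card {j. j < n \<and> a t \<le> ?B j \<and> ?B j < k}"
    unfolding split by (rule card_Un_disjoint) auto
  then have "int (card {j. j < n \<and> ?B j < a t}) = M - (k - a t)"
    using bij_betw_same_card[OF bij] ak M by simp
  moreover have "hit a b t j \<longleftrightarrow> a t \<le> ?B j \<and> ?B j < k"
    using hit_iff_between[OF assms(2,4)] by (simp add: k_def)
  ultimately show ?thesis
    using card_below_iff[OF sB assms(4), of k] card_below_iff[OF sB assms(4), of "a t"] M by linarith
qed

section \<open>Antichains of hits and arrows over a point\<close>

lemma antichain_hits_le_arrows:
  assumes "strict_mono_on {..<m} a" "strict_mono_on {..<n} b"
    and S: "S \<subseteq> {..<m} \<times> {..<n}" "\<And>t j. (t, j) \<in> S \<Longrightarrow> hit a b t j"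
    and anti: "\<And>t j t' j'. (t, j) \<in> S \<Longrightarrow> (t', j') \<in> S \<Longrightarrow> t \<le> t' \<Longrightarrow> j \<le> j' \<Longrightarrow> (t, j) = (t', j')"
  shows "\<exists>r. card S \<le> card {t. t < m \<and> a t \<le> r \<and> r < run a b t n}"
proof (cases "S = {}")
  case False
  have fin: "finite S" using S(1) by (rule finite_subset) auto
  obtain p1 where p1: "p1 \<in> S" "\<And>p. p \<in> S \<Longrightarrow> fst p \<le> fst p1"
    using Max_in[of "fst ` S"] Max_ge[of "fst ` S"] fin False
    by (metis (no_types, lifting) finite_imageI image_is_empty imageE image_eqI)
  obtain p0 where p0: "p0 \<in> S" "\<And>p. p \<in> S \<Longrightarrow> fst p0 \<le> fst p"
    using Min_in[of "fst ` S"] Min_le[of "fst ` S"] fin False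
    by (metis (no_types, lifting) finite_imageI image_is_empty imageE image_eqI)
  obtain t1 j1 where e1: "p1 = (t1, j1)" by force
  obtain t0 j0 where e0: "p0 = (t0, j0)" by force
  \<comment> \<open>Along an antichain the column decreases as the row increases, so the two extreme
    cells are opposite corners of a box around \<open>S\<close>.\<close>
  have rng: "t0 \<le> t \<and> t \<le> t1 \<and> j1 \<le> j \<and> j \<le> j0" if "(t, j) \<in> S" for t j
    using p1(2)[OF that] p0(2)[OF that] anti[OF that p1(1)[unfolded e1]] anti[OF p0(1)[unfolded e0] that]
    by (auto simp: e0 e1) (metis nat_le_linear order_refl)+
  \<comment> \<open>Distinct cells of an antichain share neither row nor column, so the box has at
    least \<open>card S\<close> of each and holds a diagonal of that length.\<close>
  have "inj_on fst S" "inj_on snd S"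
    using anti by (auto simp: inj_on_def) (metis Pair_inject nat_le_linear order_refl)+
  moreover have "fst ` S \<subseteq> {t0..t1}" "snd ` S \<subseteq> {j1..j0}" using rng by auto
  ultimately have "card S \<le> card {t0..t1}" "card S \<le> card {j1..j0}"
    by (metis card_image card_mono finite_atLeastAtMost)+
  then have cd: "card S \<le> Suc t1 - t0" "card S \<le> Suc j0 - j1" by auto
  have bd: "t1 < m" "j0 < n" using S(1) p1(1) p0(1) e1 e0 by auto
  have rect: "hit a b t j" if "t0 \<le> t" "t \<le> t1" "j1 \<le> j" "j \<le> j0" for t j
    using hit_rectangle[OF assms(1,2) S(2)[OF p1(1)[unfolded e1]] S(2)[OF p0(1)[unfolded e0]] that bd] .
  let ?r = "run a b t1 j1"
  have diag: "run a b (t1 - u) (j1 + u) = ?r \<and> hit a b (t1 - u) (j1 + u)" if "u < card S" for u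
    using that
  proof (induction u)
    case 0
    then show ?case using rect[of t1 j1] cd by auto
  next
    case (Suc u)
    let ?t = "t1 - Suc u"
    have t: "t1 - u = Suc ?t" "t0 \<le> ?t" "?t \<le> t1" "j1 + u \<le> j0" "j1 + Suc u \<le> j0" using Suc.prems cd by linarith+
    have h: "hit a b ?t (j1 + u)" "hit a b ?t (j1 + Suc u)"
      using t(2-5) by (intro rect; linarith)+
    \<comment> \<open>Column \<open>j1 + u\<close> arrives at row \<open>Suc ?t\<close> with value
      \<open>?r\<close>. The preceding row \<open>?t\<close> hits this column, hence at value
      \<open>?r - 1\<close>; the hit lifts row \<open>?t\<close> to \<open>?r\<close>, with which it
      enters the next column.\<close>
    have "run a b (Suc ?t) (j1 + u) = ?r" "hit a b (Suc ?t) (j1 + u)" using Suc t(1) by auto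
    then have "run b a (j1 + u) (Suc ?t) = ?r" by simp
    then have "run b a (j1 + u) ?t + 1 = ?r" using h(1) by simp
    then have "run a b ?t (j1 + Suc u) = ?r" using h(1) by simp
    then show ?case using h(2) by blast
  qed
  have "(\<lambda>u. t1 - u) ` {..<card S} \<subseteq> {t. t < m \<and> a t \<le> ?r \<and> ?r < run a b t n}"
  proof (rule image_subsetI)
    fix u assume u: "u \<in> {..<card S}"
    have "j1 + u < n" "t1 - u < m" using u cd bd by auto
    then show "t1 - u \<in> {t. t < m \<and> a t \<le> ?r \<and> ?r < run a b t n}"
      using diag[of u] u hit_iff_between[OF assms(2), of "j1 + u" a "t1 - u"] by auto
  qed
  then have "card ((\<lambda>u. t1 - u) ` {..<card S}) \<le> card {t. t < m \<and> a t \<le> ?r \<and> ?r < run a b t n}"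
    by (intro card_mono) auto
  moreover have "inj_on (\<lambda>u. t1 - u) {..<card S}"
    using cd by (auto simp: inj_on_def)
  ultimately show ?thesis by (auto simp: card_image)
qed auto

text \<open>A row whose arrow goes over \<open>r\<close> leaves \<open>r\<close> through a hit in
  some column \<open>g t\<close>. Afterwards this column and all columns behind it exceed
  \<open>r\<close>, so a later row must meet \<open>r\<close> strictly earlier. Hence these hits
  form an antichain.\<close>

lemma arrows_le_antichain_hits:
  assumes "strict_mono_on {..<m} a" "strict_mono_on {..<n} b"
  shows "\<exists>S. S \<subseteq> {..<m} \<times> {..<n} \<and> (\<forall>(t, j)\<in>S. hit a b t j) \<and>
    (\<forall>(t, j)\<in>S. \<forall>(t', j')\<in>S. t \<le> t' \<longrightarrow> j \<le> j' \<longrightarrow> (t, j) = (t', j')) \<and>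
    card S = card {t. t < m \<and> a t \<le> r \<and> r < run a b t n}"
proof -
  let ?T = "{t. t < m \<and> a t \<le> r \<and> r < run a b t n}"
  have "\<forall>t\<in>?T. \<exists>j<n. run a b t j = r \<and> run b a j t = r"
    using run_passes by auto
  then obtain g where g: "\<And>t. t \<in> ?T \<Longrightarrow> g t < n \<and> run a b t (g t) = r \<and> run b a (g t) t = r"
    by metis
  have lt: "g t' < g t" if "t \<in> ?T" "t' \<in> ?T" "t < t'" for t t'
  proof (rule ccontr)
    assume "\<not> g t' < g t"
    then have "run b a (g t) t' \<le> run b a (g t') t'"
      using run_strict_mono[OF assms(2), of "g t" "g t'" a t'] g[OF that(2)] by (cases "g t = g t'") auto
    moreover have "run b a (g t) (Suc t) \<le> run b a (g t) t'" using that by (intro run_mono) simp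
    ultimately show False using g[OF that(1)] g[OF that(2)] by simp
  qed
  have "card ((\<lambda>t. (t, g t)) ` ?T) = card ?T" by (intro card_image) (auto simp: inj_on_def)
  moreover have "(\<lambda>t. (t, g t)) ` ?T \<subseteq> {..<m} \<times> {..<n}" using g by auto
  moreover have "\<forall>(t, j)\<in>(\<lambda>t. (t, g t)) ` ?T. hit a b t j" using g by auto
  moreover have "\<forall>(t, j)\<in>(\<lambda>t. (t, g t)) ` ?T. \<forall>(t', j')\<in>(\<lambda>t. (t, g t)) ` ?T.
      t \<le> t' \<longrightarrow> j \<le> j' \<longrightarrow> (t, j) = (t', j')"
  proof -
    have "t = t'" if "t \<in> ?T" "t' \<in> ?T" "t \<le> t'" "g t \<le> g t'" for t t'
      using lt[OF that(1,2)] that(3,4) by (meson leD le_neq_implies_less)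
    then show ?thesis by blast
  qed
  ultimately show ?thesis by blast
qed


section \<open>Arrows and caps\<close>

text \<open>Reversed because \<open>arrow_end\<close> recurses from \<open>i = m\<close> downwards
  and because the coordinates of lambda + rho increase in this direction.\<close>

definition mirrored_eps :: "nat \<Rightarrow> (idx \<Rightarrow> int) \<Rightarrow> nat \<Rightarrow> int" where
  "mirrored_eps m x t = x (Eps (m - t))"

definition neg_del :: "(idx \<Rightarrow> int) \<Rightarrow> nat \<Rightarrow> int" where
  "neg_del x j = - x (Del (Suc j))"

lemma Ball_neg_del: "(\<forall>j\<in>{1..n}. c \<noteq> - x (Del j)) \<longleftrightarrow> (\<forall>j<n. c \<noteq> neg_del x j)"
proof -
  have "{1..n} = Suc ` {..<n}" by (simp add: image_Suc_lessThan)
  then show ?thesis by (auto simp: neg_del_def)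
qed

lemma arrow_end_eq_run:
  assumes "strict_mono_on {..<m} (mirrored_eps m x)" "strict_mono_on {..<n} (neg_del x)" "t < m"
  shows "arrow_end m n x (m - t) = run (mirrored_eps m x) (neg_del x) t n"
  using assms(3)
proof (induction t rule: less_induct)
  case (less t)
  let ?a = "mirrored_eps m x" and ?b = "neg_del x"
  have "{m - t<..m} = (\<lambda>u. m - u) ` {..<t}"
  proof (intro equalityI subsetI)
    fix i assume "i \<in> {m - t<..m}"
    then show "i \<in> (\<lambda>u. m - u) ` {..<t}" by (intro image_eqI[of _ _ "m - i"]) auto
  qed (use less.prems in auto)
  then have "arrow_end m n x ` {m - t<..m} = (\<lambda>u. arrow_end m n x (m - u)) ` {..<t}"
    by (simp add: image_image)
  also have "\<dots> = (\<lambda>u. run ?a ?b u n) ` {..<t}"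
    using less by (intro image_cong) auto
  finally have im: "arrow_end m n x ` {m - t<..m} = (\<lambda>u. run ?a ?b u n) ` {..<t}" .
  show ?case
    unfolding arrow_end.simps[of m n x "m - t"] im
  proof (rule Least_equality)
    show "run ?a ?b t n \<ge> x (Eps (m - t)) \<and> (\<forall>j\<in>{1..n}. run ?a ?b t n \<noteq> - x (Del j)) \<and>
        run ?a ?b t n \<notin> (\<lambda>u. run ?a ?b u n) ` {..<t}"
      using run_end_free[OF assms(1,2) less.prems] run_mono[of 0 n ?a ?b t]
      unfolding Ball_neg_del by (auto simp: mirrored_eps_def)
  next
    fix c assume "c \<ge> x (Eps (m - t)) \<and> (\<forall>j\<in>{1..n}. c \<noteq> - x (Del j)) \<and>
        c \<notin> (\<lambda>u. run ?a ?b u n) ` {..<t}"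
    then show "run ?a ?b t n \<le> c"
      unfolding Ball_neg_del
      by (intro run_end_le[OF assms(1) less.prems]) (auto simp: mirrored_eps_def)
  qed
qed

lemma bij_betw_mirror: "bij_betw (\<lambda>t. m - t) {..<m} {1..m::nat}"
  by (rule bij_betw_byWitness[where f' = "\<lambda>i. m - i"]) auto

lemma bij_betw_Suc_lessThan: "bij_betw Suc {..<n} {1..n}"
  by (rule bij_betw_byWitness[where f' = "\<lambda>i. i - 1"]) auto

lemma card_arrows_over:
  assumes "strict_mono_on {..<m} (mirrored_eps m x)" "strict_mono_on {..<n} (neg_del x)"
  shows "card {i \<in> {1..m}. x (Eps i) \<le> r \<and> r < arrow_end m n x i} =
    card {t. t < m \<and> mirrored_eps m x t \<le> r \<and> r < run (mirrored_eps m x) (neg_del x) t n}"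
proof -
  have "{i \<in> {1..m}. x (Eps i) \<le> r \<and> r < arrow_end m n x i} =
      (\<lambda>t. m - t) ` {t. t < m \<and> mirrored_eps m x t \<le> r \<and> r < run (mirrored_eps m x) (neg_del x) t n}"
    (is "?L = _ ` ?R")
  proof (intro equalityI subsetI)
    fix i assume i: "i \<in> ?L"
    then have "m - i < m" "m - (m - i) = i" by auto
    then have "m - i \<in> ?R"
      using i arrow_end_eq_run[OF assms, of "m - i"] by (auto simp: mirrored_eps_def)
    then show "i \<in> (\<lambda>t. m - t) ` ?R" using \<open>m - (m - i) = i\<close> by force
  next
    fix i assume "i \<in> (\<lambda>t. m - t) ` ?R"
    then show "i \<in> ?L"
      using arrow_end_eq_run[OF assms] by (auto simp: mirrored_eps_def)
  qed
  moreover have "inj_on (\<lambda>t. m - t) ?R" by (auto simp: inj_on_def)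
  ultimately show ?thesis by (simp add: card_image)
qed

lemma card_at_most_one:
  assumes "\<And>x y. x \<in> X \<Longrightarrow> y \<in> X \<Longrightarrow> x = y"
  shows "card X = (if X = {} then 0 else 1)"
proof (cases "X = {}")
  case False
  then obtain x where "X = {x}" using assms by blast
  then show ?thesis by simp
qed simp

text \<open>Going from \<open>r - 1\<close> to \<open>r\<close> adds the arrows that start at
  \<open>r\<close> and removes those that end there. Starts and ends are injective, and an arrow
  ends at \<open>r\<close> exactly if \<open>r\<close> is no \<open>b j\<close> and some arrow
  starts at \<open>r\<close> or is open over \<open>r - 1\<close>. Truncated subtraction covers the
  case that none is open.\<close>

lemma card_arrows_step:
  fixes n :: nat
  assumes "strict_mono_on {..<m} a" "strict_mono_on {..<n} b"
  defines "H \<equiv> \<lambda>r. {t. t < m \<and> a t \<le> r \<and> r < run a b t n}"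
  shows "card (H r) =
    (if \<exists>t<m. a t = r
     then (if \<exists>j<n. b j = r then card (H (r - 1)) + 1 else card (H (r - 1)))
     else (if \<exists>j<n. b j = r then card (H (r - 1)) else card (H (r - 1)) - 1))"
proof -
  let ?k = "\<lambda>t. run a b t n"
  let ?S = "{t. t < m \<and> a t = r}" and ?E = "{t. t < m \<and> ?k t = r}"
  have fin: "finite (H r)" for r by (simp add: H_def)
  have ge: "a t \<le> ?k t" for t using run_mono[of 0 n a b t] by simp
  \<comment> \<open>An arrow of length zero at \<open>r\<close> lies in both \<open>?S\<close> and
    \<open>?E\<close> but goes over no point.\<close>
  have un: "H (r - 1) \<union> ?S = H r \<union> ?E"
  proof -
    have "a t \<le> r - 1 \<and> r - 1 < ?k t \<or> a t = r \<longleftrightarrow> a t \<le> r \<and> r < ?k t \<or> ?k t = r" for t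
      using ge[of t] by linarith
    then show ?thesis unfolding H_def set_eq_iff Un_iff mem_Collect_eq by blast
  qed
  have "card (H (r - 1) \<union> ?S) = card (H (r - 1)) + card ?S"
    using fin by (intro card_Un_disjoint) (auto simp: H_def)
  moreover have "card (H r \<union> ?E) = card (H r) + card ?E"
    using fin by (intro card_Un_disjoint) (auto simp: H_def)
  ultimately have eq: "card (H (r - 1)) + card ?S = card (H r) + card ?E"
    using un by simp
  have S: "card ?S = (if \<exists>t<m. a t = r then 1 else 0)"
  proof (subst card_at_most_one)
    show "t = t'" if "t \<in> ?S" "t' \<in> ?S" for t t'
      using that strict_mono_on_imp_inj_on[OF assms(1)] by (auto simp: inj_on_def)
  qed auto
  have E: "card ?E = (if ?E = {} then 0 else 1)"
  proof (rule card_at_most_one)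
    show "t = t'" if "t \<in> ?E" "t' \<in> ?E" for t t'
      using that run_end_free(2)[OF assms(1,2), of t] run_end_free(2)[OF assms(1,2), of t']
      by (cases t t' rule: linorder_cases) force+
  qed
  have "?E = {} \<longleftrightarrow> (\<exists>j<n. b j = r) \<or> H (r - 1) \<union> ?S = {}"
  proof
    assume e: "?E = {}"
    show "(\<exists>j<n. b j = r) \<or> H (r - 1) \<union> ?S = {}"
    proof (rule ccontr)
      assume c: "\<not> ?thesis"
      then obtain t where "t \<in> H r \<union> ?E" using un by auto
      then have t: "t < m" "a t \<le> r" "r < ?k t" using e by (auto simp: H_def)
      \<comment> \<open>With \<open>r\<close> free of columns and of earlier arrow ends, minimality
        of the end forbids an arrow to go over \<open>r\<close>.\<close>
      have "?k t \<le> r"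
      proof (rule run_end_le[OF assms(1) t(1,2)])
        show "\<forall>j<n. r \<noteq> b j" using c by auto
        show "\<forall>u<t. r \<noteq> ?k u"
        proof (intro allI impI notI)
          fix u assume "u < t" "r = ?k u"
          then have "u \<in> ?E" using t(1) by simp
          then show False using e by blast
        qed
      qed
      then show False using t by simp
    qed
  next
    assume "(\<exists>j<n. b j = r) \<or> H (r - 1) \<union> ?S = {}"
    then show "?E = {}"
    proof
      assume "\<exists>j<n. b j = r"
      then obtain j where "j < n" "b j = r" by blast
      then have "?k t \<noteq> r" if "t < m" for t
        using run_end_free(1)[OF assms(1,2) that] by auto
      then show ?thesis by blast
    qed (use un in blast)
  qed
  moreover have "H (r - 1) \<union> ?S = {} \<longleftrightarrow> card (H (r - 1)) = 0 \<and> \<not> (\<exists>t<m. a t = r)"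
    using fin by auto
  ultimately have E': "card ?E = (if (\<exists>j<n. b j = r) \<or> (card (H (r - 1)) = 0 \<and> \<not> (\<exists>t<m. a t = r)) then 0 else 1)"
    using E by argo
  have arith: "h = (if A then (if B then h0 + 1 else h0) else (if B then h0 else h0 - 1))"
    if "h0 + s = h + e" "s = (if A then 1 else 0)" "e = (if B \<or> (h0 = 0 \<and> \<not> A) then 0 else 1)"
    for h0 s h e :: nat and A B
    using that by (auto split: if_splits)
  show ?thesis by (rule arith[OF eq S E'])
qed

section \<open>Caps as first returns of a walk\<close>

fun symb_weight :: "symb \<Rightarrow> int" where
  "symb_weight Cross = 1"
| "symb_weight Circ = -1"
| "symb_weight _ = 0"

text \<open>The height of a walk that goes up at crosses and down at circles. By
  \<open>balance_eq_card\<close> a cap ends where the walk from its start first returns to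
  zero.\<close>

definition balance :: "(int \<Rightarrow> symb) \<Rightarrow> int \<Rightarrow> int \<Rightarrow> int" where
  "balance D p q = (\<Sum>t\<in>{p..q}. symb_weight (D t))"

lemma balance_eq_card:
  "balance D p q = int (card {t \<in> {p..q}. D t = Cross}) - int (card {t \<in> {p..q}. D t = Circ})"
proof -
  have "symb_weight s = (if s = Cross then 1 else 0) - (if s = Circ then 1 else 0)" for s
    by (cases s) auto
  then show ?thesis
    by (simp add: balance_def sum_subtractf sum.If_cases Int_def conj_commute)
qed

lemma balance_split: "p \<le> s + 1 \<Longrightarrow> s \<le> q \<Longrightarrow> balance D p q = balance D p s + balance D (s + 1) q"
proof -
  assume "p \<le> s + 1" "s \<le> q"
  then have "{p..q} = {p..s} \<union> {s + 1..q}" by auto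
  then show ?thesis unfolding balance_def by (simp only:) (rule sum.union_disjoint, auto)
qed

lemma balance_single [simp]: "balance D p p = symb_weight (D p)"
  by (simp add: balance_def)

lemma balance_empty [simp]: "q < p \<Longrightarrow> balance D p q = 0"
  by (simp add: balance_def)

lemma balance_last: "p \<le> q \<Longrightarrow> balance D p q = balance D p (q - 1) + symb_weight (D q)"
  using balance_split[of p "q - 1" q D] by simp

lemma symb_weight_ge: "symb_weight s \<ge> -1"
  by (cases s) auto

text \<open>Downward steps have size one, so a walk starting at 1 cannot become nonpositive without
  visiting zero.\<close>

lemma balance_pos:
  assumes "D p = Cross" "\<And>q. p < q \<Longrightarrow> q \<le> r \<Longrightarrow> balance D p q \<noteq> 0" "p \<le> q" "q \<le> r"
  shows "balance D p q \<ge> 1"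
  using assms(3,4)
proof (induction q rule: int_ge_induct)
  case (step q)
  then show ?case
    using balance_last[of p "q + 1" D] symb_weight_ge[of "D (q + 1)"] assms(2)[of "q + 1"] by simp
qed (use assms in simp)

text \<open>On \<open>int\<close> a minimum needs a lower bound; it is found among the naturals
  counted from \<open>lo\<close>.\<close>

lemma Least_int_exists:
  fixes P :: "int \<Rightarrow> bool"
  assumes "P q" "\<And>q. P q \<Longrightarrow> lo \<le> q"
  shows "P (LEAST q. P q)" "\<And>q. P q \<Longrightarrow> (LEAST q. P q) \<le> q"
proof -
  obtain k where k: "P (lo + int k)" "\<And>k'. P (lo + int k') \<Longrightarrow> k \<le> k'"
  proof -
    have "P (lo + int (nat (q - lo)))" using assms by force
    then show ?thesis using that[of "LEAST k. P (lo + int k)"] by (metis (mono_tags) LeastI_ex Least_le)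
  qed
  have min: "lo + int k \<le> q'" if "P q'" for q'
  proof -
    have "lo \<le> q'" using assms(2) that .
    then have "k \<le> nat (q' - lo)" using k(2)[of "nat (q' - lo)"] that by simp
    then show ?thesis using \<open>lo \<le> q'\<close> by simp
  qed
  then have "(LEAST q. P q) = lo + int k" using k(1) by (intro Least_equality)
  then show "P (LEAST q. P q)" "\<And>q. P q \<Longrightarrow> (LEAST q. P q) \<le> q"
    using k min by auto
qed

lemma caps_step_arith:
  fixes h0 c h e :: nat
  assumes "h0 + c = h + e" "c = (if s = Cross then 1 else 0)" "e = (if P then 0 else 1)"
      "\<not> P \<longleftrightarrow> s = Circ \<and> h0 \<noteq> 0"
  shows "h = (case s of Cross \<Rightarrow> h0 + 1 | Circ \<Rightarrow> h0 - 1 | _ \<Rightarrow> h0)"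
  using assms by (cases s; cases P; auto)

context
  fixes D :: "int \<Rightarrow> symb" and cap :: "int \<Rightarrow> int" and G :: "int \<Rightarrow> int set"
  assumes fin_D: "finite {t. D t \<noteq> Circ}"
  defines "cap \<equiv> \<lambda>p. LEAST q. q > p \<and>
    card {t \<in> {p..q}. D t = Cross} = card {t \<in> {p..q}. D t = Circ}"
  defines "G \<equiv> \<lambda>r. {p. D p = Cross \<and> p \<le> r \<and> r < cap p}"
begin

lemma cap_eq: "cap p = (LEAST q. q > p \<and> balance D p q = 0)"
  unfolding cap_def balance_eq_card by simp

lemma balance_vanishes:
  assumes "D p = Cross"
  shows "\<exists>q>p. balance D p q = 0"
proof (rule ccontr)
  assume no: "\<not> ?thesis"
  define N where "N = card {t. D t \<noteq> Circ}"
  \<comment> \<open>Of the 2 N + 1 positions from \<open>p\<close> to \<open>q\<close> at most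
    \<open>N\<close> are not circles, so the circles outnumber the crosses and the walk has become
    negative.\<close>
  define q where "q = p + 2 * int N"
  have "{p..q} = {t \<in> {p..q}. D t = Circ} \<union> {t \<in> {p..q}. D t \<noteq> Circ}" by auto
  then have "card {p..q} \<le> card {t \<in> {p..q}. D t = Circ} + card {t \<in> {p..q}. D t \<noteq> Circ}"
    by (metis (lifting) card_Un_le)
  moreover have "card {t \<in> {p..q}. D t \<noteq> Circ} \<le> N" "card {t \<in> {p..q}. D t = Cross} \<le> N"
    unfolding N_def using fin_D by (auto intro!: card_mono)
  moreover have "card {p..q} = 2 * N + 1" by (simp add: q_def)
  ultimately have "balance D p q \<le> -1" unfolding balance_eq_card by linarith
  moreover have "balance D p q \<ge> 1" using balance_pos[where D = D and p = p and q = q and r = q] assms no by (auto simp: q_def)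
  ultimately show False by simp
qed

lemma cap_props:
  assumes "D p = Cross"
  shows "p < cap p" "balance D p (cap p) = 0" "\<And>q. p \<le> q \<Longrightarrow> q < cap p \<Longrightarrow> balance D p q \<ge> 1"
proof -
  obtain q where q: "q > p \<and> balance D p q = 0" using balance_vanishes[OF assms] by blast
  have *: "cap p > p \<and> balance D p (cap p) = 0" "\<And>q. q > p \<and> balance D p q = 0 \<Longrightarrow> cap p \<le> q"
    unfolding cap_eq using Least_int_exists[of "\<lambda>q. q > p \<and> balance D p q = 0", OF q, of p] by auto
  show "p < cap p" "balance D p (cap p) = 0" using * by auto
  show "balance D p q \<ge> 1" if "p \<le> q" "q < cap p" for q
  proof (rule balance_pos[where r = "cap p - 1"])
    show "balance D p q' \<noteq> 0" if "p < q'" "q' \<le> cap p - 1" for q'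
    proof
      assume "balance D p q' = 0"
      then have "cap p \<le> q'" using *(2)[of q'] that by simp
      then show False using that by simp
    qed
  qed (use assms that in auto)
qed

text \<open>The counterpart of \<open>card_arrows_step\<close>: a cross opens a cap, and a circle
  closes exactly one cap if any is open.\<close>

lemma card_caps_step:
  "card (G r) =
    (case D r of Cross \<Rightarrow> card (G (r - 1)) + 1 | Circ \<Rightarrow> card (G (r - 1)) - 1 | _ \<Rightarrow> card (G (r - 1)))"
proof -
  let ?S = "{p. p = r \<and> D p = Cross}" and ?E = "{p. D p = Cross \<and> cap p = r}"
  have "finite {p. D p = Cross}" by (rule finite_subset[OF _ fin_D]) auto
  then have fin: "finite (G r)" "finite ?S" "finite ?E" for r
    by (auto simp: G_def intro: rev_finite_subset)
  have un: "G (r - 1) \<union> ?S = G r \<union> ?E"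
  proof -
    have "p \<le> r - 1 \<and> r - 1 < cap p \<or> p = r \<longleftrightarrow> p \<le> r \<and> r < cap p \<or> cap p = r" if "D p = Cross" for p
      using cap_props(1)[OF that] by linarith
    then show ?thesis unfolding G_def set_eq_iff Un_iff mem_Collect_eq by blast
  qed
  have "card (G (r - 1) \<union> ?S) = card (G (r - 1)) + card ?S"
    by (intro card_Un_disjoint fin) (auto simp: G_def)
  moreover have "card (G r \<union> ?E) = card (G r) + card ?E"
    by (intro card_Un_disjoint fin) (auto simp: G_def)
  ultimately have eq: "card (G (r - 1)) + card ?S = card (G r) + card ?E"
    using un by simp
  have S: "card ?S = (if D r = Cross then 1 else 0)"
  proof -
    have "?S = (if D r = Cross then {r} else {})" by auto
    then show ?thesis by simp
  qed
  \<comment> \<open>If both caps ended at \<open>r\<close>, the outer walk would vanish just before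
    the inner start \<open>p'\<close>, although it stays positive before \<open>r\<close>.\<close>
  have inj: "\<not> p < p'" if "p \<in> ?E" "p' \<in> ?E" for p p'
  proof
    assume "p < p'"
    have "p' < r" using that cap_props(1)[of p'] by auto
    then have "balance D p (p' - 1) = 0"
      using balance_split[of p "p' - 1" r D] cap_props(2)[of p] cap_props(2)[of p'] that \<open>p < p'\<close> by auto
    moreover have "balance D p (p' - 1) \<ge> 1"
      using cap_props(3)[of p "p' - 1"] that \<open>p < p'\<close> \<open>p' < r\<close> by auto
    ultimately show False by simp
  qed
  have E: "card ?E = (if ?E = {} then 0 else 1)"
  proof (rule card_at_most_one)
    show "p = p'" if "p \<in> ?E" "p' \<in> ?E" for p p'
      using inj[OF that] inj[OF that(2,1)] by linarith
  qed
  have "?E \<noteq> {} \<longleftrightarrow> D r = Circ \<and> G (r - 1) \<noteq> {}"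
  proof
    assume "?E \<noteq> {}"
    then obtain p where p: "D p = Cross" "cap p = r" by blast
    have "p \<in> G (r - 1)" using cap_props(1)[OF p(1)] p by (auto simp: G_def)
    moreover have "symb_weight (D r) < 0"
      using balance_last[of p r D] cap_props(1-2)[OF p(1)] cap_props(3)[OF p(1), of "r - 1"] p by simp
    then have "D r = Circ" by (cases "D r") auto
    ultimately show "D r = Circ \<and> G (r - 1) \<noteq> {}" by auto
  next
    assume r: "D r = Circ \<and> G (r - 1) \<noteq> {}"
    then obtain p where "p \<in> G (r - 1)" by blast
    then have p: "D p = Cross" "p \<le> r - 1" "r - 1 < cap p" by (auto simp: G_def)
    \<comment> \<open>The circle at \<open>r\<close> closes the innermost open cap, which starts at
      the last position whose walk up to \<open>r - 1\<close> is positive. Maximality forces an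
      upward step at this position and height exactly 1 at \<open>r - 1\<close>.\<close>
    let ?P = "{p' \<in> {p..r - 1}. balance D p' (r - 1) \<ge> 1}"
    have "p \<in> ?P" using cap_props(3)[OF p(1,2)] p by auto
    moreover have finP: "finite ?P" by (rule finite_subset[of _ "{p..r - 1}"]) auto
    ultimately have P: "Max ?P \<in> ?P" by (intro Max_in) auto
    define p' where "p' = Max ?P"
    have p': "p \<le> p'" "p' \<le> r - 1" "balance D p' (r - 1) \<ge> 1" using P by (auto simp: p'_def)
    have neg: "balance D q (r - 1) \<le> 0" if "p' < q" for q
    proof (cases "q \<le> r - 1")
      case True
      then show ?thesis using Max_ge[OF finP, of q] that p'(1) by (force simp: p'_def)
    qed simp
    have pos: "balance D p' q \<ge> 1" if "p' \<le> q" "q \<le> r - 1" for q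
      using balance_split[of p' q "r - 1" D] that neg[of "q + 1"] p' by simp
    have "balance D p' (r - 1) = symb_weight (D p') + balance D (p' + 1) (r - 1)"
      using balance_split[of p' p' "r - 1" D] p' by simp
    moreover have "symb_weight (D p') \<le> 1" by (cases "D p'") auto
    ultimately have b: "symb_weight (D p') = 1" "balance D p' (r - 1) = 1"
      using neg[of "p' + 1"] p' by auto
    then have "D p' = Cross" by (cases "D p'") auto
    moreover have "cap p' = r"
      unfolding cap_eq
    proof (rule Least_equality)
      show "r > p' \<and> balance D p' r = 0"
        using balance_last[of p' r D] b p' r by simp
    next
      fix q assume q: "q > p' \<and> balance D p' q = 0"
      show "r \<le> q"
      proof (rule ccontr)
        assume "\<not> r \<le> q"
        then show False using pos[of q] q by simp
      qed
    qed
    ultimately show "?E \<noteq> {}" by auto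
  qed
  then have E': "\<not> ?E = {} \<longleftrightarrow> D r = Circ \<and> card (G (r - 1)) \<noteq> 0" using fin by simp
  show ?thesis by (rule caps_step_arith[OF eq S E E'])
qed

end

text \<open>Both counts vanish far to the left and obey the same recursion in \<open>r\<close>.
  Arrows and caps need not match individually: an arrow can end at a \<open>Greater\<close>, where
  no cap ends.\<close>

lemma card_caps_over:
  assumes "strict_mono_on {..<m} (mirrored_eps m x)" "strict_mono_on {..<n} (neg_del x)"
  shows "card {p. diagram m n x p = Cross \<and> p \<le> r \<and> r < cap_end m n x p} =
    card {t. t < m \<and> mirrored_eps m x t \<le> r \<and> r < run (mirrored_eps m x) (neg_del x) t n}"
proof -
  let ?a = "mirrored_eps m x" and ?b = "neg_del x" and ?D = "diagram m n x"
  let ?H = "\<lambda>r. {t. t < m \<and> ?a t \<le> r \<and> r < run ?a ?b t n}"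
  let ?G = "\<lambda>r. {p. ?D p = Cross \<and> p \<le> r \<and> r < cap_end m n x p}"
  have A: "(\<exists>i\<in>{1..m}. p = x (Eps i)) \<longleftrightarrow> (\<exists>t<m. ?a t = p)" for p
    unfolding bij_betw_imp_surj_on[OF bij_betw_mirror, symmetric] by (auto simp: mirrored_eps_def)
  have B: "(\<exists>j\<in>{1..n}. p = - x (Del j)) \<longleftrightarrow> (\<exists>j<n. ?b j = p)" for p
    unfolding bij_betw_imp_surj_on[OF bij_betw_Suc_lessThan, symmetric] by (auto simp: neg_del_def)
  have D: "?D p = (if \<exists>t<m. ?a t = p then (if \<exists>j<n. ?b j = p then Cross else Greater)
      else (if \<exists>j<n. ?b j = p then Less else Circ))" for p
    unfolding diagram_def A B ..
  have "{t. ?D t \<noteq> Circ} \<subseteq> ?a ` {..<m} \<union> ?b ` {..<n}"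
    by (auto simp: D split: if_splits)
  then have fin: "finite {t. ?D t \<noteq> Circ}" by (rule finite_subset) auto
  \<comment> \<open>Up to \<open>lo\<close> no arrow and no cap has started; the inserted 0 keeps
    \<open>Min\<close> meaningful for \<open>m = 0\<close>.\<close>
  define lo where "lo = Min (insert 0 (?a ` {..<m})) - 1"
  have lo: "lo < ?a t" if "t < m" for t
  proof -
    have "Min (insert 0 (?a ` {..<m})) \<le> ?a t" using that by (intro Min_le) auto
    then show ?thesis by (simp add: lo_def)
  qed
  have empty: "?H r = {}" "?G r = {}" if "r \<le> lo" for r
  proof -
    show "?H r = {}" using lo that by (force simp: not_le)
    have "\<exists>t<m. ?a t = p" if "?D p = Cross" for p using that by (auto simp: D split: if_splits)
    then show "?G r = {}" using lo that by (force simp: not_le)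
  qed
  have "card (?G r) = card (?H r)" if "lo \<le> r" for r
    using that
  proof (induction r rule: int_ge_induct)
    case (step r)
    have "card (?G (r + 1)) = (case ?D (r + 1) of Cross \<Rightarrow> card (?G r) + 1
        | Circ \<Rightarrow> card (?G r) - 1 | _ \<Rightarrow> card (?G r))"
      using card_caps_step[OF fin, of "r + 1"] by (simp only: cap_end_def add_diff_cancel_right')
    also have "\<dots> = card (?H (r + 1))"
      unfolding step.IH card_arrows_step[OF assms, of "r + 1"] add_diff_cancel_right'
      by (auto simp only: D symb.case split: if_split)
    finally show ?case .
  qed (simp only: empty[OF order_refl] card.empty)
  then show ?thesis
  proof (cases "lo \<le> r")
    case False
    then show ?thesis by (simp only: empty[of r] card.empty not_le less_imp_le)
  qed
qed


section \<open>Highest weight vectors and odd reflections\<close>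

lemma finite_idxs [simp]: "finite (idxs m n)"
  by (simp add: idxs_def)

lemma sum_fun_apply: "(\<Sum>x\<in>A. f x) a = (\<Sum>x\<in>A. f x a)"
  by (induction A rule: infinite_finite_induct) auto

lemma mat_unit_in_gl: "a \<in> idxs m n \<Longrightarrow> b \<in> idxs m n \<Longrightarrow> mat_unit a b \<in> gl m n"
  by (auto simp: gl_def mat_unit_def)

lemma mat_unit_in_gl_part:
  "a \<in> idxs m n \<Longrightarrow> b \<in> idxs m n \<Longrightarrow> mat_unit a b \<in> gl_part m n (odd_idx a \<noteq> odd_idx b)"
  by (auto simp: gl_part_def mat_unit_in_gl) (auto simp: mat_unit_def split: if_splits)

lemma mat_scale_in_gl: "X \<in> gl m n \<Longrightarrow> mat_scale c X \<in> gl m n"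
  by (auto simp: gl_def mat_scale_def)

lemma mat_mul_unit:
  assumes "b \<in> idxs m n"
  shows "mat_mul m n (mat_unit a b) (mat_unit c d) = (if b = c then mat_unit a d else 0)"
proof (intro ext)
  fix r s
  have "mat_mul m n (mat_unit a b) (mat_unit c d) r s
      = (\<Sum>k\<in>idxs m n. if k = b then (if r = a \<and> b = c \<and> s = d then 1 else 0) else 0)"
    unfolding mat_mul_def by (rule sum.cong) (auto simp: mat_unit_def)
  also have "\<dots> = (if r = a \<and> b = c \<and> s = d then 1 else 0)"
    using assms by simp
  finally show "mat_mul m n (mat_unit a b) (mat_unit c d) r s
      = (if b = c then mat_unit a d else 0) r s"
    by (auto simp: mat_unit_def)
qed

lemma zero_in_gl: "0 \<in> gl m n"
  by (simp add: gl_def)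

lemma add_in_gl:
  assumes "X \<in> gl m n" "Y \<in> gl m n"
  shows "X + Y \<in> gl m n"
proof -
  have "gl m n = {X. \<forall>a b. \<not> (a \<in> idxs m n \<and> b \<in> idxs m n) \<longrightarrow> X a b = 0}"
    unfolding gl_def by blast
  then show ?thesis using assms by auto
qed

lemma gl_expand:
  assumes "X \<in> gl m n"
  shows "X = (\<Sum>(a, b)\<in>idxs m n \<times> idxs m n. mat_scale (X a b) (mat_unit a b))"
proof (intro ext)
  fix r s
  have "(\<Sum>(a, b)\<in>idxs m n \<times> idxs m n. mat_scale (X a b) (mat_unit a b)) r s
      = (\<Sum>p\<in>idxs m n \<times> idxs m n. if p = (r, s) then X r s else 0)"
    unfolding sum_fun_apply
    by (rule sum.cong) (auto simp: mat_scale_def mat_unit_def split: if_splits)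
  also have "\<dots> = X r s"
    using assms by (auto simp: gl_def)
  finally show "X r s = (\<Sum>(a, b)\<in>idxs m n \<times> idxs m n. mat_scale (X a b) (mat_unit a b)) r s" ..
qed

text \<open>Write \<open>x\<close> as a combination of finitely many eigenvectors in
  \<open>G\<close> and apply the product of \<open>D - l\<close> over their eigenvalues
  \<open>l\<close>. It kills \<open>x\<close>, yet acts on it as the product of the numbers
  \<open>\<mu> - l\<close>, so one of these is zero.\<close>

lemma (in vector_space) eigenvalue_in_span:
  assumes lin: "Vector_Spaces.linear scale scale D"
    and G: "\<And>g. g \<in> G \<Longrightarrow> \<exists>l\<in>\<Lambda>. D g = scale l g"
    and x: "x \<in> span G" "x \<noteq> 0" "D x = scale \<mu> x"
  shows "\<mu> \<in> \<Lambda>"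
proof -
  interpret D: Vector_Spaces.linear scale scale D by (rule lin)
  define annihilate where "annihilate L = foldr (\<lambda>l y. D y - scale l y) L" for L
  have ann: "annihilate [] y = y" "annihilate (l # L) y = D (annihilate L y) - scale l (annihilate L y)" for l L y
    by (simp_all add: annihilate_def)
  have add: "annihilate L (y + z) = annihilate L y + annihilate L z" for L y z
    by (induction L) (auto simp: ann D.add scale_right_distrib)
  have scl: "annihilate L (scale c y) = scale c (annihilate L y)" for L c y
    by (induction L) (auto simp: ann D.scale scale_right_diff_distrib mult.commute)
  have eig: "annihilate L y = scale (\<Prod>l'\<leftarrow>L. l - l') y" if "D y = scale l y" for L y l
    using that by (induction L) (auto simp: ann D.scale scale_left_diff_distrib algebra_simps)
  have "\<exists>L. set L \<subseteq> \<Lambda> \<and> annihilate L x = 0"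
    using x(1)
  proof (induction rule: span_induct_alt)
    case base
    show ?case by (intro exI[of _ "[]"]) (simp add: ann)
  next
    case (step c g y)
    then obtain L where L: "set L \<subseteq> \<Lambda>" "annihilate L y = 0" by blast
    obtain l where l: "l \<in> \<Lambda>" "D g = scale l g" using G step by blast
    have "annihilate (l # L) g = 0" using eig[OF l(2), of "l # L"] by simp
    moreover have "annihilate (l # L) y = 0" using L by (simp add: ann D.zero)
    ultimately have "annihilate (l # L) (scale c g + y) = 0"
      unfolding add scl by simp
    then show ?case using L l by (intro exI[of _ "l # L"]) simp
  qed
  then obtain L where L: "set L \<subseteq> \<Lambda>" "annihilate L x = 0" by blast
  then have "(\<Prod>l'\<leftarrow>L. \<mu> - l') = 0" using eig[OF x(3)] x(2) by simp
  then have "\<mu> \<in> set L" by (auto simp: prod_list_zero_iff)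
  then show ?thesis using L by blast
qed

context gl_module
begin

abbreviation E :: "idx \<Rightarrow> idx \<Rightarrow> 'v \<Rightarrow> 'v" where
  "E a b \<equiv> act (mat_unit a b)"

lemma act_lin:
  assumes "X \<in> gl m n"
  shows "act X (u + v) = act X u + act X v" "act X (scale c v) = scale c (act X v)" "act X 0 = 0"
    "act X (sum g A) = (\<Sum>x\<in>A. act X (g x))"
proof -
  interpret X: Vector_Spaces.linear scale scale "act X" by (rule act_linear[OF assms])
  show "act X (u + v) = act X u + act X v" "act X (scale c v) = scale c (act X v)" "act X 0 = 0"
    "act X (sum g A) = (\<Sum>x\<in>A. act X (g x))"
    by (auto simp: X.add X.scale X.zero X.sum)
qed

lemma act_zero: "act 0 v = 0"
proof -
  have "mat_scale 0 (0 :: cmat) = 0" by (simp add: mat_scale_def fun_eq_iff)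
  then show ?thesis using act_scale[OF zero_in_gl, of 0 v] by simp
qed

lemma act_diff_scale:
  assumes "X \<in> gl m n" "Y \<in> gl m n"
  shows "act (X - mat_scale s Y) v = act X v - scale s (act Y v)"
proof -
  have eq: "X - mat_scale s Y = X + mat_scale (- s) Y" by (simp add: mat_scale_def fun_eq_iff)
  show ?thesis
    unfolding eq act_add[OF assms(1) mat_scale_in_gl[OF assms(2)]] act_scale[OF assms(2)] by simp
qed

lemma act_sum:
  assumes "\<And>p. p \<in> F \<Longrightarrow> g p \<in> gl m n" "finite F"
  shows "act (\<Sum>p\<in>F. g p) v = (\<Sum>p\<in>F. act (g p) v) \<and> (\<Sum>p\<in>F. g p) \<in> gl m n"
  using assms(2,1)
proof (induction F)
  case empty
  then show ?case by (simp only: sum.empty act_zero zero_in_gl simp_thms)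
next
  case (insert p F)
  then have "act (g p + sum g F) v = act (g p) v + act (sum g F) v"
    by (intro act_add) auto
  moreover have "g p + sum g F \<in> gl m n"
    using insert by (intro add_in_gl) auto
  ultimately show ?case
    unfolding sum.insert[OF insert.hyps(1,2)] using insert by (simp only: insertI2 simp_thms)
qed

lemma act_expand:
  assumes "X \<in> gl m n"
  shows "act X v = (\<Sum>(a, b)\<in>idxs m n \<times> idxs m n. scale (X a b) (E a b v))"
proof -
  have "act X v = (\<Sum>p\<in>idxs m n \<times> idxs m n. act (case p of (a, b) \<Rightarrow> mat_scale (X a b) (mat_unit a b)) v)"
    by (subst gl_expand[OF assms], rule conjunct1[OF act_sum])
      (auto intro: mat_scale_in_gl mat_unit_in_gl)
  also have "\<dots> = (\<Sum>(a, b)\<in>idxs m n \<times> idxs m n. scale (X a b) (E a b v))"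
    by (rule sum.cong) (auto simp: act_scale mat_unit_in_gl)
  finally show ?thesis .
qed

lemma act_swap:
  assumes "a \<in> idxs m n" "b \<in> idxs m n" "c \<in> idxs m n" "d \<in> idxs m n"
  defines "s \<equiv> super_sign (odd_idx a \<noteq> odd_idx b) (odd_idx c \<noteq> odd_idx d)"
  shows "E a b (E c d v) = scale s (E c d (E a b v)) + (if b = c then E a d v else 0)
    - scale s (if d = a then E c b v else 0)"
proof -
  let ?X = "if b = c then mat_unit a d else 0" and ?Y = "if d = a then mat_unit c b else 0"
  have "act (super_bracket m n (odd_idx a \<noteq> odd_idx b) (odd_idx c \<noteq> odd_idx d) (mat_unit a b) (mat_unit c d)) v
      = act (?X - mat_scale s ?Y) v"
    using assms by (simp add: super_bracket_def mat_mul_unit)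
  also have "\<dots> = act ?X v - scale s (act ?Y v)"
    using assms by (intro act_diff_scale) (auto simp: mat_unit_in_gl zero_in_gl)
  also have "\<dots> = (if b = c then E a d v else 0) - scale s (if d = a then E c b v else 0)"
    by (auto simp: act_zero)
  finally have "E a b (E c d v) - scale s (E c d (E a b v))
      = (if b = c then E a d v else 0) - scale s (if d = a then E c b v else 0)"
    using act_bracket[OF mat_unit_in_gl_part[OF assms(1,2)] mat_unit_in_gl_part[OF assms(3,4)], of v]
    by (simp only: s_def)
  then show ?thesis by (simp only: diff_eq_eq) (simp only: algebra_simps)
qed

lemma act_diag_swap:
  assumes "a \<in> idxs m n" "c \<in> idxs m n" "d \<in> idxs m n"
  shows "E a a (E c d v) = E c d (E a a v) + scale ((if a = c then 1 else 0) - (if a = d then 1 else 0)) (E c d v)"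
  using act_swap[OF assms(1) assms(1) assms(2,3), of v] by (auto simp: super_sign_def)

text \<open>The Borel subalgebra enters through a ranking \<open>f\<close> of the indices, so that
  an odd reflection merely exchanges two neighbours.\<close>

definition hwv :: "(idx \<Rightarrow> nat) \<Rightarrow> weight \<Rightarrow> 'v \<Rightarrow> bool" where
  "hwv f \<nu> v \<longleftrightarrow> v \<noteq> 0 \<and> (\<forall>a\<in>idxs m n. E a a v = scale (\<nu> a) v) \<and>
     (\<forall>a\<in>idxs m n. \<forall>b\<in>idxs m n. f a < f b \<longrightarrow> E a b v = 0)"

section \<open>Uniqueness of the highest weight in a simple module\<close>

lemma grading_components_zero:
  assumes "x \<in> V False" "y \<in> V True" "x + y = 0"
  shows "x = 0" "y = 0"
proof -
  have "x = - y" using assms by (simp add: eq_neg_iff_add_eq_0)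
  then have "x \<in> V True" using subspace_neg[OF grading_subspace assms(2)] by simp
  then show "x = 0" using grading_disjoint assms by auto
  then show "y = 0" using assms by simp
qed

text \<open>Submodules are graded by definition, so a generating vector should be homogeneous. Each
  \<open>E a b\<close> has a parity, hence the defining equations hold for both components of
  \<open>v\<close> separately.\<close>

lemma hwv_homogeneous:
  assumes "hwv f \<nu> v"
  shows "\<exists>v' q. v' \<in> V q \<and> hwv f \<nu> v'"
proof -
  obtain x y where xy: "x \<in> V False" "y \<in> V True" "v = x + y" using grading_sum by blast
  have split0: "E a b x = 0 \<and> E a b y = 0"
    if "a \<in> idxs m n" "b \<in> idxs m n" "E a b v = 0" for a b
  proof -
    note part = mat_unit_in_gl_part[OF that(1,2)]
    have s: "E a b x + E a b y = 0" using that xy act_lin(1)[OF mat_unit_in_gl[OF that(1,2)], of x y] by simp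
    show ?thesis
    proof (cases "odd_idx a \<noteq> odd_idx b")
      case True
      then have "E a b x \<in> V True" "E a b y \<in> V False"
        using act_parity[OF part xy(1)] act_parity[OF part xy(2)] by auto
      then show ?thesis using grading_components_zero[of "E a b y" "E a b x"] s by (simp add: add.commute)
    next
      case False
      then have "E a b x \<in> V False" "E a b y \<in> V True"
        using act_parity[OF part xy(1)] act_parity[OF part xy(2)] by auto
      then show ?thesis using grading_components_zero[of "E a b x" "E a b y"] s by simp
    qed
  qed
  have diag: "E a a x = scale (\<nu> a) x \<and> E a a y = scale (\<nu> a) y" if a: "a \<in> idxs m n" for a
  proof -
    note part = mat_unit_in_gl_part[OF a a]
    have "E a a x \<in> V False" "E a a y \<in> V True"
      using act_parity[OF part xy(1)] act_parity[OF part xy(2)] by auto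
    then have in_V: "E a a x - scale (\<nu> a) x \<in> V False" "E a a y - scale (\<nu> a) y \<in> V True"
      using xy grading_subspace by (auto intro!: subspace_diff subspace_scale)
    have "E a a v = scale (\<nu> a) v" using assms a by (simp add: hwv_def)
    then have "(E a a x - scale (\<nu> a) x) + (E a a y - scale (\<nu> a) y) = 0"
      using act_lin(1)[OF mat_unit_in_gl[OF a a], of x y] xy(3) by (simp add: scale_right_distrib add_diff_add[symmetric])
    then show ?thesis using grading_components_zero[OF in_V] by simp
  qed
  have "hwv f \<nu> x" if "x \<noteq> 0" using that diag split0 assms by (simp add: hwv_def)
  moreover have "hwv f \<nu> y" if "y \<noteq> 0" using that diag split0 assms by (simp add: hwv_def)
  moreover have "x \<noteq> 0 \<or> y \<noteq> 0" using assms xy by (auto simp: hwv_def)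
  ultimately show ?thesis using xy by blast
qed

text \<open>The monomials in the lowering operators for \<open>f\<close> applied to
  \<open>v\<close>. No order of the factors is imposed, since only the span matters.\<close>

inductive_set descendants :: "(idx \<Rightarrow> nat) \<Rightarrow> 'v \<Rightarrow> 'v set" for f v where
  base: "v \<in> descendants f v"
| step: "w \<in> descendants f v \<Longrightarrow> c \<in> idxs m n \<Longrightarrow> d \<in> idxs m n \<Longrightarrow> f d < f c \<Longrightarrow>
    E c d w \<in> descendants f v"

lemma act_span:
  assumes "X \<in> gl m n" "\<And>w. w \<in> S \<Longrightarrow> act X w \<in> span T" "u \<in> span S"
  shows "act X u \<in> span T"
  using assms(3)
  by (induction rule: span_induct_alt) (auto simp: act_lin[OF assms(1)] span_zero intro!: span_add span_scale assms(2))

text \<open>\<open>act_swap\<close> moves \<open>E a b\<close> past the outermost factor of the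
  monomial; as the induction hypothesis covers all index pairs, it also absorbs the commutator
  terms.\<close>

lemma descendants_closed:
  assumes v: "hwv f \<nu> v" and inj: "inj_on f (idxs m n)"
    and w: "w \<in> descendants f v" and "a \<in> idxs m n" "b \<in> idxs m n"
  shows "E a b w \<in> span (descendants f v)"
  using w assms(4,5)
proof (induction arbitrary: a b)
  case base
  consider "f a < f b" | "a = b" | "f b < f a"
    using inj base by (metis inj_onD linorder_neqE_nat)
  then show ?case
  proof cases
    case 1
    then show ?thesis using v base by (simp add: hwv_def span_zero)
  next
    case 2
    then show ?thesis using v base by (simp add: hwv_def span_scale span_base descendants.base)
  next
    case 3
    then show ?thesis using base by (auto intro!: span_base descendants.intros)
  qed
next
  case (step w c d)
  have "E c d (E a b w) \<in> span (descendants f v)"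
    by (rule act_span[OF mat_unit_in_gl[OF step(2,3)] _ step.IH[OF step.prems]])
      (use step in \<open>auto intro: span_base descendants.step\<close>)
  then show ?case
    unfolding act_swap[OF step.prems step(2,3)]
    using step.IH step.prems step(2,3) by (auto intro!: span_add span_diff span_scale simp: span_zero)
qed

lemma descendants_span:
  assumes "simple_module" "hwv f \<nu> v" "inj_on f (idxs m n)" "v \<in> V q"
  shows "span (descendants f v) = UNIV"
proof -
  let ?W = "descendants f v"
  have "submodule (span ?W)"
    unfolding submodule_def
  proof (intro conjI ballI)
    show "subspace (span ?W)" by simp
    show "act X w \<in> span ?W" if "X \<in> gl m n" "w \<in> span ?W" for X w
    proof (rule act_span[OF that(1) _ that(2)])
      fix u assume u: "u \<in> ?W"
      show "act X u \<in> span ?W"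
        unfolding act_expand[OF that(1)]
        by (rule span_sum) (auto intro!: span_scale descendants_closed[OF assms(2,3) u])
    qed
    fix w assume "w \<in> span ?W"
    then show "\<exists>x\<in>span ?W \<inter> V False. \<exists>y\<in>span ?W \<inter> V True. w = x + y"
    proof (induction rule: span_induct_alt)
      case base
      have "0 \<in> V p" for p using grading_subspace by (rule subspace_0)
      then show ?case by (intro bexI[of _ 0]) (auto simp: span_zero)
    next
      case (step c w u)
      then obtain x y where xy: "x \<in> span ?W" "x \<in> V False" "y \<in> span ?W" "y \<in> V True" "u = x + y" by blast
      have "\<exists>p. w \<in> V p"
        using step(1)
      proof induction
        case (step w c d)
        then show ?case using act_parity[OF mat_unit_in_gl_part[OF step(2,3)]] by blast
      qed (use assms in blast)
      then obtain p where p: "w \<in> V p" by blast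
      have cw: "scale c w \<in> span ?W" "scale c w \<in> V p"
        using span_scale[OF span_base[OF step(1)]] subspace_scale[OF grading_subspace p] by auto
      show ?case
      proof (cases p)
        case True
        then show ?thesis using xy cw grading_subspace
          by (intro bexI[of _ x] bexI[of _ "scale c w + y"]) (auto intro: span_add subspace_add simp: algebra_simps)
      next
        case False
        then show ?thesis using xy cw grading_subspace
          by (intro bexI[of _ "scale c w + x"] bexI[of _ y]) (auto intro: span_add subspace_add simp: algebra_simps)
      qed
    qed
  qed
  moreover have "span ?W \<noteq> {0}"
    using span_base[OF descendants.base, of v f] assms(2) by (auto simp: hwv_def)
  ultimately show ?thesis using assms(1) by (auto simp: simple_module_def)
qed

text \<open>The action of the diagonal matrix with entries \<open>f a\<close>. A lowering operator
  \<open>E c d\<close> increases its eigenvalue by \<open>f c - f d\<close>, so the eigenvalue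
  measures the depth of a monomial below the highest weight vector.\<close>

definition height_op :: "(idx \<Rightarrow> nat) \<Rightarrow> 'v \<Rightarrow> 'v" where
  "height_op f w = (\<Sum>a\<in>idxs m n. scale (of_nat (f a)) (E a a w))"

definition height_wt :: "(idx \<Rightarrow> nat) \<Rightarrow> weight \<Rightarrow> complex" where
  "height_wt f \<nu> = (\<Sum>a\<in>idxs m n. of_nat (f a) * \<nu> a)"

lemma height_op_linear: "Vector_Spaces.linear scale scale (height_op f)"
proof (unfold_locales)
  show "height_op f (x + y) = height_op f x + height_op f y" for x y
    by (simp add: height_op_def act_lin(1) mat_unit_in_gl scale_right_distrib sum.distrib)
  show "height_op f (scale c x) = scale c (height_op f x)" for c x
    by (simp add: height_op_def act_lin(2) mat_unit_in_gl scale_sum_right mult.commute)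
qed

lemma height_op_hwv: "hwv f \<nu> v \<Longrightarrow> height_op g v = scale (height_wt g \<nu>) v"
  by (simp add: height_op_def height_wt_def hwv_def scale_sum_left)

lemma height_op_act:
  assumes "c \<in> idxs m n" "d \<in> idxs m n"
  shows "height_op f (E c d w) = E c d (height_op f w) + scale (of_nat (f c) - of_nat (f d)) (E c d w)"
proof -
  have "height_op f (E c d w) = (\<Sum>a\<in>idxs m n. scale (of_nat (f a)) (E c d (E a a w))
      + scale (of_nat (f a) * ((if a = c then 1 else 0) - (if a = d then 1 else 0))) (E c d w))"
    unfolding height_op_def
    by (rule sum.cong) (simp_all add: act_diag_swap assms scale_right_distrib)
  also have "\<dots> = (\<Sum>a\<in>idxs m n. scale (of_nat (f a)) (E c d (E a a w)))
      + scale (\<Sum>a\<in>idxs m n. of_nat (f a) * ((if a = c then 1 else 0) - (if a = d then 1 else 0))) (E c d w)"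
    by (simp add: sum.distrib scale_sum_left)
  also have "(\<Sum>a\<in>idxs m n. scale (of_nat (f a)) (E c d (E a a w))) = E c d (height_op f w)"
    unfolding height_op_def act_lin(4)[OF mat_unit_in_gl[OF assms]]
    by (simp add: act_lin(2)[OF mat_unit_in_gl[OF assms]])
  also have "(\<Sum>a\<in>idxs m n. of_nat (f a) * ((if a = c then 1 else 0) - (if a = d then 1 else 0)))
      = (of_nat (f c) - of_nat (f d) :: complex)"
    using assms by (simp add: right_diff_distrib sum_subtractf if_distrib[of "\<lambda>x. _ * x"] cong: if_cong)
  finally show ?thesis .
qed

lemma descendants_height:
  assumes "hwv f \<nu> v" "w \<in> descendants f v"
  shows "w = v \<or> (\<exists>k>0. height_op f w = scale (height_wt f \<nu> + of_nat k) w)"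
  using assms(2)
proof induction
  case (step w c d)
  have "\<exists>k. height_op f w = scale (height_wt f \<nu> + of_nat k) w"
    using step.IH height_op_hwv[OF assms(1), of f] by (auto intro: exI[of _ 0])
  then obtain k where k: "height_op f w = scale (height_wt f \<nu> + of_nat k) w" ..
  have "height_op f (E c d w) = scale (height_wt f \<nu> + of_nat (k + (f c - f d))) (E c d w)"
    unfolding height_op_act[OF step(2,3)] k act_lin(2)[OF mat_unit_in_gl[OF step(2,3)]]
    using step(4) by (simp add: of_nat_diff scale_left_distrib algebra_simps)
  then show ?case using step(4) by (intro disjI2 exI[of _ "k + (f c - f d)"]) simp
qed simp

lemma height_wt_less:
  assumes "simple_module" "inj_on f (idxs m n)" "hwv f \<nu> v" "v \<in> V q" "hwv f \<nu>' v'"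
  shows "\<exists>k. height_wt f \<nu>' = height_wt f \<nu> + of_nat k"
proof -
  have "height_wt f \<nu>' \<in> {height_wt f \<nu> + of_nat k | k. True}"
  proof (rule eigenvalue_in_span[OF height_op_linear[of f]])
    show "v' \<in> span (descendants f v)" using descendants_span[OF assms(1,3,2,4)] by simp
    show "v' \<noteq> 0" using assms(5) by (simp add: hwv_def)
    show "height_op f v' = scale (height_wt f \<nu>') v'" by (rule height_op_hwv[OF assms(5)])
    fix g assume "g \<in> descendants f v"
    then consider "g = v" | k where "height_op f g = scale (height_wt f \<nu> + of_nat k) g"
      using descendants_height[OF assms(3)] by blast
    then show "\<exists>l\<in>{height_wt f \<nu> + of_nat k | k. True}. height_op f g = scale l g"
    proof cases
      case 1
      then show ?thesis
        using height_op_hwv[OF assms(3), of f] by (intro bexI[of _ "height_wt f \<nu>"]) (auto intro: exI[of _ 0])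
    qed blast
  qed
  then show ?thesis by blast
qed

text \<open>Homogeneous representatives of the two vectors generate the module, so each height
  exceeds the other by a natural number, and the heights agree. At this height the span of the
  descendants is a line, so the representatives are proportional.\<close>

lemma hwv_weight_unique:
  assumes "simple_module" "inj_on f (idxs m n)" "hwv f \<nu> v" "hwv f \<nu>' v'" "a \<in> idxs m n"
  shows "\<nu> a = \<nu>' a"
proof -
  obtain u q where u: "u \<in> V q" "hwv f \<nu> u" using hwv_homogeneous[OF assms(3)] by blast
  obtain u' q' where u': "u' \<in> V q'" "hwv f \<nu>' u'" using hwv_homogeneous[OF assms(4)] by blast
  obtain k where k: "height_wt f \<nu>' = height_wt f \<nu> + of_nat k"
    using height_wt_less[OF assms(1,2) u(2,1) u'(2)] by blast
  obtain k' where k': "height_wt f \<nu> = height_wt f \<nu>' + of_nat k'"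
    using height_wt_less[OF assms(1,2) u'(2,1) u(2)] by blast
  have "of_nat k + of_nat k' = (0 :: complex)" using k' unfolding k by (simp add: add.assoc)
  then have "of_nat (k + k') = (0 :: complex)" by simp
  then have eq: "height_wt f \<nu>' = height_wt f \<nu>" using k by (simp only: of_nat_eq_0_iff) simp
  let ?G = "{w. \<exists>k>0. height_op f w = scale (height_wt f \<nu> + of_nat k) w}"
  have "descendants f u \<subseteq> insert u ?G" using descendants_height[OF u(2)] by blast
  then have "span (descendants f u) \<subseteq> span (insert u ?G)" by (rule span_mono)
  then have "u' \<in> span (insert u ?G)" using descendants_span[OF assms(1) u(2) assms(2) u(1)] by auto
  \<comment> \<open>Splitting off \<open>u\<close> leaves a combination of vectors of strictly
    larger height, while the difference itself has the height of \<open>u\<close>; this forces it to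
    vanish.\<close>
  then obtain c where c: "u' - scale c u \<in> span ?G" by (auto simp: span_insert)
  interpret h: Vector_Spaces.linear scale scale "height_op f" by (rule height_op_linear)
  have "height_op f (u' - scale c u) = scale (height_wt f \<nu>) (u' - scale c u)"
    unfolding h.diff h.scale height_op_hwv[OF u(2)] height_op_hwv[OF u'(2)] eq
    by (simp add: scale_right_diff_distrib mult.commute)
  moreover have "\<not> height_wt f \<nu> \<in> {height_wt f \<nu> + of_nat k | k. k > 0}" by auto
  ultimately have "u' - scale c u = 0"
    using eigenvalue_in_span[OF height_op_linear _ c, of "{height_wt f \<nu> + of_nat k | k. k > 0}" f "height_wt f \<nu>"]
    by auto
  then have e: "u' = scale c u" by simp
  have "scale (\<nu>' a) u' = E a a u'" using u'(2) assms(5) by (simp add: hwv_def)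
  also have "\<dots> = scale (\<nu> a) u'"
    unfolding e act_lin(2)[OF mat_unit_in_gl[OF assms(5) assms(5)]]
    using u(2) assms(5) by (simp add: hwv_def mult.commute)
  finally show ?thesis using u'(2) by (auto simp: hwv_def)
qed

text \<open>\<open>E p q\<close> sends \<open>E q p v\<close> back to \<open>v\<close> times
  \<open>\<nu> p + \<nu> q\<close>. If this scalar is nonzero, \<open>E q p v\<close> is the new
  highest weight vector. If it is zero, \<open>E q p v\<close> would be highest for the old ranking
  with a different weight; uniqueness makes it vanish, and \<open>v\<close> remains highest.\<close>

lemma odd_reflection:
  assumes simple: "simple_module" and inj: "inj_on f (idxs m n)" and v: "hwv f \<nu> v"
    and pq: "p \<in> idxs m n" "q \<in> idxs m n" "odd_idx p \<noteq> odd_idx q" "f p < f q"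
    and adj: "\<And>a. a \<in> idxs m n \<Longrightarrow> \<not> (f p < f a \<and> f a < f q)"
    and f': "\<And>a b. a \<in> idxs m n \<Longrightarrow> b \<in> idxs m n \<Longrightarrow> f' a < f' b \<Longrightarrow>
      (a, b) = (q, p) \<or> (f a < f b \<and> (a, b) \<noteq> (p, q))"
  shows "\<exists>w. hwv f' (if \<nu> p + \<nu> q = 0 then \<nu> else \<nu> - (unit_wt p - unit_wt q)) w"
proof -
  let ?w = "E q p v"
  have np: "p \<noteq> q" using pq by auto
  have s: "super_sign True True = -1" by (simp add: super_sign_def)
  have epq: "E p q v = 0" using v pq by (simp add: hwv_def)
  have "E p q ?w = scale (-1) (E q p (E p q v)) + E p p v - scale (-1) (E q q v)"
    using act_swap[OF pq(1,2) pq(2,1), of v] pq(3) s by (simp add: eq_commute[of "odd_idx p"])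
  also have "\<dots> = scale (\<nu> p + \<nu> q) v"
    using epq v pq act_lin(3)[OF mat_unit_in_gl[OF pq(2,1)]]
    by (simp add: hwv_def scale_left_distrib)
  finally have pqw: "E p q ?w = scale (\<nu> p + \<nu> q) v" .
  have diag: "E a a ?w = scale ((\<nu> - (unit_wt p - unit_wt q)) a) ?w" if "a \<in> idxs m n" for a
  proof -
    have "E a a v = scale (\<nu> a) v" using v that by (simp add: hwv_def)
    then have "E a a ?w = scale (\<nu> a + ((if a = q then 1 else 0) - (if a = p then 1 else 0))) ?w"
      unfolding act_diag_swap[OF that pq(2,1)] scale_left_distrib
      by (simp only: act_lin(2)[OF mat_unit_in_gl[OF pq(2,1)]])
    also have "\<nu> a + ((if a = q then 1 else 0) - (if a = p then 1 else 0)) = (\<nu> - (unit_wt p - unit_wt q)) a"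
      by (simp add: unit_wt_def)
    finally show ?thesis .
  qed
  \<comment> \<open>No index lies between \<open>p\<close> and \<open>q\<close>, so the operators in
    the commutator terms \<open>E a p v\<close> and \<open>E q b v\<close> are still
    raising.\<close>
  have pos: "E a b ?w = 0" if ab: "a \<in> idxs m n" "b \<in> idxs m n" "f a < f b" "(a, b) \<noteq> (p, q)" for a b
  proof -
    have "E a b v = 0" using v ab by (simp add: hwv_def)
    moreover have "E a p v = 0" if "b = q"
    proof -
      have "a \<noteq> p" using ab that by auto
      then have "f a \<noteq> f p" using inj ab pq by (auto dest: inj_onD)
      then have "f a < f p" using adj[OF ab(1)] ab(3) that by auto
      then show ?thesis using v ab pq by (simp add: hwv_def)
    qed
    moreover have "E q b v = 0" if "p = a"
    proof -
      have "b \<noteq> q" using ab that by auto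
      then have "f b \<noteq> f q" using inj ab pq by (auto dest: inj_onD)
      then have "f q < f b" using adj[OF ab(2)] ab(3) that by auto
      then show ?thesis using v ab pq by (simp add: hwv_def)
    qed
    ultimately show ?thesis
      unfolding act_swap[OF ab(1,2) pq(2,1)] using ab(4) by (auto simp add: act_lin(3)[OF mat_unit_in_gl[OF pq(2,1)]])
  qed
  \<comment> \<open>An odd root vector anticommutes with itself, so its square acts as zero.\<close>
  have qpw: "E q p ?w = 0"
  proof -
    have "E q p ?w = scale (-1) (E q p ?w)"
      using act_swap[OF pq(2,1) pq(2,1), of v] pq(3) np s by (simp add: eq_commute[of "odd_idx p"])
    then have "E q p ?w = - E q p ?w" by (simp only: scale_minus_left scale_one)
    then have "E q p ?w + E q p ?w = 0" by (rule eq_neg_iff_add_eq_0[THEN iffD1])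
    then have "scale 2 (E q p ?w) = 0" using scale_left_distrib[of 1 1 "E q p ?w"] by simp
    then show ?thesis by simp
  qed
  show ?thesis
  proof (cases "\<nu> p + \<nu> q = 0")
    case True
    have "?w = 0"
    proof (rule ccontr)
      assume "?w \<noteq> 0"
      then have "hwv f (\<nu> - (unit_wt p - unit_wt q)) ?w"
        unfolding hwv_def using diag pos pqw True by (metis prod.inject scale_zero_left)
      from hwv_weight_unique[OF simple inj v this pq(1)] np show False
        by (simp add: unit_wt_def)
    qed
    then have "hwv f' \<nu> v" using v f' unfolding hwv_def by (metis prod.inject)
    then show ?thesis using True by auto
  next
    case False
    then have "?w \<noteq> 0" using pqw v act_lin(3)[OF mat_unit_in_gl[OF pq(1,2)]] by (auto simp: hwv_def)
    then have "hwv f' (\<nu> - (unit_wt p - unit_wt q)) ?w"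
      unfolding hwv_def using diag pos qpw f' by (metis prod.inject)
    then show ?thesis using False by auto
  qed
qed

end


section \<open>Bases from linear orders\<close>

lemma unit_diff_eq_iff:
  assumes "a \<noteq> b"
  shows "unit_wt a - unit_wt b = unit_wt c - unit_wt d \<longleftrightarrow> a = c \<and> b = d"
proof
  assume e: "unit_wt a - unit_wt b = unit_wt c - unit_wt d"
  show "a = c \<and> b = d"
    using fun_cong[OF e, of a] fun_cong[OF e, of b] assms
    by (auto simp: unit_wt_def split: if_splits)
qed simp

lemma unit_diff_nonzero: "a \<noteq> b \<Longrightarrow> unit_wt a - unit_wt b \<noteq> 0"
  by (auto simp: unit_wt_def fun_eq_iff)

definition order_roots :: "nat \<Rightarrow> nat \<Rightarrow> (idx \<Rightarrow> nat) \<Rightarrow> weight set" where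
  "order_roots m n f = {unit_wt a - unit_wt b | a b. a \<in> idxs m n \<and> b \<in> idxs m n \<and> f a < f b}"

text \<open>The simple system of the linear order given by \<open>f\<close>.\<close>

definition covering_roots :: "nat \<Rightarrow> nat \<Rightarrow> (idx \<Rightarrow> nat) \<Rightarrow> weight set" where
  "covering_roots m n f = {unit_wt a - unit_wt b | a b. a \<in> idxs m n \<and> b \<in> idxs m n \<and> f a < f b \<and>
     \<not> (\<exists>c\<in>idxs m n. f a < f c \<and> f c < f b)}"

lemma idxs_iff [simp]:
  "Eps i \<in> idxs m n \<longleftrightarrow> 1 \<le> i \<and> i \<le> m" "Del j \<in> idxs m n \<longleftrightarrow> 1 \<le> j \<and> j \<le> n"
  by (auto simp: idxs_def)

lemma even_roots_eq:
  "even_roots m n = {unit_wt a - unit_wt b | a b. a \<in> idxs m n \<and> b \<in> idxs m n \<and> a \<noteq> b \<and> odd_idx a = odd_idx b}"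
  (is "_ = ?R")
proof (intro equalityI subsetI)
  show "\<alpha> \<in> ?R" if "\<alpha> \<in> even_roots m n" for \<alpha>
    using that unfolding even_roots_def by force
  fix \<alpha> assume "\<alpha> \<in> ?R"
  then obtain a b where ab: "\<alpha> = unit_wt a - unit_wt b" "a \<in> idxs m n" "b \<in> idxs m n" "a \<noteq> b" "odd_idx a = odd_idx b"
    by blast
  then show "\<alpha> \<in> even_roots m n"
    unfolding even_roots_def by (cases a; cases b) auto
qed

lemma right_odd_roots_eq:
  "right_odd_roots m n = {unit_wt a - unit_wt b | a b. a \<in> idxs m n \<and> b \<in> idxs m n \<and> \<not> odd_idx a \<and> odd_idx b}"
  (is "_ = ?R")
proof (intro equalityI subsetI)
  show "\<alpha> \<in> ?R" if "\<alpha> \<in> right_odd_roots m n" for \<alpha>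
    using that unfolding right_odd_roots_def by force
  fix \<alpha> assume "\<alpha> \<in> ?R"
  then obtain a b where ab: "\<alpha> = unit_wt a - unit_wt b" "a \<in> idxs m n" "b \<in> idxs m n" "\<not> odd_idx a" "odd_idx b"
    by blast
  then show "\<alpha> \<in> right_odd_roots m n"
    unfolding right_odd_roots_def by (cases a; cases b) auto
qed

lemma odd_roots_eq:
  "odd_roots m n = {unit_wt a - unit_wt b | a b. a \<in> idxs m n \<and> b \<in> idxs m n \<and> odd_idx a \<noteq> odd_idx b}"
  (is "_ = ?R")
proof (intro equalityI subsetI)
  show "\<alpha> \<in> ?R" if "\<alpha> \<in> odd_roots m n" for \<alpha>
    using that unfolding odd_roots_def right_odd_roots_eq by force
  fix \<alpha> assume "\<alpha> \<in> ?R"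
  then obtain a b where ab: "\<alpha> = unit_wt a - unit_wt b" "a \<in> idxs m n" "b \<in> idxs m n" "odd_idx a \<noteq> odd_idx b"
    by blast
  show "\<alpha> \<in> odd_roots m n"
  proof (cases "odd_idx a")
    case True
    then have "unit_wt b - unit_wt a \<in> right_odd_roots m n" using ab unfolding right_odd_roots_eq by blast
    moreover have "\<alpha> = - (unit_wt b - unit_wt a)" using ab by simp
    ultimately show ?thesis unfolding odd_roots_def by blast
  next
    case False
    then show ?thesis using ab unfolding odd_roots_def right_odd_roots_eq by blast
  qed
qed

lemma roots_eq: "roots m n = {unit_wt a - unit_wt b | a b. a \<in> idxs m n \<and> b \<in> idxs m n \<and> a \<noteq> b}"
  unfolding roots_def even_roots_eq odd_roots_eq by blast

lemma finite_roots: "finite (roots m n)"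
proof -
  have "roots m n \<subseteq> (\<lambda>(a, b). unit_wt a - unit_wt b) ` (idxs m n \<times> idxs m n)"
    unfolding roots_eq by auto
  then show ?thesis by (rule finite_subset) simp
qed

lemma root_nonzero: "\<alpha> \<in> roots m n \<Longrightarrow> \<alpha> \<noteq> 0"
proof -
  assume "\<alpha> \<in> roots m n"
  then obtain a b where "\<alpha> = unit_wt a - unit_wt b" "a \<noteq> b" unfolding roots_eq by blast
  then show ?thesis using unit_diff_nonzero by metis
qed

lemma uminus_root: "\<alpha> \<in> roots m n \<Longrightarrow> - \<alpha> \<in> roots m n"
proof -
  assume "\<alpha> \<in> roots m n"
  then obtain a b where "\<alpha> = unit_wt a - unit_wt b" "a \<in> idxs m n" "b \<in> idxs m n" "a \<noteq> b"
    unfolding roots_eq by blast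
  moreover from this have "- \<alpha> = unit_wt b - unit_wt a" by simp
  ultimately show ?thesis unfolding roots_eq by blast
qed

section \<open>Positive systems of bases\<close>

lemma int_comb_add: "int_comb c \<Sigma> + int_comb c' \<Sigma> = int_comb (\<lambda>\<beta>. c \<beta> + c' \<beta>) \<Sigma>"
  by (simp add: int_comb_def sum.distrib wt.scale_left_distrib)

lemma int_comb_uminus: "- int_comb c \<Sigma> = int_comb (\<lambda>\<beta>. - c \<beta>) \<Sigma>"
  by (simp add: int_comb_def sum_negf)

lemma int_comb_single:
  assumes "finite \<Sigma>" "\<alpha> \<in> \<Sigma>"
  shows "int_comb (\<lambda>\<beta>. if \<beta> = \<alpha> then 1 else 0) \<Sigma> = \<alpha>"
proof -
  have "int_comb (\<lambda>\<beta>. if \<beta> = \<alpha> then 1 else 0) \<Sigma> = (\<Sum>\<beta>\<in>\<Sigma>. if \<beta> = \<alpha> then \<alpha> else 0)"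
    unfolding int_comb_def by (rule sum.cong) auto
  then show ?thesis using assms by simp
qed

lemma int_comb_zero: "\<forall>\<beta>\<in>\<Sigma>. c \<beta> = 0 \<Longrightarrow> int_comb c \<Sigma> = 0"
  by (simp add: int_comb_def)

lemma int_comb_eq_0D:
  assumes "finite \<Sigma>" "wt.independent \<Sigma>" "int_comb c \<Sigma> = 0" "\<beta> \<in> \<Sigma>"
  shows "c \<beta> = 0"
  using wt.independentD[OF assms(2,1) order_refl assms(3)[unfolded int_comb_def] assms(4)] by simp

context
  fixes m n \<Sigma>
  assumes base: "is_base m n \<Sigma>"
begin

lemma base_finite: "finite \<Sigma>"
  using base finite_roots finite_subset unfolding is_base_def by blast

lemma base_indep: "wt.independent \<Sigma>"
  using base unfolding is_base_def by blast

lemma positive_root_or: "\<alpha> \<in> roots m n \<Longrightarrow> \<alpha> \<in> positive_roots m n \<Sigma> \<or> - \<alpha> \<in> positive_roots m n \<Sigma>"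
proof -
  assume a: "\<alpha> \<in> roots m n"
  then obtain c where c: "\<alpha> = int_comb c \<Sigma>" "(\<forall>\<beta>\<in>\<Sigma>. c \<beta> \<ge> 0) \<or> (\<forall>\<beta>\<in>\<Sigma>. c \<beta> \<le> 0)"
    using base unfolding is_base_def by blast
  have "- \<alpha> = int_comb (\<lambda>\<beta>. - c \<beta>) \<Sigma>" using c(1) int_comb_uminus by simp
  moreover have "(\<forall>\<beta>\<in>\<Sigma>. c \<beta> \<ge> 0) \<or> (\<forall>\<beta>\<in>\<Sigma>. - c \<beta> \<ge> 0)" using c(2) by simp
  ultimately show ?thesis using c(1) a uminus_root[OF a] unfolding positive_roots_def by blast
qed

lemma positive_roots_sum_nonzero:
  assumes "\<alpha> \<in> positive_roots m n \<Sigma>" "\<beta> \<in> positive_roots m n \<Sigma>"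
  shows "\<alpha> + \<beta> \<noteq> 0"
proof
  assume z: "\<alpha> + \<beta> = 0"
  obtain c d where c: "\<alpha> = int_comb c \<Sigma>" "\<forall>\<gamma>\<in>\<Sigma>. c \<gamma> \<ge> 0" and d: "\<beta> = int_comb d \<Sigma>" "\<forall>\<gamma>\<in>\<Sigma>. d \<gamma> \<ge> 0"
    using assms unfolding positive_roots_def by blast
  have "int_comb (\<lambda>\<gamma>. c \<gamma> + d \<gamma>) \<Sigma> = 0" using z c d int_comb_add by simp
  then have "\<forall>\<gamma>\<in>\<Sigma>. c \<gamma> + d \<gamma> = 0" using int_comb_eq_0D[OF base_finite base_indep] by blast
  then have "\<forall>\<gamma>\<in>\<Sigma>. c \<gamma> = 0" using c d by (metis add_nonneg_eq_0_iff)
  then have "\<alpha> = 0" using c int_comb_zero by blast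
  then show False using assms(1) root_nonzero unfolding positive_roots_def by blast
qed

lemma uminus_positive_root: "\<alpha> \<in> positive_roots m n \<Sigma> \<Longrightarrow> - \<alpha> \<notin> positive_roots m n \<Sigma>"
  using positive_roots_sum_nonzero[of \<alpha> "- \<alpha>"] by auto

lemma positive_roots_add:
  assumes "\<alpha> \<in> positive_roots m n \<Sigma>" "\<beta> \<in> positive_roots m n \<Sigma>" "\<alpha> + \<beta> \<in> roots m n"
  shows "\<alpha> + \<beta> \<in> positive_roots m n \<Sigma>"
proof -
  obtain c d where c: "\<alpha> = int_comb c \<Sigma>" "\<forall>\<gamma>\<in>\<Sigma>. c \<gamma> \<ge> 0" and d: "\<beta> = int_comb d \<Sigma>" "\<forall>\<gamma>\<in>\<Sigma>. d \<gamma> \<ge> 0"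
    using assms unfolding positive_roots_def by blast
  have "\<alpha> + \<beta> = int_comb (\<lambda>\<gamma>. c \<gamma> + d \<gamma>) \<Sigma>" using c d int_comb_add by simp
  moreover have "\<forall>\<gamma>\<in>\<Sigma>. c \<gamma> + d \<gamma> \<ge> 0" using c d by simp
  ultimately show ?thesis using assms(3) unfolding positive_roots_def by blast
qed

lemma base_positive: "\<alpha> \<in> \<Sigma> \<Longrightarrow> \<alpha> \<in> positive_roots m n \<Sigma>"
proof -
  assume a: "\<alpha> \<in> \<Sigma>"
  then have "\<alpha> \<in> roots m n" using base unfolding is_base_def by blast
  moreover have "\<alpha> = int_comb (\<lambda>\<beta>. if \<beta> = \<alpha> then 1 else 0) \<Sigma>"
    using int_comb_single[OF base_finite a] by simp
  moreover have "\<forall>\<beta>\<in>\<Sigma>. (if \<beta> = \<alpha> then 1 else 0) \<ge> (0::int)" by simp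
  ultimately show ?thesis unfolding positive_roots_def by blast
qed

text \<open>By independence the two coefficient families add up to 1 at the given element and to 0
  elsewhere. Being nonnegative integers, one of the families vanishes identically, and its root
  would be zero.\<close>

lemma base_indecomposable:
  assumes "\<alpha> \<in> positive_roots m n \<Sigma>" "\<beta> \<in> positive_roots m n \<Sigma>"
  shows "\<alpha> + \<beta> \<notin> \<Sigma>"
proof
  assume mem: "\<alpha> + \<beta> \<in> \<Sigma>"
  obtain c d where c: "\<alpha> = int_comb c \<Sigma>" "\<forall>\<gamma>\<in>\<Sigma>. c \<gamma> \<ge> 0" and d: "\<beta> = int_comb d \<Sigma>" "\<forall>\<gamma>\<in>\<Sigma>. d \<gamma> \<ge> 0"
    using assms unfolding positive_roots_def by blast
  let ?e = "\<lambda>\<gamma>. if \<gamma> = \<alpha> + \<beta> then 1 else (0::int)"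
  have "int_comb (\<lambda>\<gamma>. (c \<gamma> + d \<gamma>) + - ?e \<gamma>) \<Sigma> = (\<alpha> + \<beta>) + - (\<alpha> + \<beta>)"
    unfolding int_comb_add[symmetric] int_comb_uminus[symmetric] int_comb_single[OF base_finite mem] c(1)[symmetric] d(1)[symmetric] ..
  then have "\<forall>\<gamma>\<in>\<Sigma>. (c \<gamma> + d \<gamma>) + - ?e \<gamma> = 0"
    using int_comb_eq_0D[OF base_finite base_indep] by (metis (no_types, lifting) add.right_inverse)
  then have s: "\<forall>\<gamma>\<in>\<Sigma>. c \<gamma> + d \<gamma> = ?e \<gamma>" by force
  show False
  proof (cases "c (\<alpha> + \<beta>) = 0")
    case True
    have "\<forall>\<gamma>\<in>\<Sigma>. c \<gamma> = 0"
    proof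
      fix \<gamma> assume g: "\<gamma> \<in> \<Sigma>"
      show "c \<gamma> = 0" using True s g c(2) d(2) by (cases "\<gamma> = \<alpha> + \<beta>") (auto simp: add_nonneg_eq_0_iff)
    qed
    then have "\<alpha> = 0" using c int_comb_zero by blast
    then show False using assms(1) root_nonzero unfolding positive_roots_def by blast
  next
    case False
    have "\<forall>\<gamma>\<in>\<Sigma>. d \<gamma> = 0"
    proof
      fix \<gamma> assume g: "\<gamma> \<in> \<Sigma>"
      have sg: "c \<gamma> + d \<gamma> = ?e \<gamma>" "c \<gamma> \<ge> 0" "d \<gamma> \<ge> 0" using s g c(2) d(2) by auto
      show "d \<gamma> = 0"
      proof (cases "\<gamma> = \<alpha> + \<beta>")
        case True
        then have "c \<gamma> \<noteq> 0" using False by simp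
        then show ?thesis using sg True by (simp only: refl if_True)
      next
        case False
        then show ?thesis using sg by (simp only: if_False)
      qed
    qed
    then have "\<beta> = 0" using d int_comb_zero by blast
    then show False using assms(2) root_nonzero unfolding positive_roots_def by blast
  qed
qed

end

text \<open>Triangularity in the rank: coordinate \<open>a\<close> is met only by the covering root
  that starts at \<open>a\<close> and the one that ends at \<open>a\<close>, whose coefficient is
  already known to vanish.\<close>

lemma covering_roots_indep:
  assumes inj: "inj_on f (idxs m n)"
  shows "wt.independent (covering_roots m n f)"
proof (rule wt.independent_if_scalars_zero)
  show fin: "finite (covering_roots m n f)"
    by (rule finite_subset[OF _ finite_roots[of m n]]) (auto simp: covering_roots_def roots_eq)
  fix c \<beta> assume z: "(\<Sum>\<beta>\<in>covering_roots m n f. wscale (c \<beta>) \<beta>) = 0" and "\<beta> \<in> covering_roots m n f"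
  then obtain a b where ab: "\<beta> = unit_wt a - unit_wt b" "unit_wt a - unit_wt b \<in> covering_roots m n f" "a \<in> idxs m n"
    unfolding covering_roots_def by blast
  have "c (unit_wt a - unit_wt b) = 0" if "unit_wt a - unit_wt b \<in> covering_roots m n f" "a \<in> idxs m n" for a b
    using that
  proof (induction "f a" arbitrary: a b rule: less_induct)
    case less
    have cov: "a \<in> idxs m n" "b \<in> idxs m n" "f a < f b" "\<not> (\<exists>c\<in>idxs m n. f a < f c \<and> f c < f b)"
    proof -
      obtain a' b' where ab': "unit_wt a - unit_wt b = unit_wt a' - unit_wt b'" "a' \<in> idxs m n" "b' \<in> idxs m n"
        "f a' < f b'" "\<not> (\<exists>c\<in>idxs m n. f a' < f c \<and> f c < f b')"
        using less(2) unfolding covering_roots_def by blast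
      moreover have "a' \<noteq> b'" using ab' by auto
      ultimately have "a' = a" "b' = b" using unit_diff_eq_iff[of a' b' a b] by auto
      then show "a \<in> idxs m n" "b \<in> idxs m n" "f a < f b" "\<not> (\<exists>c\<in>idxs m n. f a < f c \<and> f c < f b)"
        using ab' by auto
    qed
    have single: "c \<gamma> * \<gamma> a = (if \<gamma> = unit_wt a - unit_wt b then c \<gamma> else 0)"
      if g: "\<gamma> \<in> covering_roots m n f" for \<gamma>
    proof -
      obtain a' b' where g': "\<gamma> = unit_wt a' - unit_wt b'" "a' \<in> idxs m n" "b' \<in> idxs m n"
        "f a' < f b'" "\<not> (\<exists>c\<in>idxs m n. f a' < f c \<and> f c < f b')"
        using g unfolding covering_roots_def by blast
      consider "a' = a" | "b' = a" "a' \<noteq> a" | "a' \<noteq> a" "b' \<noteq> a" by blast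
      then show ?thesis
      proof cases
        case 1
        have "f b = f b'" using cov g' 1 by (metis linorder_neqE_nat)
        then have "b' = b" using inj cov g' by (auto dest: inj_onD)
        then show ?thesis using 1 g' cov by (auto simp: unit_wt_def)
      next
        case 2
        then have "c \<gamma> = 0" using less(1)[of a' b'] g g' by simp
        then show ?thesis by auto
      next
        case 3
        then have "\<gamma> a = 0" using g' by (simp add: unit_wt_def)
        moreover have "\<gamma> \<noteq> unit_wt a - unit_wt b"
          using 3 g' unit_diff_eq_iff[of a' b' a b] by auto
        ultimately show ?thesis by simp
      qed
    qed
    have "0 = (\<Sum>\<beta>\<in>covering_roots m n f. wscale (c \<beta>) \<beta>) a" using z by simp
    also have "\<dots> = (\<Sum>\<gamma>\<in>covering_roots m n f. c \<gamma> * \<gamma> a)"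
      unfolding sum_fun_apply by (simp add: wscale_def)
    also have "\<dots> = (\<Sum>\<gamma>\<in>covering_roots m n f. if \<gamma> = unit_wt a - unit_wt b then c \<gamma> else 0)"
      by (rule sum.cong) (simp_all add: single)
    also have "\<dots> = c (unit_wt a - unit_wt b)" using fin less(2) by simp
    finally show ?case by simp
  qed
  then show "c \<beta> = 0" using ab by blast
qed

text \<open>Telescoping: an intermediate index splits the difference into two shorter ones.\<close>

lemma order_roots_int_comb:
  assumes "a \<in> idxs m n" "b \<in> idxs m n" "f a < f b"
  shows "\<exists>c. unit_wt a - unit_wt b = int_comb c (covering_roots m n f) \<and>
    (\<forall>\<beta>\<in>covering_roots m n f. c \<beta> \<ge> 0)"
  using assms
proof (induction "f b - f a" arbitrary: a b rule: less_induct)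
  case less
  let ?C = "covering_roots m n f"
  have fin: "finite ?C"
    by (rule finite_subset[OF _ finite_roots[of m n]]) (auto simp: covering_roots_def roots_eq)
  show ?case
  proof (cases "\<exists>c\<in>idxs m n. f a < f c \<and> f c < f b")
    case True
    then obtain e where e: "e \<in> idxs m n" "f a < f e" "f e < f b" by blast
    obtain c where c: "unit_wt a - unit_wt e = int_comb c ?C" "\<forall>\<beta>\<in>?C. c \<beta> \<ge> 0"
      using less.hyps[of e a] less.prems e by fastforce
    obtain d where d: "unit_wt e - unit_wt b = int_comb d ?C" "\<forall>\<beta>\<in>?C. d \<beta> \<ge> 0"
      using less.hyps[of b e] less.prems e by fastforce
    have "unit_wt a - unit_wt b = int_comb c ?C + int_comb d ?C"
      unfolding c(1)[symmetric] d(1)[symmetric] by simp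
    then show ?thesis unfolding int_comb_add using c d
      by (intro exI[of _ "\<lambda>\<beta>. c \<beta> + d \<beta>"]) simp
  next
    case False
    then have "unit_wt a - unit_wt b \<in> ?C" using less.prems unfolding covering_roots_def by blast
    from int_comb_single[OF fin this] show ?thesis
      by (intro exI[of _ "\<lambda>\<beta>. if \<beta> = unit_wt a - unit_wt b then 1 else 0"]) simp
  qed
qed

lemma covering_roots_base:
  assumes inj: "inj_on f (idxs m n)"
  shows "is_base m n (covering_roots m n f)"
  unfolding is_base_def
proof (intro conjI ballI)
  show "covering_roots m n f \<subseteq> roots m n" by (auto simp: covering_roots_def roots_eq)
  show "wt.independent (covering_roots m n f)" by (rule covering_roots_indep[OF inj])
  fix \<alpha> assume "\<alpha> \<in> roots m n"
  then obtain a b where ab: "\<alpha> = unit_wt a - unit_wt b" "a \<in> idxs m n" "b \<in> idxs m n" "a \<noteq> b"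
    unfolding roots_eq by blast
  then have "f a \<noteq> f b" using inj by (auto dest: inj_onD)
  then consider "f a < f b" | "f b < f a" by linarith
  then show "\<exists>c. \<alpha> = int_comb c (covering_roots m n f) \<and>
      ((\<forall>\<beta>\<in>covering_roots m n f. c \<beta> \<ge> 0) \<or> (\<forall>\<beta>\<in>covering_roots m n f. c \<beta> \<le> 0))"
  proof cases
    case 1
    then show ?thesis using order_roots_int_comb[OF ab(2,3) 1] ab(1) by blast
  next
    case 2
    obtain c where c: "unit_wt b - unit_wt a = int_comb c (covering_roots m n f)"
      "\<forall>\<beta>\<in>covering_roots m n f. c \<beta> \<ge> 0"
      using order_roots_int_comb[OF ab(3,2) 2] by blast
    have "\<alpha> = - (unit_wt b - unit_wt a)" using ab(1) by simp
    then have "\<alpha> = int_comb (\<lambda>\<beta>. - c \<beta>) (covering_roots m n f)"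
      unfolding c(1) int_comb_uminus .
    then show ?thesis using c(2) by (intro exI[of _ "\<lambda>\<beta>. - c \<beta>"]) simp
  qed
qed

lemma positive_covering_roots:
  assumes inj: "inj_on f (idxs m n)"
  shows "positive_roots m n (covering_roots m n f) = order_roots m n f"
proof (intro equalityI subsetI)
  fix \<alpha> assume "\<alpha> \<in> order_roots m n f"
  then obtain a b where ab: "\<alpha> = unit_wt a - unit_wt b" "a \<in> idxs m n" "b \<in> idxs m n" "f a < f b"
    unfolding order_roots_def by blast
  then have "\<alpha> \<in> roots m n" unfolding roots_eq by blast
  then show "\<alpha> \<in> positive_roots m n (covering_roots m n f)"
    using order_roots_int_comb[OF ab(2-4)] ab(1) unfolding positive_roots_def by blast
next
  fix \<alpha> assume pos: "\<alpha> \<in> positive_roots m n (covering_roots m n f)"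
  then obtain a b where ab: "\<alpha> = unit_wt a - unit_wt b" "a \<in> idxs m n" "b \<in> idxs m n" "a \<noteq> b"
    unfolding positive_roots_def roots_eq by blast
  have "f a \<noteq> f b" using inj ab by (auto dest: inj_onD)
  moreover have "\<not> f b < f a"
  proof
    assume "f b < f a"
    then have "unit_wt b - unit_wt a \<in> positive_roots m n (covering_roots m n f)"
      using order_roots_int_comb[OF ab(3,2)] ab unfolding positive_roots_def roots_eq by blast
    then have "- \<alpha> \<in> positive_roots m n (covering_roots m n f)" using ab(1) by simp
    then show False using uminus_positive_root[OF covering_roots_base[OF inj] pos] by blast
  qed
  ultimately show "\<alpha> \<in> order_roots m n f" using ab unfolding order_roots_def by force
qed

lemma unit_diff_in_order_roots_iff:
  assumes "a \<in> idxs m n" "b \<in> idxs m n"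
  shows "unit_wt a - unit_wt b \<in> order_roots m n f \<longleftrightarrow> f a < f b"
proof
  assume "unit_wt a - unit_wt b \<in> order_roots m n f"
  then obtain a' b' where ab': "unit_wt a - unit_wt b = unit_wt a' - unit_wt b'" "f a' < f b'"
    unfolding order_roots_def by blast
  moreover have "a' \<noteq> b'" using ab' by auto
  ultimately show "f a < f b" using unit_diff_eq_iff[of a' b' a b] by auto
qed (use assms in \<open>auto simp: order_roots_def\<close>)


section \<open>Bases and order ideals\<close>

definition order_ideal :: "nat \<Rightarrow> nat \<Rightarrow> (nat \<times> nat) set \<Rightarrow> bool" where
  "order_ideal m n N \<longleftrightarrow> N \<subseteq> {..<m} \<times> {..<n} \<and>
     (\<forall>t j t' j'. (t, j) \<in> N \<longrightarrow> t' \<le> t \<longrightarrow> j' \<le> j \<longrightarrow> (t', j') \<in> N)"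

definition row_len :: "(nat \<times> nat) set \<Rightarrow> nat \<Rightarrow> nat" where
  "row_len N t = card {j. (t, j) \<in> N}"

definition col_len :: "(nat \<times> nat) set \<Rightarrow> nat \<Rightarrow> nat" where
  "col_len N j = card {t. (t, j) \<in> N}"

lemma down_closed_iff_less_card:
  fixes X :: "nat set"
  assumes "finite X" "\<And>x y. x \<in> X \<Longrightarrow> y \<le> x \<Longrightarrow> y \<in> X"
  shows "x \<in> X \<longleftrightarrow> x < card X"
proof
  assume "x \<in> X"
  then have "{..x} \<subseteq> X" using assms(2) by auto
  then have "card {..x} \<le> card X" using assms(1) by (rule card_mono[rotated])
  then show "x < card X" by simp
next
  assume l: "x < card X"
  show "x \<in> X"
  proof (rule ccontr)
    assume "x \<notin> X"
    then have "X \<subseteq> {..<x}" using assms(2) by (metis leI lessThan_iff subsetI)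
    then have "card X \<le> card {..<x}" by (rule card_mono[rotated]) simp
    then show False using l by simp
  qed
qed

context
  fixes m n N
  assumes ideal: "order_ideal m n N"
begin

lemma ideal_bounds: "(t, j) \<in> N \<Longrightarrow> t < m \<and> j < n"
  using ideal unfolding order_ideal_def by auto

lemma ideal_down: "(t, j) \<in> N \<Longrightarrow> t' \<le> t \<Longrightarrow> j' \<le> j \<Longrightarrow> (t', j') \<in> N"
  using ideal unfolding order_ideal_def by blast

lemma row_len_iff: "(t, j) \<in> N \<longleftrightarrow> j < row_len N t"
proof -
  have "finite {j. (t, j) \<in> N}"
    by (rule finite_subset[of _ "{..<n}"]) (auto dest: ideal_bounds)
  then show ?thesis
    unfolding row_len_def using down_closed_iff_less_card[of "{j. (t, j) \<in> N}" j] ideal_down by auto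
qed

lemma col_len_iff: "(t, j) \<in> N \<longleftrightarrow> t < col_len N j"
proof -
  have "finite {t. (t, j) \<in> N}"
    by (rule finite_subset[of _ "{..<m}"]) (auto dest: ideal_bounds)
  then show ?thesis
    unfolding col_len_def using down_closed_iff_less_card[of "{t. (t, j) \<in> N}" t] ideal_down by auto
qed

lemma row_len_le: "row_len N t \<le> n"
  using row_len_iff[of t n] ideal_bounds[of t n] by (meson leI less_irrefl)

lemma col_len_le: "col_len N j \<le> m"
  using col_len_iff[of m j] ideal_bounds[of m j] by (meson leI less_irrefl)

lemma row_len_antimono: "t' \<le> t \<Longrightarrow> row_len N t \<le> row_len N t'"
  using row_len_iff ideal_down by (meson leI less_irrefl order_refl)

lemma col_len_antimono: "j' \<le> j \<Longrightarrow> col_len N j \<le> col_len N j'"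
  using col_len_iff ideal_down by (meson leI less_irrefl order_refl)

end

text \<open>The position (up to a shift) of a basis vector in the shuffle of the
  \<open>\<epsilon>\<^sub>i\<close> and \<open>\<delta>\<^sub>j\<close> in which \<open>\<delta>\<^sub>j\<close> precedes \<open>\<epsilon>\<^sub>i\<close> iff \<open>(m - i, j - 1) \<in> N\<close>.\<close>

fun shuffle_pos :: "nat \<Rightarrow> (nat \<times> nat) set \<Rightarrow> idx \<Rightarrow> nat" where
  "shuffle_pos m N (Eps i) = i + row_len N (m - i)"
| "shuffle_pos m N (Del j) = j + m - col_len N (j - 1)"

lemma idx_cases:
  assumes "a \<in> idxs m n"
  obtains t where "t < m" "a = Eps (m - t)" | j where "j < n" "a = Del (Suc j)"
proof (cases a)
  case (Eps i)
  then show ?thesis using assms that(1)[of "m - i"] by auto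
next
  case (Del j)
  then show ?thesis using assms that(2)[of "j - 1"] by auto
qed

context
  fixes m n N
  assumes ideal: "order_ideal m n N"
begin

lemma shuffle_pos_Eps: "t < m \<Longrightarrow> shuffle_pos m N (Eps (m - t)) = m - t + row_len N t"
  by simp

lemma shuffle_pos_Del: "shuffle_pos m N (Del (Suc j)) = Suc j + (m - col_len N j)"
  using col_len_le[OF ideal, of j] by simp

lemma shuffle_pos_less_Eps_Eps:
  assumes "t < m" "t' < m"
  shows "shuffle_pos m N (Eps (m - t)) < shuffle_pos m N (Eps (m - t')) \<longleftrightarrow> t' < t"
proof -
  have *: "shuffle_pos m N (Eps (m - t)) < shuffle_pos m N (Eps (m - t'))" if "t' < t" "t < m" for t t'
    using that row_len_antimono[OF ideal, of t' t] by simp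
  show ?thesis using *[of t' t] *[of t t'] assms by (cases t t' rule: linorder_cases) auto
qed

lemma shuffle_pos_less_Del_Del:
  "shuffle_pos m N (Del (Suc j)) < shuffle_pos m N (Del (Suc j')) \<longleftrightarrow> j < j'"
proof -
  have *: "shuffle_pos m N (Del (Suc j)) < shuffle_pos m N (Del (Suc j'))" if "j < j'" for j j'
    unfolding shuffle_pos_Del using that col_len_antimono[OF ideal, of j j'] by simp
  show ?thesis using *[of j' j] *[of j j'] by (cases j j' rule: linorder_cases) auto
qed

lemma shuffle_pos_less_mixed:
  assumes "t < m" "j < n"
  shows "shuffle_pos m N (Del (Suc j)) < shuffle_pos m N (Eps (m - t)) \<longleftrightarrow> (t, j) \<in> N"
    "shuffle_pos m N (Eps (m - t)) < shuffle_pos m N (Del (Suc j)) \<longleftrightarrow> (t, j) \<notin> N"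
proof -
  have 1: "shuffle_pos m N (Del (Suc j)) < shuffle_pos m N (Eps (m - t))" if "(t, j) \<in> N"
    unfolding shuffle_pos_Del shuffle_pos_Eps[OF assms(1)]
    using that row_len_iff[OF ideal, of t j] col_len_iff[OF ideal, of t j] col_len_le[OF ideal, of j] by linarith
  have 2: "shuffle_pos m N (Eps (m - t)) < shuffle_pos m N (Del (Suc j))" if "(t, j) \<notin> N"
    unfolding shuffle_pos_Del shuffle_pos_Eps[OF assms(1)]
    using that row_len_iff[OF ideal, of t j] col_len_iff[OF ideal, of t j] assms(1) by linarith
  show "shuffle_pos m N (Del (Suc j)) < shuffle_pos m N (Eps (m - t)) \<longleftrightarrow> (t, j) \<in> N"
    "shuffle_pos m N (Eps (m - t)) < shuffle_pos m N (Del (Suc j)) \<longleftrightarrow> (t, j) \<notin> N"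
    using 1 2 by (meson less_asym)+
qed

lemma shuffle_pos_inj: "inj_on (shuffle_pos m N) (idxs m n)"
proof (rule inj_onI)
  fix a b assume ab: "a \<in> idxs m n" "b \<in> idxs m n" "shuffle_pos m N a = shuffle_pos m N b"
  show "a = b"
  proof (rule idx_cases[OF ab(1)]; rule idx_cases[OF ab(2)])
    fix t t' assume "t < m" "a = Eps (m - t)" "t' < m" "b = Eps (m - t')"
    then show ?thesis using ab(3) shuffle_pos_less_Eps_Eps[of t t'] shuffle_pos_less_Eps_Eps[of t' t]
      by (metis less_irrefl linorder_neqE_nat)
  next
    fix j j' assume "j < n" "a = Del (Suc j)" "j' < n" "b = Del (Suc j')"
    then show ?thesis using ab(3) shuffle_pos_less_Del_Del[of j j'] shuffle_pos_less_Del_Del[of j' j]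
      by (metis less_irrefl linorder_neqE_nat)
  next
    fix t j assume "t < m" "a = Eps (m - t)" "j < n" "b = Del (Suc j)"
    then show ?thesis using ab(3) shuffle_pos_less_mixed[of t j] by (metis less_irrefl)
  next
    fix t j assume "t < m" "b = Eps (m - t)" "j < n" "a = Del (Suc j)"
    then show ?thesis using ab(3) shuffle_pos_less_mixed[of t j] by (metis less_irrefl)
  qed
qed

lemma even_order_roots: "order_roots m n (shuffle_pos m N) \<inter> even_roots m n = std_even_positive m n"
proof (intro equalityI subsetI)
  fix \<alpha> assume "\<alpha> \<in> order_roots m n (shuffle_pos m N) \<inter> even_roots m n"
  then obtain a b where ab: "\<alpha> = unit_wt a - unit_wt b" "a \<in> idxs m n" "b \<in> idxs m n" "odd_idx a = odd_idx b"
    "shuffle_pos m N a < shuffle_pos m N b"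
    using unit_diff_in_order_roots_iff unfolding even_roots_eq by blast
  show "\<alpha> \<in> std_even_positive m n"
  proof (rule idx_cases[OF ab(2)]; rule idx_cases[OF ab(3)])
    fix t t' assume t: "t < m" "a = Eps (m - t)" "t' < m" "b = Eps (m - t')"
    then have "t' < t" using ab(5) shuffle_pos_less_Eps_Eps[of t t'] by simp
    then have "1 \<le> m - t \<and> m - t < m - t' \<and> m - t' \<le> m" using t by auto
    then show ?thesis unfolding std_even_positive_def ab(1) t(2,4) by blast
  next
    fix j j' assume j: "j < n" "a = Del (Suc j)" "j' < n" "b = Del (Suc j')"
    then have "j < j'" using ab(5) shuffle_pos_less_Del_Del[of j j'] by simp
    then have "1 \<le> Suc j \<and> Suc j < Suc j' \<and> Suc j' \<le> n" using j by auto
    then show ?thesis unfolding std_even_positive_def ab(1) j(2,4) by blast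
  qed (use ab(4) in auto)
next
  fix \<alpha> assume "\<alpha> \<in> std_even_positive m n"
  then consider i k where "\<alpha> = \<epsilon> i - \<epsilon> k" "1 \<le> i" "i < k" "k \<le> m"
    | i k where "\<alpha> = \<delta> i - \<delta> k" "1 \<le> i" "i < k" "k \<le> n"
    unfolding std_even_positive_def by blast
  then show "\<alpha> \<in> order_roots m n (shuffle_pos m N) \<inter> even_roots m n"
  proof cases
    case (1 i k)
    then have "shuffle_pos m N (Eps i) < shuffle_pos m N (Eps k)"
      using shuffle_pos_less_Eps_Eps[of "m - i" "m - k"] by simp
    moreover have "Eps i \<in> idxs m n" "Eps k \<in> idxs m n" "Eps i \<noteq> Eps k" using 1 by auto
    ultimately show ?thesis using 1(1) unfolding order_roots_def even_roots_eq by force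
  next
    case (2 i k)
    then have "shuffle_pos m N (Del i) < shuffle_pos m N (Del k)"
      using shuffle_pos_less_Del_Del[of "i - 1" "k - 1"] by simp
    moreover have "Del i \<in> idxs m n" "Del k \<in> idxs m n" "Del i \<noteq> Del k" using 2 by auto
    ultimately show ?thesis using 2(1) unfolding order_roots_def even_roots_eq by force
  qed
qed

lemma covering_roots_in_bases: "covering_roots m n (shuffle_pos m N) \<in> bases m n"
  unfolding bases_def
  using covering_roots_base[OF shuffle_pos_inj] positive_covering_roots[OF shuffle_pos_inj] even_order_roots
  by simp

end

definition base_ideal :: "nat \<Rightarrow> nat \<Rightarrow> weight set \<Rightarrow> (nat \<times> nat) set" where
  "base_ideal m n \<Sigma> = {(t, j). t < m \<and> j < n \<and> \<delta> (Suc j) - \<epsilon> (m - t) \<in> positive_roots m n \<Sigma>}"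

context
  fixes m n \<Sigma>
  assumes bs: "\<Sigma> \<in> bases m n"
begin

lemma bases_is_base: "is_base m n \<Sigma>"
  using bs unfolding bases_def by blast

lemma positive_even_Eps:
  assumes "i \<in> {1..m}" "k \<in> {1..m}"
  shows "\<epsilon> i - \<epsilon> k \<in> positive_roots m n \<Sigma> \<longleftrightarrow> i < k"
proof
  assume p: "\<epsilon> i - \<epsilon> k \<in> positive_roots m n \<Sigma>"
  then have "\<epsilon> i - \<epsilon> k \<noteq> 0" using root_nonzero unfolding positive_roots_def by blast
  then have "i \<noteq> k" by auto
  moreover have "\<not> k < i"
  proof
    assume "k < i"
    then have "\<epsilon> k - \<epsilon> i \<in> positive_roots m n \<Sigma>"
      using bs assms unfolding bases_def std_even_positive_def by fastforce
    from positive_roots_sum_nonzero[OF bases_is_base p this] show False by simp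
  qed
  ultimately show "i < k" by simp
next
  assume "i < k"
  then have "\<epsilon> i - \<epsilon> k \<in> std_even_positive m n" using assms unfolding std_even_positive_def by auto
  then show "\<epsilon> i - \<epsilon> k \<in> positive_roots m n \<Sigma>" using bs unfolding bases_def by blast
qed

lemma positive_even_Del:
  assumes "i \<in> {1..n}" "k \<in> {1..n}"
  shows "\<delta> i - \<delta> k \<in> positive_roots m n \<Sigma> \<longleftrightarrow> i < k"
proof
  assume p: "\<delta> i - \<delta> k \<in> positive_roots m n \<Sigma>"
  then have "\<delta> i - \<delta> k \<noteq> 0" using root_nonzero unfolding positive_roots_def by blast
  then have "i \<noteq> k" by auto
  moreover have "\<not> k < i"
  proof
    assume "k < i"
    then have "\<delta> k - \<delta> i \<in> positive_roots m n \<Sigma>"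
      using bs assms unfolding bases_def std_even_positive_def by fastforce
    from positive_roots_sum_nonzero[OF bases_is_base p this] show False by simp
  qed
  ultimately show "i < k" by simp
next
  assume "i < k"
  then have "\<delta> i - \<delta> k \<in> std_even_positive m n" using assms unfolding std_even_positive_def by auto
  then show "\<delta> i - \<delta> k \<in> positive_roots m n \<Sigma>" using bs unfolding bases_def by blast
qed

lemma positive_roots_trans:
  assumes "unit_wt a - unit_wt b \<in> positive_roots m n \<Sigma>" "unit_wt b - unit_wt c \<in> positive_roots m n \<Sigma>"
    "a \<in> idxs m n" "c \<in> idxs m n" "a \<noteq> c"
  shows "unit_wt a - unit_wt c \<in> positive_roots m n \<Sigma>"
proof -
  have "unit_wt a - unit_wt c \<in> roots m n" using assms unfolding roots_eq by blast
  then show ?thesis using positive_roots_add[OF bases_is_base assms(1,2)] by simp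
qed

lemma positive_odd_iff:
  assumes "t < m" "j < n"
  shows "\<epsilon> (m - t) - \<delta> (Suc j) \<in> positive_roots m n \<Sigma> \<longleftrightarrow> (t, j) \<notin> base_ideal m n \<Sigma>"
proof -
  have idx: "Eps (m - t) \<in> idxs m n" "Del (Suc j) \<in> idxs m n" using assms by auto
  then have "\<epsilon> (m - t) - \<delta> (Suc j) \<in> roots m n" unfolding roots_eq by blast
  then have "\<epsilon> (m - t) - \<delta> (Suc j) \<in> positive_roots m n \<Sigma> \<longleftrightarrow> - (\<epsilon> (m - t) - \<delta> (Suc j)) \<notin> positive_roots m n \<Sigma>"
    using positive_root_or[OF bases_is_base] uminus_positive_root[OF bases_is_base] by blast
  then show ?thesis using assms by (simp add: base_ideal_def)
qed

text \<open>Positivity is transitive, and the even positive roots extend a relation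
  "\<open>\<delta>\<close> before \<open>\<epsilon>\<close>" to earlier \<open>\<delta>\<close> and
  later \<open>\<epsilon>\<close>.\<close>

lemma base_ideal_ideal: "order_ideal m n (base_ideal m n \<Sigma>)"
  unfolding order_ideal_def
proof (intro conjI allI impI)
  fix t j t' j' assume N: "(t, j) \<in> base_ideal m n \<Sigma>" and le: "t' \<le> t" "j' \<le> j"
  then have b: "t < m" "j < n" "\<delta> (Suc j) - \<epsilon> (m - t) \<in> positive_roots m n \<Sigma>"
    by (auto simp: base_ideal_def)
  have 1: "\<delta> (Suc j') - \<epsilon> (m - t) \<in> positive_roots m n \<Sigma>"
  proof (cases "j' = j")
    case False
    then have "\<delta> (Suc j') - \<delta> (Suc j) \<in> positive_roots m n \<Sigma>"
      using positive_even_Del[of "Suc j'" "Suc j"] le b by simp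
    then show ?thesis using positive_roots_trans[OF _ b(3)] b le by simp
  qed (use b in simp)
  have "\<delta> (Suc j') - \<epsilon> (m - t') \<in> positive_roots m n \<Sigma>"
  proof (cases "t' = t")
    case False
    then have "\<epsilon> (m - t) - \<epsilon> (m - t') \<in> positive_roots m n \<Sigma>"
      using positive_even_Eps[of "m - t" "m - t'"] le b by simp
    then show ?thesis using positive_roots_trans[OF 1] b le by simp
  qed (use 1 in simp)
  then show "(t', j') \<in> base_ideal m n \<Sigma>" using b le by (simp add: base_ideal_def)
qed (auto simp: base_ideal_def)

text \<open>Highest weights and rho are defined through positive roots, so for both of them the base
  may now be replaced by its ideal.\<close>

lemma positive_roots_eq: "positive_roots m n \<Sigma> = order_roots m n (shuffle_pos m (base_ideal m n \<Sigma>))"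
proof -
  let ?N = "base_ideal m n \<Sigma>"
  note ideal = base_ideal_ideal
  have iff: "unit_wt a - unit_wt b \<in> positive_roots m n \<Sigma> \<longleftrightarrow> shuffle_pos m ?N a < shuffle_pos m ?N b"
    if ab: "a \<in> idxs m n" "b \<in> idxs m n" for a b
  proof (rule idx_cases[OF ab(1)]; rule idx_cases[OF ab(2)])
    fix t t' assume "t < m" "a = Eps (m - t)" "t' < m" "b = Eps (m - t')"
    then show ?thesis
      using shuffle_pos_less_Eps_Eps[OF ideal, of t t'] positive_even_Eps[of "m - t" "m - t'"] by auto
  next
    fix j j' assume "j < n" "a = Del (Suc j)" "j' < n" "b = Del (Suc j')"
    then show ?thesis
      using shuffle_pos_less_Del_Del[OF ideal, of j j'] positive_even_Del[of "Suc j" "Suc j'"] by auto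
  next
    fix t j assume "t < m" "a = Eps (m - t)" "j < n" "b = Del (Suc j)"
    then show ?thesis using shuffle_pos_less_mixed(2)[OF ideal, of t j] positive_odd_iff[of t j] by simp
  next
    fix t j assume "t < m" "b = Eps (m - t)" "j < n" "a = Del (Suc j)"
    then show ?thesis using shuffle_pos_less_mixed(1)[OF ideal, of t j] by (simp add: base_ideal_def)
  qed
  show ?thesis
  proof (intro equalityI subsetI)
    fix \<alpha> assume p: "\<alpha> \<in> positive_roots m n \<Sigma>"
    then obtain a b where "\<alpha> = unit_wt a - unit_wt b" "a \<in> idxs m n" "b \<in> idxs m n"
      unfolding positive_roots_def roots_eq by blast
    then show "\<alpha> \<in> order_roots m n (shuffle_pos m ?N)" using p iff unfolding order_roots_def by blast
  next
    fix \<alpha> assume "\<alpha> \<in> order_roots m n (shuffle_pos m ?N)"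
    then obtain a b where "\<alpha> = unit_wt a - unit_wt b" "a \<in> idxs m n" "b \<in> idxs m n"
      "shuffle_pos m ?N a < shuffle_pos m ?N b"
      unfolding order_roots_def by blast
    then show "\<alpha> \<in> positive_roots m n \<Sigma>" using iff[of a b] by simp
  qed
qed

end

lemma finite_bases: "finite (bases m n)"
proof -
  have "bases m n \<subseteq> Pow (roots m n)" unfolding bases_def is_base_def by blast
  then show ?thesis by (rule finite_subset) (simp add: finite_roots)
qed

lemma order_ideal_empty: "order_ideal m n {}"
  by (simp add: order_ideal_def)

lemma base_ideal_covering:
  assumes "order_ideal m n N"
  shows "base_ideal m n (covering_roots m n (shuffle_pos m N)) = N"
proof -
  have "\<delta> (Suc j) - \<epsilon> (m - t) \<in> order_roots m n (shuffle_pos m N) \<longleftrightarrow> (t, j) \<in> N" if "t < m" "j < n" for t j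
    using unit_diff_in_order_roots_iff[of "Del (Suc j)" m n "Eps (m - t)" "shuffle_pos m N"]
      shuffle_pos_less_mixed(1)[OF assms that] that by simp
  then show ?thesis
    unfolding base_ideal_def positive_covering_roots[OF shuffle_pos_inj[OF assms]]
    using ideal_bounds[OF assms] by blast
qed

text \<open>Makes the distinguished base, as the empty ideal, the starting point of all
  reflections.\<close>

lemma dist_base_eq: "dist_base m n = covering_roots m n (shuffle_pos m {})"
proof -
  have [simp]: "row_len {} t = 0" "col_len {} j = 0" for t j
    by (simp_all add: row_len_def col_len_def)
  have pos: "shuffle_pos m {} (Eps i) = i" "shuffle_pos m {} (Del j) = j + m" for i j
    by simp_all
  let ?C = "covering_roots m n (shuffle_pos m {})"
  have cov: "unit_wt a - unit_wt b \<in> ?C"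
    if "a \<in> idxs m n" "b \<in> idxs m n" "shuffle_pos m {} b = Suc (shuffle_pos m {} a)" for a b
    using that unfolding covering_roots_def by fastforce
  show ?thesis
  proof (intro equalityI subsetI)
    fix \<alpha> assume "\<alpha> \<in> dist_base m n"
    then consider i where "1 \<le> i" "i < m" "\<alpha> = \<epsilon> i - \<epsilon> (i + 1)"
      | "1 \<le> m" "1 \<le> n" "\<alpha> = \<epsilon> m - \<delta> 1"
      | j where "1 \<le> j" "j < n" "\<alpha> = \<delta> j - \<delta> (j + 1)"
      unfolding dist_base_def by (auto split: if_splits)
    then show "\<alpha> \<in> ?C"
    proof cases
      case (1 i)
      then show ?thesis using cov[of "Eps i" "Eps (i + 1)"] pos by simp
    next
      case 2
      then show ?thesis using cov[of "Eps m" "Del 1"] pos by simp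
    next
      case (3 j)
      then show ?thesis using cov[of "Del j" "Del (j + 1)"] pos by simp
    qed
  next
    fix \<alpha> assume "\<alpha> \<in> ?C"
    then obtain a b where ab: "\<alpha> = unit_wt a - unit_wt b" "a \<in> idxs m n" "b \<in> idxs m n"
      "shuffle_pos m {} a < shuffle_pos m {} b"
      and no: "\<And>c. c \<in> idxs m n \<Longrightarrow> \<not> (shuffle_pos m {} a < shuffle_pos m {} c \<and> shuffle_pos m {} c < shuffle_pos m {} b)"
      unfolding covering_roots_def by blast
    show "\<alpha> \<in> dist_base m n"
    proof (cases a; cases b)
      fix i k assume e: "a = Eps i" "b = Eps k"
      then have "k = i + 1" using no[of "Eps (i + 1)"] ab pos by auto
      then show ?thesis using ab e unfolding dist_base_def by auto
    next
      fix i k assume e: "a = Eps i" "b = Del k"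
      then have "i = m" using no[of "Eps m"] ab pos by auto
      moreover have "k = 1" using no[of "Del 1"] e ab pos by auto
      ultimately show ?thesis using ab e unfolding dist_base_def by auto
    next
      fix i k assume e: "a = Del i" "b = Eps k"
      then show ?thesis using ab pos by auto
    next
      fix i k assume e: "a = Del i" "b = Del k"
      then have "k = i + 1" using no[of "Del (i + 1)"] ab pos by auto
      then show ?thesis using ab e unfolding dist_base_def by auto
    qed
  qed
qed


section \<open>Highest weights for all bases\<close>

text \<open>The coordinates of rho for the distinguished base. The terms \<open>n / 2\<close> and
  \<open>m / 2\<close> with their signs come from the odd roots through the index, the last summand
  is the integrality shift, and the rest comes from the even roots.\<close>

definition rho_dist :: "nat \<Rightarrow> nat \<Rightarrow> idx \<Rightarrow> complex" where
  "rho_dist m n a = (case a of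
     Eps i \<Rightarrow> (of_nat m + 1 - 2 * of_nat i - of_nat n) / 2 + (if odd (m + n) then 0 else 1/2)
   | Del j \<Rightarrow> (of_nat n + 1 - 2 * of_nat j + of_nat m) / 2 - (if odd (m + n) then 0 else 1/2))"

text \<open>Index \<open>k\<close> is the first entry of \<open>M - k\<close> pairs and the second
  entry of \<open>k - 1\<close> pairs.\<close>

lemma sum_unit_diffs:
  fixes u :: "nat \<Rightarrow> idx" and M :: nat
  assumes "inj u"
  defines "A \<equiv> {unit_wt (u i) - unit_wt (u j) | i j. 1 \<le> i \<and> i < j \<and> j \<le> M}"
  shows "1 \<le> k \<Longrightarrow> k \<le> M \<Longrightarrow> (\<Sum>\<alpha>\<in>A. \<alpha>) (u k) = of_nat M + 1 - 2 * of_nat k"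
    and "c \<notin> range u \<Longrightarrow> (\<Sum>\<alpha>\<in>A. \<alpha>) c = 0"
proof -
  let ?I = "{(i, j). 1 \<le> i \<and> i < j \<and> j \<le> M}"
  let ?g = "\<lambda>(i, j). unit_wt (u i) - unit_wt (u j)"
  have fin: "finite ?I" by (rule finite_subset[of _ "{..M} \<times> {..M}"]) auto
  have img: "A = ?g ` ?I" unfolding A_def by auto
  have inj: "inj_on ?g ?I"
  proof (rule inj_onI)
    fix p q assume pq: "p \<in> ?I" "q \<in> ?I" "?g p = ?g q"
    obtain i j i' j' where e: "p = (i, j)" "q = (i', j')" by (metis surj_pair)
    have "u i \<noteq> u j" using pq e assms(1) by (auto dest: injD)
    then have "u i = u i' \<and> u j = u j'" using pq(3) unit_diff_eq_iff[of "u i" "u j" "u i'" "u j'"] e by simp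
    then show "p = q" using e assms(1) by (auto dest: injD)
  qed
  have ev: "(\<Sum>\<alpha>\<in>A. \<alpha>) c = (\<Sum>p\<in>?I. unit_wt (u (fst p)) c - unit_wt (u (snd p)) c)" for c
    unfolding img sum.reindex[OF inj] sum_fun_apply by (rule sum.cong) auto
  show "(\<Sum>\<alpha>\<in>A. \<alpha>) c = 0" if "c \<notin> range u"
    unfolding ev using that by (intro sum.neutral) (auto simp: unit_wt_def)
  assume k: "1 \<le> k" "k \<le> M"
  have "(\<Sum>\<alpha>\<in>A. \<alpha>) (u k) = (\<Sum>p\<in>?I. (if fst p = k then 1 else 0) - (if snd p = k then 1 else 0))"
    unfolding ev
    by (rule sum.cong[OF refl]) (simp add: unit_wt_def inj_eq[OF assms(1)] eq_commute[of k])
  also have "\<dots> = of_nat (card {p \<in> ?I. fst p = k}) - of_nat (card {p \<in> ?I. snd p = k})"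
    using fin by (simp add: sum_subtractf sum.If_cases Int_def conj_commute)
  also have "{p \<in> ?I. fst p = k} = Pair k ` {k<..M}" using k by auto
  also have "{p \<in> ?I. snd p = k} = (\<lambda>i. (i, k)) ` {1..<k}" using k by auto
  also have "card (Pair k ` {k<..M}) = M - k" by (simp add: card_image inj_on_def)
  also have "card ((\<lambda>i. (i, k)) ` {1..<k}) = k - 1" by (simp add: card_image inj_on_def)
  finally show "(\<Sum>\<alpha>\<in>A. \<alpha>) (u k) = of_nat M + 1 - 2 * of_nat k"
    using k by (simp add: of_nat_diff)
qed

lemma sum_std_even_positive:
  shows "1 \<le> k \<Longrightarrow> k \<le> m \<Longrightarrow> (\<Sum>\<alpha>\<in>std_even_positive m n. \<alpha>) (Eps k) = of_nat m + 1 - 2 * of_nat k"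
    and "1 \<le> k \<Longrightarrow> k \<le> n \<Longrightarrow> (\<Sum>\<alpha>\<in>std_even_positive m n. \<alpha>) (Del k) = of_nat n + 1 - 2 * of_nat k"
proof -
  let ?A = "{\<epsilon> i - \<epsilon> j | i j. 1 \<le> i \<and> i < j \<and> j \<le> m}"
  let ?B = "{\<delta> i - \<delta> j | i j. 1 \<le> i \<and> i < j \<and> j \<le> n}"
  have fin: "finite ?A" "finite ?B"
    by (rule finite_subset[OF _ finite_roots[of m n]], force simp: roots_eq)+
  have "?A \<inter> ?B = {}" by (auto simp: unit_diff_eq_iff)
  then have "(\<Sum>\<alpha>\<in>std_even_positive m n. \<alpha>) = (\<Sum>\<alpha>\<in>?A. \<alpha>) + (\<Sum>\<alpha>\<in>?B. \<alpha>)"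
    unfolding std_even_positive_def by (rule sum.union_disjoint[OF fin])
  then have s: "(\<Sum>\<alpha>\<in>std_even_positive m n. \<alpha>) c = (\<Sum>\<alpha>\<in>?A. \<alpha>) c + (\<Sum>\<alpha>\<in>?B. \<alpha>) c" for c
    by (simp only: plus_fun_apply)
  have inj: "inj Eps" "inj Del" by (auto simp: inj_def)
  show "(\<Sum>\<alpha>\<in>std_even_positive m n. \<alpha>) (Eps k) = of_nat m + 1 - 2 * of_nat k" if "1 \<le> k" "k \<le> m"
    unfolding s using sum_unit_diffs(1)[OF inj(1) that] sum_unit_diffs(2)[OF inj(2), of "Eps k" n] by auto
  show "(\<Sum>\<alpha>\<in>std_even_positive m n. \<alpha>) (Del k) = of_nat n + 1 - 2 * of_nat k" if "1 \<le> k" "k \<le> n"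
    unfolding s using sum_unit_diffs(1)[OF inj(2) that] sum_unit_diffs(2)[OF inj(1), of "Del k" m] by auto
qed

lemma sum_signs:
  assumes "X \<subseteq> {..<k}"
  shows "(\<Sum>i<k. if i \<in> X then -1 else 1 :: complex) = of_nat k - 2 * of_nat (card X)"
proof -
  have "{..<k} \<inter> {i. i \<in> X} = X" "{..<k} \<inter> - {i. i \<in> X} = {..<k} - X" using assms by auto
  moreover have "card ({..<k} - X) = k - card X" "card X \<le> k"
    using assms card_mono[OF _ assms] by (auto simp: card_Diff_subset finite_subset)
  ultimately show ?thesis by (simp add: sum.If_cases of_nat_diff)
qed

text \<open>Each cell of the ideal replaces a positive root \<open>\<epsilon> - \<delta>\<close> by
  its negative, which adds that root to rho. So row \<open>t\<close> gains one per cell and column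
  \<open>j\<close> loses one per cell.\<close>

lemma rho_coords:
  assumes bs: "\<Sigma> \<in> bases m n"
  defines "N \<equiv> base_ideal m n \<Sigma>"
  shows "t < m \<Longrightarrow> rho m n \<Sigma> (Eps (m - t)) = rho_dist m n (Eps (m - t)) + of_nat (row_len N t)"
    and "j < n \<Longrightarrow> rho m n \<Sigma> (Del (Suc j)) = rho_dist m n (Del (Suc j)) - of_nat (col_len N j)"
proof -
  let ?I = "{..<m} \<times> {..<n}"
  let ?g = "\<lambda>(t, j). if (t, j) \<in> N then \<delta> (Suc j) - \<epsilon> (m - t) else \<epsilon> (m - t) - \<delta> (Suc j)"
  note ideal = base_ideal_ideal[OF bs, folded N_def]
  have odd: "positive_roots m n \<Sigma> \<inter> odd_roots m n = ?g ` ?I"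
  proof (intro equalityI subsetI)
    fix \<alpha> assume "\<alpha> \<in> positive_roots m n \<Sigma> \<inter> odd_roots m n"
    then obtain a b where ab: "\<alpha> = unit_wt a - unit_wt b" "a \<in> idxs m n" "b \<in> idxs m n"
      "odd_idx a \<noteq> odd_idx b" "unit_wt a - unit_wt b \<in> positive_roots m n \<Sigma>"
      unfolding odd_roots_eq by blast
    show "\<alpha> \<in> ?g ` ?I"
    proof (rule idx_cases[OF ab(2)]; rule idx_cases[OF ab(3)])
      fix t j assume e: "t < m" "a = Eps (m - t)" "j < n" "b = Del (Suc j)"
      then have "(t, j) \<notin> N" using positive_odd_iff[OF bs, of t j] ab unfolding N_def by simp
      then show ?thesis using e ab(1) by (intro image_eqI[of _ _ "(t, j)"]) auto
    next
      fix t j assume e: "t < m" "b = Eps (m - t)" "j < n" "a = Del (Suc j)"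
      then have "(t, j) \<in> N" using ab unfolding N_def base_ideal_def by simp
      then show ?thesis using e ab(1) by (intro image_eqI[of _ _ "(t, j)"]) auto
    qed (use ab(4) in auto)
  next
    fix \<alpha> assume "\<alpha> \<in> ?g ` ?I"
    then obtain t j where tj: "t < m" "j < n" "\<alpha> = ?g (t, j)" by blast
    then have idx: "Eps (m - t) \<in> idxs m n" "Del (Suc j) \<in> idxs m n" by auto
    show "\<alpha> \<in> positive_roots m n \<Sigma> \<inter> odd_roots m n"
    proof (cases "(t, j) \<in> N")
      case True
      then have "\<delta> (Suc j) - \<epsilon> (m - t) \<in> positive_roots m n \<Sigma>" unfolding N_def base_ideal_def by blast
      moreover have "\<delta> (Suc j) - \<epsilon> (m - t) \<in> odd_roots m n" unfolding odd_roots_eq using idx by fastforce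
      ultimately show ?thesis using tj True by simp
    next
      case False
      then have "\<epsilon> (m - t) - \<delta> (Suc j) \<in> positive_roots m n \<Sigma>"
        using positive_odd_iff[OF bs tj(1,2)] unfolding N_def by blast
      moreover have "\<epsilon> (m - t) - \<delta> (Suc j) \<in> odd_roots m n" unfolding odd_roots_eq using idx by fastforce
      ultimately show ?thesis using tj False by simp
    qed
  qed
  have inj: "inj_on ?g ?I"
  proof (rule inj_onI)
    fix p q assume pq: "p \<in> ?I" "q \<in> ?I" "?g p = ?g q"
    obtain t j t' j' where e: "p = (t, j)" "q = (t', j')" by (metis surj_pair)
    have "m - t = m - t' \<and> j = j'" using pq(3) e
      by (auto simp: unit_diff_eq_iff split: if_splits)
    then show "p = q" using pq e by auto
  qed
  have ev: "(\<Sum>\<alpha>\<in>positive_roots m n \<Sigma> \<inter> odd_roots m n. \<alpha>) c = (\<Sum>p\<in>?I. ?g p c)" for c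
    unfolding odd sum.reindex[OF inj] sum_fun_apply by simp
  have even: "positive_roots m n \<Sigma> \<inter> even_roots m n = std_even_positive m n"
    using bs unfolding bases_def by blast
  show "rho m n \<Sigma> (Eps (m - t)) = rho_dist m n (Eps (m - t)) + of_nat (row_len N t)" if t: "t < m"
  proof -
    have "(\<Sum>\<alpha>\<in>positive_roots m n \<Sigma> \<inter> odd_roots m n. \<alpha>) (Eps (m - t))
        = (\<Sum>t'<m. \<Sum>j<n. if t' = t then (if j \<in> {j. (t, j) \<in> N} then -1 else 1) else 0)"
    proof -
      have "?g (t', j) (Eps (m - t)) = (if t' = t then (if j \<in> {j. (t, j) \<in> N} then -1 else 1) else 0)"
        if "t' < m" for t' j
      proof -
        have "m - t = m - t' \<longleftrightarrow> t' = t" using t that by linarith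
        then show ?thesis by (simp add: unit_wt_def)
      qed
      then show ?thesis
        unfolding ev sum.cartesian_product by (intro sum.cong refl) (auto simp only: lessThan_iff mem_Sigma_iff split_conv)
    qed
    also have "\<dots> = (\<Sum>t'<m. if t' = t then (\<Sum>j<n. if j \<in> {j. (t, j) \<in> N} then -1 else 1) else 0)"
      by (intro sum.cong) auto
    also have "\<dots> = of_nat n - 2 * of_nat (row_len N t)"
    proof -
      have "{j. (t, j) \<in> N} \<subseteq> {..<n}" using ideal_bounds[OF ideal] by auto
      from sum_signs[OF this] show ?thesis using t unfolding row_len_def by simp
    qed
    finally have o: "(\<Sum>\<alpha>\<in>positive_roots m n \<Sigma> \<inter> odd_roots m n. \<alpha>) (Eps (m - t)) = of_nat n - 2 * of_nat (row_len N t)" .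
    have s: "((\<Sum>i=1..m. \<epsilon> i) - (\<Sum>j=1..n. \<delta> j)) (Eps (m - t)) = 1"
      using t by (simp add: sum_fun_apply unit_wt_def) 
    have e: "(\<Sum>\<alpha>\<in>std_even_positive m n. \<alpha>) (Eps (m - t)) = of_nat m + 1 - 2 * of_nat (m - t)"
      using sum_std_even_positive(1)[of "m - t" m n] t by simp
    have "rho m n \<Sigma> (Eps (m - t)) = 1/2 * (\<Sum>\<alpha>\<in>std_even_positive m n. \<alpha>) (Eps (m - t))
        - 1/2 * (\<Sum>\<alpha>\<in>positive_roots m n \<Sigma> \<inter> odd_roots m n. \<alpha>) (Eps (m - t))
        + (if odd (m + n) then 0 else 1/2) * ((\<Sum>i=1..m. \<epsilon> i) - (\<Sum>j=1..n. \<delta> j)) (Eps (m - t))"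
      unfolding rho_def even by (simp only: wscale_def plus_fun_apply fun_diff_def)
    then show ?thesis
      unfolding e o s rho_dist_def
      by (cases "odd (m + n)"; simp only: if_True if_False simp_thms idx.case; simp add: field_simps)
  qed
  show "rho m n \<Sigma> (Del (Suc j)) = rho_dist m n (Del (Suc j)) - of_nat (col_len N j)" if j: "j < n"
  proof -
    have "(\<Sum>\<alpha>\<in>positive_roots m n \<Sigma> \<inter> odd_roots m n. \<alpha>) (Del (Suc j))
        = (\<Sum>t<m. \<Sum>j'<n. if j' = j then - (if t \<in> {t. (t, j) \<in> N} then -1 else 1) else 0)"
    proof -
      have "?g (t, j') (Del (Suc j)) = (if j' = j then - (if t \<in> {t. (t, j) \<in> N} then -1 else 1) else 0)" for t j'
        by (simp add: unit_wt_def eq_commute[of j])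
      then show ?thesis
        unfolding ev sum.cartesian_product by (intro sum.cong refl) (auto simp only: split_conv)
    qed
    also have "\<dots> = - (\<Sum>t<m. if t \<in> {t. (t, j) \<in> N} then -1 else 1)"
      using j by (simp add: sum_negf)
    also have "\<dots> = - (of_nat m - 2 * of_nat (col_len N j))"
    proof -
      have "{t. (t, j) \<in> N} \<subseteq> {..<m}" using ideal_bounds[OF ideal] by auto
      from sum_signs[OF this] show ?thesis unfolding col_len_def by simp
    qed
    finally have o: "(\<Sum>\<alpha>\<in>positive_roots m n \<Sigma> \<inter> odd_roots m n. \<alpha>) (Del (Suc j)) = - (of_nat m - 2 * of_nat (col_len N j))" .
    have s: "((\<Sum>i=1..m. \<epsilon> i) - (\<Sum>j=1..n. \<delta> j)) (Del (Suc j)) = -1"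
      using j by (simp add: sum_fun_apply unit_wt_def)
    have e: "(\<Sum>\<alpha>\<in>std_even_positive m n. \<alpha>) (Del (Suc j)) = of_nat n + 1 - 2 * of_nat (Suc j)"
      using sum_std_even_positive(2)[of "Suc j" n m] j by simp
    have "rho m n \<Sigma> (Del (Suc j)) = 1/2 * (\<Sum>\<alpha>\<in>std_even_positive m n. \<alpha>) (Del (Suc j))
        - 1/2 * (\<Sum>\<alpha>\<in>positive_roots m n \<Sigma> \<inter> odd_roots m n. \<alpha>) (Del (Suc j))
        + (if odd (m + n) then 0 else 1/2) * ((\<Sum>i=1..m. \<epsilon> i) - (\<Sum>j=1..n. \<delta> j)) (Del (Suc j))"
      unfolding rho_def even by (simp only: wscale_def plus_fun_apply fun_diff_def)
    then show ?thesis
      unfolding e o s rho_dist_def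
      by (cases "odd (m + n)"; simp only: if_True if_False simp_thms idx.case; simp add: field_simps)
  qed
qed

text \<open>A cell maximising \<open>t + j\<close> is an outer corner, so removing it leaves an
  ideal and undoes one reflection.\<close>

lemma remove_maximal:
  assumes "order_ideal m n N" "N \<noteq> {}"
  obtains t j where "(t, j) \<in> N" "order_ideal m n (N - {(t, j)})"
    "row_len N t = Suc j" "row_len (N - {(t, j)}) t = j"
    "col_len N j = Suc t" "col_len (N - {(t, j)}) j = t"
    "\<And>t'. t' \<noteq> t \<Longrightarrow> row_len (N - {(t, j)}) t' = row_len N t'"
    "\<And>j'. j' \<noteq> j \<Longrightarrow> col_len (N - {(t, j)}) j' = col_len N j'"
proof -
  have fin: "finite N" by (rule finite_subset[of _ "{..<m} \<times> {..<n}"]) (use assms in \<open>auto simp: order_ideal_def\<close>)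
  obtain p where p: "p \<in> N" "\<And>q. q \<in> N \<Longrightarrow> fst q + snd q \<le> fst p + snd p"
  proof -
    have "Max ((\<lambda>q. fst q + snd q) ` N) \<in> (\<lambda>q. fst q + snd q) ` N" using fin assms(2) by (intro Max_in) auto
    then obtain p where "p \<in> N" "fst p + snd p = Max ((\<lambda>q. fst q + snd q) ` N)" by force
    then show ?thesis using that[of p] Max_ge[of "(\<lambda>q. fst q + snd q) ` N"] fin by simp
  qed
  obtain t j where e: "p = (t, j)" by force
  let ?N = "N - {(t, j)}"
  note down = ideal_down[OF assms(1)]
  have ideal: "order_ideal m n ?N"
    unfolding order_ideal_def
  proof (intro conjI allI impI)
    fix t2 j2 t1 j1 assume a: "(t2, j2) \<in> ?N" "t1 \<le> t2" "j1 \<le> j2"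
    then have "(t1, j1) \<in> N" using down by blast
    moreover have "(t1, j1) \<noteq> (t, j)" using a p(2)[of "(t2, j2)"] e by auto
    ultimately show "(t1, j1) \<in> ?N" by blast
  qed (use assms(1) in \<open>auto simp: order_ideal_def\<close>)
  have tj: "(t, j) \<in> N" using p e by simp
  have "(t, Suc j) \<notin> N" "(Suc t, j) \<notin> N" using p(2)[of "(t, Suc j)"] p(2)[of "(Suc t, j)"] e by auto
  then have 1: "row_len N t = Suc j" "col_len N j = Suc t"
    using tj row_len_iff[OF assms(1), of t j] row_len_iff[OF assms(1), of t "Suc j"]
      col_len_iff[OF assms(1), of t j] col_len_iff[OF assms(1), of "Suc t" j] by linarith+
  have sets: "{j'. (t, j') \<in> ?N} = {j'. (t, j') \<in> N} - {j}" "{t'. (t', j) \<in> ?N} = {t'. (t', j) \<in> N} - {t}" by auto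
  have 2: "row_len ?N t = j" "col_len ?N j = t"
    using 1 tj unfolding row_len_def col_len_def sets by auto
  have 3: "row_len ?N t' = row_len N t'" if "t' \<noteq> t" for t'
    using that unfolding row_len_def by simp
  have 4: "col_len ?N j' = col_len N j'" if "j' \<noteq> j" for j'
    using that unfolding col_len_def by simp
  show ?thesis by (rule that[OF tj ideal 1(1) 2(1) 1(2) 2(2) 3 4])
qed

text \<open>The value of lambda + rho reached by the process, minus rho in the form of
  \<open>rho_coords\<close>. In the \<open>Del\<close> branch \<open>run\<close> is negated because
  the process works with negated coordinates.\<close>

definition ideal_weight ::
  "nat \<Rightarrow> nat \<Rightarrow> (nat \<Rightarrow> int) \<Rightarrow> (nat \<Rightarrow> int) \<Rightarrow> (nat \<times> nat) set \<Rightarrow> weight" where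
  "ideal_weight m n a b N x = (case x of
     Eps i \<Rightarrow> if i \<in> {1..m}
       then of_int (run a b (m - i) (row_len N (m - i))) - of_nat (row_len N (m - i)) - rho_dist m n x else 0
   | Del j \<Rightarrow> if j \<in> {1..n}
       then - of_int (run b a (j - 1) (col_len N (j - 1))) + of_nat (col_len N (j - 1)) - rho_dist m n x else 0)"

lemma ideal_weight_Eps:
  "t < m \<Longrightarrow> ideal_weight m n a b N (Eps (m - t))
    = of_int (run a b t (row_len N t)) - of_nat (row_len N t) - rho_dist m n (Eps (m - t))"
  by (simp add: ideal_weight_def Suc_le_eq)

lemma ideal_weight_Del:
  "j < n \<Longrightarrow> ideal_weight m n a b N (Del (Suc j))
    = - of_int (run b a j (col_len N j)) + of_nat (col_len N j) - rho_dist m n (Del (Suc j))"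
  by (simp add: ideal_weight_def)

section \<open>The highest weight for each order ideal\<close>

lemma (in gl_module) hwv_cong:
  assumes "hwv f \<nu> v" "\<And>a. a \<in> idxs m n \<Longrightarrow> \<nu> a = \<nu>' a"
  shows "hwv f \<nu>' v"
  using assms by (simp add: hwv_def)

text \<open>The ideal is filled cell by cell, with one odd reflection each. At a hit the unit gained
  by \<open>run\<close> cancels against the longer row or column, and the weight stays; otherwise
  only the lengths grow, and the weight drops by the root.\<close>

lemma (in gl_module) hwv_ideal:
  assumes simple: "simple_module" and v: "hwv (shuffle_pos m {}) (ideal_weight m n a b {}) v"
    and ideal: "order_ideal m n N"
  shows "\<exists>w. hwv (shuffle_pos m N) (ideal_weight m n a b N) w"
  using ideal
proof (induction "card N" arbitrary: N)
  case 0
  then have "finite N" using finite_subset[of N "{..<m} \<times> {..<n}"] by (auto simp: order_ideal_def)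
  then have "N = {}" using 0 by simp
  then show ?case using v by blast
next
  case (Suc k)
  then have "N \<noteq> {}" by auto
  obtain t j where tj: "(t, j) \<in> N" "order_ideal m n (N - {(t, j)})"
    "row_len N t = Suc j" "row_len (N - {(t, j)}) t = j"
    "col_len N j = Suc t" "col_len (N - {(t, j)}) j = t"
    "\<And>t'. t' \<noteq> t \<Longrightarrow> row_len (N - {(t, j)}) t' = row_len N t'"
    "\<And>j'. j' \<noteq> j \<Longrightarrow> col_len (N - {(t, j)}) j' = col_len N j'"
    by (rule remove_maximal[OF Suc.prems \<open>N \<noteq> {}\<close>]) (rule that; assumption)
  let ?N = "N - {(t, j)}" and ?p = "Eps (m - t)" and ?q = "Del (Suc j)"
  let ?\<nu> = "ideal_weight m n a b ?N"
  have bd: "t < m" "j < n" using ideal_bounds[OF Suc.prems tj(1)] by auto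
  have "card ?N = k" using Suc.hyps(2) tj(1) by (simp add: card_Diff_singleton)
  then obtain u where u: "hwv (shuffle_pos m ?N) ?\<nu> u" using Suc.hyps(1) tj(2) by blast
  have pq: "?p \<in> idxs m n" "?q \<in> idxs m n" "odd_idx ?p \<noteq> odd_idx ?q" using bd by auto
  \<comment> \<open>The removed corner joins two neighbours in the ranking, so its root is simple
    and \<open>odd_reflection\<close> applies.\<close>
  have pos: "shuffle_pos m ?N ?q = Suc (shuffle_pos m ?N ?p)"
    unfolding shuffle_pos_Eps[OF tj(2) bd(1)] shuffle_pos_Del[OF tj(2)] tj(4,6) using bd by simp
  have swap: "(x, y) = (?q, ?p) \<or> (shuffle_pos m ?N x < shuffle_pos m ?N y \<and> (x, y) \<noteq> (?p, ?q))"
    if xy: "x \<in> idxs m n" "y \<in> idxs m n" "shuffle_pos m N x < shuffle_pos m N y" for x y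
  proof (rule idx_cases[OF xy(1)]; rule idx_cases[OF xy(2)])
    fix t1 t2 assume e: "t1 < m" "x = Eps (m - t1)" "t2 < m" "y = Eps (m - t2)"
    then show ?thesis
      using xy(3) shuffle_pos_less_Eps_Eps[OF tj(2), of t1 t2] shuffle_pos_less_Eps_Eps[OF Suc.prems, of t1 t2]
      by simp
  next
    fix j1 j2 assume e: "j1 < n" "x = Del (Suc j1)" "j2 < n" "y = Del (Suc j2)"
    then show ?thesis
      using xy(3) shuffle_pos_less_Del_Del[OF tj(2), of j1 j2] shuffle_pos_less_Del_Del[OF Suc.prems, of j1 j2]
      by simp
  next
    fix t1 j1 assume e: "t1 < m" "x = Eps (m - t1)" "j1 < n" "y = Del (Suc j1)"
    then have "(t1, j1) \<notin> N" using xy(3) shuffle_pos_less_mixed(2)[OF Suc.prems, of t1 j1] by simp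
    moreover from this have "(t1, j1) \<noteq> (t, j)" using tj(1) by auto
    ultimately show ?thesis using e bd shuffle_pos_less_mixed(2)[OF tj(2), of t1 j1] by auto
  next
    fix t1 j1 assume e: "t1 < m" "y = Eps (m - t1)" "j1 < n" "x = Del (Suc j1)"
    then have "(t1, j1) \<in> N" using xy(3) shuffle_pos_less_mixed(1)[OF Suc.prems, of t1 j1] by simp
    then show ?thesis using e bd shuffle_pos_less_mixed(1)[OF tj(2), of t1 j1] by auto
  qed
  have "\<exists>w. hwv (shuffle_pos m N) (if ?\<nu> ?p + ?\<nu> ?q = 0 then ?\<nu> else ?\<nu> - (unit_wt ?p - unit_wt ?q)) w"
    by (rule odd_reflection[OF simple shuffle_pos_inj[OF tj(2)] u pq _ _ swap]) (use pos in auto)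
  then obtain w where w: "hwv (shuffle_pos m N) (if ?\<nu> ?p + ?\<nu> ?q = 0 then ?\<nu> else ?\<nu> - (unit_wt ?p - unit_wt ?q)) w" ..
  have sum: "?\<nu> ?p + ?\<nu> ?q = of_int (run a b t j - run b a j t)"
  proof -
    \<comment> \<open>This cancels the row length \<open>j\<close> and the column length
      \<open>t\<close>, leaving the difference of the two process values.\<close>
    have r: "rho_dist m n ?q = of_nat t - of_nat j - rho_dist m n ?p"
      using bd by (simp add: rho_dist_def of_nat_diff field_simps)
    have p: "?\<nu> ?p = of_int (run a b t j) - of_nat j - rho_dist m n ?p"
      using tj(4) by (simp only: ideal_weight_Eps[OF bd(1)])
    have q: "?\<nu> ?q = - of_int (run b a j t) + of_nat t - rho_dist m n ?q"
      using tj(6) by (simp only: ideal_weight_Del[OF bd(2)])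
    show ?thesis unfolding p q r by simp
  qed
  have zero: "?\<nu> ?p + ?\<nu> ?q = 0 \<longleftrightarrow> hit a b t j" unfolding sum by simp
  show ?case
  proof (intro exI, rule hwv_cong[OF w])
    fix x assume x: "x \<in> idxs m n"
    show "(if ?\<nu> ?p + ?\<nu> ?q = 0 then ?\<nu> else ?\<nu> - (unit_wt ?p - unit_wt ?q)) x = ideal_weight m n a b N x"
    proof (rule idx_cases[OF x])
      fix t' assume t': "t' < m" "x = Eps (m - t')"
      show ?thesis
      proof (cases "t' = t")
        case True
        then show ?thesis unfolding zero using t' tj(3,4) by (simp add: ideal_weight_Eps ideal_weight_Del unit_wt_def)
      next
        case False
        moreover have "m - t' \<noteq> m - t" using False t' bd by simp
        ultimately show ?thesis unfolding zero using t' tj(7) by (simp add: ideal_weight_Eps ideal_weight_Del unit_wt_def)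
      qed
    next
      fix j' assume j': "j' < n" "x = Del (Suc j')"
      show ?thesis
      proof (cases "j' = j")
        case True
        then show ?thesis unfolding zero using j' tj(5,6) by (simp add: ideal_weight_Eps ideal_weight_Del unit_wt_def)
      next
        case False
        then show ?thesis unfolding zero using j' tj(8) by (simp add: ideal_weight_Eps ideal_weight_Del unit_wt_def)
      qed
    qed
  qed
qed

lemma (in gl_module) act_cartan:
  assumes "H \<in> cartan m n"
  shows "act H v = (\<Sum>a\<in>idxs m n. scale (H a a) (E a a v))"
proof -
  have H: "H \<in> gl m n" "\<And>a b. a \<noteq> b \<Longrightarrow> H a b = 0" using assms by (auto simp: cartan_def)
  have "act H v = (\<Sum>a\<in>idxs m n. \<Sum>b\<in>idxs m n. scale (H a b) (E a b v))"
    unfolding act_expand[OF H(1)] by (simp add: sum.cartesian_product)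
  also have "\<dots> = (\<Sum>a\<in>idxs m n. \<Sum>b\<in>idxs m n. if b = a then scale (H a a) (E a a v) else 0)"
    using H(2) by (intro sum.cong) auto
  finally show ?thesis by simp
qed

lemma (in gl_module) has_highest_weight_iff:
  assumes "positive_roots m n \<Sigma> = order_roots m n f"
  shows "has_highest_weight m n scale act \<Sigma> \<nu> \<longleftrightarrow> \<nu> \<in> weights m n \<and> (\<exists>v. hwv f \<nu> v)"
proof -
  have cartan: "(\<forall>H\<in>cartan m n. act H v = scale (wt_eval m n \<nu> H) v) \<longleftrightarrow>
      (\<forall>a\<in>idxs m n. E a a v = scale (\<nu> a) v)" for v
  proof
    assume l: "\<forall>H\<in>cartan m n. act H v = scale (wt_eval m n \<nu> H) v"
    show "\<forall>a\<in>idxs m n. E a a v = scale (\<nu> a) v"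
    proof
      fix a assume a: "a \<in> idxs m n"
      have "mat_unit a a \<in> cartan m n"
        using mat_unit_in_gl[OF a a] by (auto simp: cartan_def mat_unit_def)
      moreover have "wt_eval m n \<nu> (mat_unit a a) = (\<Sum>b\<in>idxs m n. if b = a then \<nu> a else 0)"
        unfolding wt_eval_def by (intro sum.cong) (auto simp: mat_unit_def)
      then have "wt_eval m n \<nu> (mat_unit a a) = \<nu> a" using a by simp
      ultimately show "E a a v = scale (\<nu> a) v" using l by auto
    qed
  next
    assume r: "\<forall>a\<in>idxs m n. E a a v = scale (\<nu> a) v"
    then show "\<forall>H\<in>cartan m n. act H v = scale (wt_eval m n \<nu> H) v"
      by (simp add: act_cartan wt_eval_def scale_sum_left mult.commute)
  qed
  show ?thesis
    unfolding has_highest_weight_def hwv_def cartan assms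
    by (simp add: unit_diff_in_order_roots_iff cong: conj_cong)
qed


section \<open>Longtail and antichains of hits\<close>

definition antichains :: "nat \<Rightarrow> nat \<Rightarrow> (nat \<times> nat) set set" where
  "antichains m n = {T. T \<subseteq> {..<m} \<times> {..<n} \<and>
     (\<forall>(t, j)\<in>T. \<forall>(t', j')\<in>T. t \<le> t' \<longrightarrow> j \<le> j' \<longrightarrow> (t, j) = (t', j'))}"

lemma antichainsI:
  assumes "T \<subseteq> {..<m} \<times> {..<n}"
    and "\<And>t j t' j'. (t, j) \<in> T \<Longrightarrow> (t', j') \<in> T \<Longrightarrow> t \<le> t' \<Longrightarrow> j \<le> j' \<Longrightarrow> (t, j) = (t', j')"
  shows "T \<in> antichains m n"
  unfolding antichains_def using assms by blast

lemma antichainsD: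
  assumes "T \<in> antichains m n"
  shows "T \<subseteq> {..<m} \<times> {..<n}"
    and "(t, j) \<in> T \<Longrightarrow> (t', j') \<in> T \<Longrightarrow> t \<le> t' \<Longrightarrow> j \<le> j' \<Longrightarrow> (t, j) = (t', j')"
  using assms unfolding antichains_def by blast+

section \<open>Right odd roots as cells\<close>

definition odd_root :: "nat \<Rightarrow> nat \<times> nat \<Rightarrow> weight" where
  "odd_root m p = \<epsilon> (m - fst p) - \<delta> (Suc (snd p))"

lemma odd_root_inj: "inj_on (odd_root m) ({..<m} \<times> {..<n})"
  by (rule inj_onI) (auto simp: odd_root_def unit_diff_eq_iff)

lemma right_odd_roots_image: "right_odd_roots m n = odd_root m ` ({..<m} \<times> {..<n})"
proof (intro equalityI subsetI)
  fix \<alpha> assume "\<alpha> \<in> right_odd_roots m n"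
  then obtain i j where "\<alpha> = \<epsilon> i - \<delta> j" "i \<in> {1..m}" "j \<in> {1..n}" unfolding right_odd_roots_def by blast
  then show "\<alpha> \<in> odd_root m ` ({..<m} \<times> {..<n})"
    by (intro image_eqI[of _ _ "(m - i, j - 1)"]) (auto simp: odd_root_def)
next
  fix \<alpha> assume "\<alpha> \<in> odd_root m ` ({..<m} \<times> {..<n})"
  then obtain t j where "t < m" "j < n" "\<alpha> = \<epsilon> (m - t) - \<delta> (Suc j)" by (auto simp: odd_root_def)
  moreover from this have "m - t \<in> {1..m}" "Suc j \<in> {1..n}" by auto
  ultimately show "\<alpha> \<in> right_odd_roots m n" unfolding right_odd_roots_def by blast
qed

lemma right_le_odd_root:
  assumes "p \<in> {..<m} \<times> {..<n}" "q \<in> {..<m} \<times> {..<n}"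
  shows "right_le m n (odd_root m p) (odd_root m q) \<longleftrightarrow> fst p \<le> fst q \<and> snd p \<le> snd q"
proof -
  obtain t j t' j' where e: "p = (t, j)" "q = (t', j')" by (metis surj_pair)
  have b: "t < m" "j < n" "t' < m" "j' < n" using assms e by auto
  show ?thesis
  proof
    assume "right_le m n (odd_root m p) (odd_root m q)"
    then obtain i k l h where r: "odd_root m p = \<epsilon> i - \<delta> k" "odd_root m q = \<epsilon> l - \<delta> h" "i \<ge> l" "k \<le> h"
      unfolding right_le_def by blast
    then have "m - t = i" "Suc j = k" "m - t' = l" "Suc j' = h"
      using unit_diff_eq_iff[of "Eps (m - t)" "Del (Suc j)"] unit_diff_eq_iff[of "Eps (m - t')" "Del (Suc j')"]
      by (auto simp: odd_root_def e)
    then show "fst p \<le> fst q \<and> snd p \<le> snd q" using r(3,4) b e by auto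
  next
    assume "fst p \<le> fst q \<and> snd p \<le> snd q"
    then show "right_le m n (odd_root m p) (odd_root m q)"
      unfolding right_le_def odd_root_def using b e
      by (intro bexI[of _ "m - t"] bexI[of _ "Suc j"] bexI[of _ "m - t'"] bexI[of _ "Suc j'"]) auto
  qed
qed

lemma incomparable_iff:
  assumes "T \<subseteq> {..<m} \<times> {..<n}"
  shows "incomparable m n (odd_root m ` T) \<longleftrightarrow> T \<in> antichains m n"
proof -
  have inj: "inj_on (odd_root m) T" using odd_root_inj assms by (rule inj_on_subset)
  have sub: "odd_root m ` T \<subseteq> right_odd_roots m n" unfolding right_odd_roots_image using assms by blast
  have "incomparable m n (odd_root m ` T) \<longleftrightarrow> (\<forall>p\<in>T. \<forall>q\<in>T. p \<noteq> q \<longrightarrow>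
      \<not> (fst p \<le> fst q \<and> snd p \<le> snd q) \<and> \<not> (fst q \<le> fst p \<and> snd q \<le> snd p))"
  proof -
    have "right_le m n (odd_root m p) (odd_root m q) \<longleftrightarrow> fst p \<le> fst q \<and> snd p \<le> snd q" if "p \<in> T" "q \<in> T" for p q
      using right_le_odd_root that assms by blast
    then show ?thesis
      unfolding incomparable_def ball_simps(9) using sub inj_on_eq_iff[OF inj] by (simp cong: ball_cong)
  qed
  also have "\<dots> \<longleftrightarrow> T \<in> antichains m n"
  proof
    assume l: "\<forall>p\<in>T. \<forall>q\<in>T. p \<noteq> q \<longrightarrow>
      \<not> (fst p \<le> fst q \<and> snd p \<le> snd q) \<and> \<not> (fst q \<le> fst p \<and> snd q \<le> snd p)"
    show "T \<in> antichains m n"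
    proof (rule antichainsI[OF assms])
      fix t j t' j' assume "(t, j) \<in> T" "(t', j') \<in> T" "t \<le> t'" "j \<le> j'"
      then show "(t, j) = (t', j')" using l[rule_format, of "(t, j)" "(t', j')"] by auto
    qed
  next
    assume T: "T \<in> antichains m n"
    have "p = q" if "p \<in> T" "q \<in> T" "fst p \<le> fst q \<and> snd p \<le> snd q" for p q
      using antichainsD(2)[OF T, of "fst p" "snd p" "fst q" "snd q"] that by simp
    then show "\<forall>p\<in>T. \<forall>q\<in>T. p \<noteq> q \<longrightarrow>
      \<not> (fst p \<le> fst q \<and> snd p \<le> snd q) \<and> \<not> (fst q \<le> fst p \<and> snd q \<le> snd p)" by blast
  qed
  finally show ?thesis .
qed

lemma finite_antichain_cards: "finite {card T | T. T \<in> antichains m n \<and> P T}"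
proof -
  have "{card T | T. T \<in> antichains m n \<and> P T} \<subseteq> card ` Pow ({..<m} \<times> {..<n})"
    unfolding antichains_def by auto
  then show ?thesis by (rule finite_subset) simp
qed

lemma card_odd_root_image: "T \<subseteq> {..<m} \<times> {..<n} \<Longrightarrow> card (odd_root m ` T) = card T"
  by (rule card_image) (rule inj_on_subset[OF odd_root_inj])

lemma change_tracking_iff_hit:
  assumes "strict_mono_on {..<m} (mirrored_eps m x)" "strict_mono_on {..<n} (neg_del x)" "t < m" "j < n"
  shows "change_tracking m n x (odd_root m (t, j)) = 1 \<longleftrightarrow> hit (mirrored_eps m x) (neg_del x) t j"
proof -
  have "{j \<in> {1..n}. - x (Del j) < c} = Suc ` {j. j < n \<and> neg_del x j < c}" for c
  proof (intro equalityI subsetI)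
    fix j assume "j \<in> {j \<in> {1..n}. - x (Del j) < c}"
    then show "j \<in> Suc ` {j. j < n \<and> neg_del x j < c}"
      by (intro image_eqI[of _ _ "j - 1"]) (auto simp: neg_del_def)
  qed (auto simp: neg_del_def)
  then have row: "change_row m n x i = int (card {j. j < n \<and> neg_del x j < arrow_end m n x i})" for i
    by (simp add: change_row_def card_image)
  let ?P = "\<lambda>i j. change_row m n x i - (arrow_end m n x i - x (Eps i) - 1) \<le> int j \<and> int j \<le> change_row m n x i"
  have "change_tracking m n x (odd_root m (t, j)) = 1 \<longleftrightarrow> ?P (m - t) (Suc j)"
  proof -
    have "(\<exists>i\<in>{1..m}. \<exists>j'\<in>{1..n}. odd_root m (t, j) = \<epsilon> i - \<delta> j' \<and> ?P i j') \<longleftrightarrow> ?P (m - t) (Suc j)"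
    proof
      assume "\<exists>i\<in>{1..m}. \<exists>j'\<in>{1..n}. odd_root m (t, j) = \<epsilon> i - \<delta> j' \<and> ?P i j'"
      then obtain i j' where "odd_root m (t, j) = \<epsilon> i - \<delta> j'" "?P i j'" by blast
      moreover from this have "i = m - t" "j' = Suc j"
        using unit_diff_eq_iff[of "Eps (m - t)" "Del (Suc j)" "Eps i" "Del j'"] by (auto simp: odd_root_def)
      ultimately show "?P (m - t) (Suc j)" by simp
    next
      assume "?P (m - t) (Suc j)"
      moreover have "m - t \<in> {1..m}" "Suc j \<in> {1..n}" "odd_root m (t, j) = \<epsilon> (m - t) - \<delta> (Suc j)"
        using assms(3,4) by (auto simp: odd_root_def)
      ultimately show "\<exists>i\<in>{1..m}. \<exists>j'\<in>{1..n}. odd_root m (t, j) = \<epsilon> i - \<delta> j' \<and> ?P i j'" by blast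
    qed
    then show ?thesis unfolding change_tracking_def by simp
  qed
  also have "\<dots> \<longleftrightarrow> hit (mirrored_eps m x) (neg_del x) t j"
    unfolding row arrow_end_eq_run[OF assms(1-3)] hit_iff_change[OF assms] by (simp add: mirrored_eps_def)
  finally show ?thesis .
qed

lemma max_incomparable_eq:
  assumes "strict_mono_on {..<m} (mirrored_eps m x)" "strict_mono_on {..<n} (neg_del x)"
  shows "max_incomparable m n x =
    Max {card T | T. T \<in> antichains m n \<and> (\<forall>(t, j)\<in>T. hit (mirrored_eps m x) (neg_del x) t j)}"
proof -
  have "{card S | S. incomparable m n S \<and> (\<forall>\<alpha>\<in>S. change_tracking m n x \<alpha> = 1)}
    = {card T | T. T \<in> antichains m n \<and> (\<forall>(t, j)\<in>T. hit (mirrored_eps m x) (neg_del x) t j)}" (is "?L = ?R")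
  proof (intro equalityI subsetI)
    fix k assume "k \<in> ?L"
    then obtain S where S: "k = card S" "incomparable m n S" "\<forall>\<alpha>\<in>S. change_tracking m n x \<alpha> = 1" by blast
    then have "S \<subseteq> odd_root m ` ({..<m} \<times> {..<n})" unfolding incomparable_def right_odd_roots_image by blast
    then obtain T where T: "T \<subseteq> {..<m} \<times> {..<n}" "S = odd_root m ` T" by (auto simp: subset_image_iff)
    have "T \<in> antichains m n" using S(2) incomparable_iff[OF T(1)] T(2) by simp
    moreover have "\<forall>(t, j)\<in>T. hit (mirrored_eps m x) (neg_del x) t j"
    proof clarify
      fix t j assume tj: "(t, j) \<in> T"
      then have "t < m" "j < n" "change_tracking m n x (odd_root m (t, j)) = 1" using S(3) T by auto
      then show "hit (mirrored_eps m x) (neg_del x) t j" using change_tracking_iff_hit[OF assms] by blast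
    qed
    ultimately show "k \<in> ?R" using S(1) T card_odd_root_image[OF T(1)] by blast
  next
    fix k assume "k \<in> ?R"
    then obtain T where T: "k = card T" "T \<in> antichains m n"
      "\<forall>(t, j)\<in>T. hit (mirrored_eps m x) (neg_del x) t j" by blast
    then have sub: "T \<subseteq> {..<m} \<times> {..<n}" unfolding antichains_def by blast
    have "\<forall>\<alpha>\<in>odd_root m ` T. change_tracking m n x \<alpha> = 1"
    proof clarify
      fix t j assume tj: "(t, j) \<in> T"
      then have "t < m" "j < n" "hit (mirrored_eps m x) (neg_del x) t j" using T(3) sub by auto
      then show "change_tracking m n x (odd_root m (t, j)) = 1" using change_tracking_iff_hit[OF assms] by blast
    qed
    then show "k \<in> ?L" using T(1,2) incomparable_iff[OF sub] card_odd_root_image[OF sub] by force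
  qed
  then show ?thesis unfolding max_incomparable_def by simp
qed

section \<open>Orthogonal sets of simple odd roots\<close>

lemma bil_uminus: "bil m n (- \<mu>) \<nu> = - bil m n \<mu> \<nu>" "bil m n \<mu> (- \<nu>) = - bil m n \<mu> \<nu>"
  by (simp_all add: bil_def sum_negf)

lemma bil_odd_root:
  assumes "t < m" "j < n"
  shows "bil m n (odd_root m (t, j)) \<nu> = \<nu> (Eps (m - t)) + \<nu> (Del (Suc j))"
proof -
  have "(\<Sum>i=1..m. odd_root m (t, j) (Eps i) * \<nu> (Eps i)) = (\<Sum>i=1..m. if i = m - t then \<nu> (Eps i) else 0)"
    by (rule sum.cong) (auto simp: odd_root_def unit_wt_def)
  also have "\<dots> = \<nu> (Eps (m - t))" using assms by (simp add: Suc_le_eq)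
  moreover have "(\<Sum>k=1..n. odd_root m (t, j) (Del k) * \<nu> (Del k)) = (\<Sum>k=1..n. if k = Suc j then - \<nu> (Del k) else 0)"
    by (rule sum.cong) (auto simp: odd_root_def unit_wt_def)
  moreover have "\<dots> = - \<nu> (Del (Suc j))" using assms by simp
  ultimately show ?thesis by (simp add: bil_def)
qed

text \<open>If the cells were comparable and distinct, \<open>?e'\<close> would precede
  \<open>?e\<close> and \<open>?d\<close> would precede \<open>?d'\<close>. For each choice of
  signs, either these relations close a cycle or one of the two simple roots is a sum of positive
  roots.\<close>

lemma orthogonal_simple_odd_roots:
  assumes bs: "\<Sigma> \<in> bases m n" and b: "t < m" "j < n" "t' < m" "j' < n"
    and mem: "odd_root m (t, j) \<in> \<Sigma> \<or> - odd_root m (t, j) \<in> \<Sigma>"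
      "odd_root m (t', j') \<in> \<Sigma> \<or> - odd_root m (t', j') \<in> \<Sigma>"
    and orth: "bil m n (odd_root m (t, j)) (odd_root m (t', j')) = 0"
    and le: "t \<le> t'" "j \<le> j'"
  shows "(t, j) = (t', j')"
proof (rule ccontr)
  assume ne: "(t, j) \<noteq> (t', j')"
  let ?e = "Eps (m - t)" and ?d = "Del (Suc j)" and ?e' = "Eps (m - t')" and ?d' = "Del (Suc j')"
  note base = bases_is_base[OF bs]
  \<comment> \<open>The form takes the value \<open>[t = t'] - [j = j']\<close>, so orthogonal
    distinct cells share neither row nor column.\<close>
  have "t \<noteq> t' \<and> j \<noteq> j'"
    using orth ne b unfolding bil_odd_root[OF b(1,2)]
    by (auto simp: odd_root_def unit_wt_def split: if_splits)
  then have lt: "t < t'" "j < j'" using le by auto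
  let ?P = "positive_roots m n \<Sigma>"
  have idx: "?e \<in> idxs m n" "?d \<in> idxs m n" "?e' \<in> idxs m n" "?d' \<in> idxs m n" using b by auto
  have ee: "unit_wt ?e' - unit_wt ?e \<in> ?P" using positive_even_Eps[OF bs, of "m - t'" "m - t"] lt b by auto
  have dd: "unit_wt ?d - unit_wt ?d' \<in> ?P" using positive_even_Del[OF bs, of "Suc j" "Suc j'"] lt b by auto
  note trans = positive_roots_trans[OF bs]
  have split: False if "unit_wt a - unit_wt c \<in> \<Sigma>" "unit_wt a - unit_wt b \<in> ?P" "unit_wt b - unit_wt c \<in> ?P" for a b c
    using base_indecomposable[OF base that(2,3)] that(1) by simp
  have pos: "odd_root m (t, j) = unit_wt ?e - unit_wt ?d" "odd_root m (t', j') = unit_wt ?e' - unit_wt ?d'"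
    by (simp_all add: odd_root_def)
  consider "unit_wt ?e - unit_wt ?d \<in> \<Sigma>" "unit_wt ?e' - unit_wt ?d' \<in> \<Sigma>"
    | "unit_wt ?d - unit_wt ?e \<in> \<Sigma>" "unit_wt ?d' - unit_wt ?e' \<in> \<Sigma>"
    | "unit_wt ?e - unit_wt ?d \<in> \<Sigma>" "unit_wt ?d' - unit_wt ?e' \<in> \<Sigma>"
    | "unit_wt ?d - unit_wt ?e \<in> \<Sigma>" "unit_wt ?e' - unit_wt ?d' \<in> \<Sigma>"
    using mem unfolding pos minus_diff_eq by blast
  then show False
  proof cases
    case 1
    have "unit_wt ?e - unit_wt ?d' \<in> ?P"
      using trans[OF base_positive[OF base 1(1)] dd] idx by simp
    then show False using split[OF 1(2) ee] by blast
  next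
    case 2
    have "unit_wt ?d' - unit_wt ?e \<in> ?P"
      using trans[OF base_positive[OF base 2(2)] ee] idx by simp
    then show False using split[OF 2(1) dd] by blast
  next
    case 3
    have "unit_wt ?d' - unit_wt ?e \<in> ?P"
      using trans[OF base_positive[OF base 3(2)] ee] idx by simp
    then have "unit_wt ?d - unit_wt ?e \<in> ?P" using trans[OF dd] idx by simp
    then show False using positive_roots_sum_nonzero[OF base base_positive[OF base 3(1)], of "unit_wt ?d - unit_wt ?e"] by simp
  next
    case 4
    have "unit_wt ?e' - unit_wt ?d \<in> roots m n" using idx unfolding roots_eq by blast
    then consider "unit_wt ?e' - unit_wt ?d \<in> ?P" | "unit_wt ?d - unit_wt ?e' \<in> ?P"
      using positive_root_or[OF base] by fastforce
    then show False
    proof cases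
      case 1
      then show False using split[OF 4(2) _ dd] by blast
    next
      case 2
      then show False using split[OF 4(1) _ ee] by blast
    qed
  qed
qed

text \<open>\<open>T\<close> consists of the minimal cells outside \<open>N\<close>. Row and column
  of \<open>N\<close> end right before such a cell, so its \<open>\<epsilon>\<close> and
  \<open>\<delta>\<close> are adjacent in the shuffle; one base thus makes all of \<open>T\<close>
  simple.\<close>

lemma antichain_simple:
  assumes "T \<in> antichains m n"
  defines "N \<equiv> {p \<in> {..<m} \<times> {..<n}. \<not> (\<exists>q\<in>T. fst q \<le> fst p \<and> snd q \<le> snd p)}"
  shows "order_ideal m n N"
    and "(t, j) \<in> T \<Longrightarrow> row_len N t = j" "(t, j) \<in> T \<Longrightarrow> col_len N j = t"
    and "odd_root m ` T \<subseteq> covering_roots m n (shuffle_pos m N)"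
proof -
  have sub: "T \<subseteq> {..<m} \<times> {..<n}" using assms(1) unfolding antichains_def by blast
  have anti: "(t, j) = (t', j')" if "(t, j) \<in> T" "(t', j') \<in> T" "t \<le> t'" "j \<le> j'" for t j t' j'
    using assms(1) that unfolding antichains_def by blast
  show ideal: "order_ideal m n N"
    unfolding order_ideal_def N_def by (auto intro: order.trans)
  have lens: "row_len N t = j \<and> col_len N j = t" if tj: "(t, j) \<in> T" for t j
  proof -
    have b: "t < m" "j < n" using sub tj by auto
    have notin: "(t, j) \<notin> N" unfolding N_def using tj by force
    have below: "(t', j') \<in> N" if "t' \<le> t" "j' \<le> j" "(t', j') \<noteq> (t, j)" for t' j'
    proof -
      have "False" if q: "(tq, jq) \<in> T" "tq \<le> t'" "jq \<le> j'" for tq jq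
      proof -
        have "(tq, jq) = (t, j)" using anti[OF q(1) tj] q \<open>t' \<le> t\<close> \<open>j' \<le> j\<close> by simp
        then show False using q \<open>t' \<le> t\<close> \<open>j' \<le> j\<close> \<open>(t', j') \<noteq> (t, j)\<close> by auto
      qed
      then show ?thesis unfolding N_def using b that by force
    qed
    have "row_len N t \<le> j" using notin row_len_iff[OF ideal, of t j] by simp
    moreover have "j \<le> row_len N t"
    proof (cases j)
      case (Suc i)
      then have "(t, i) \<in> N" by (intro below) auto
      then show ?thesis using row_len_iff[OF ideal, of t i] Suc by simp
    qed simp
    moreover have "col_len N j \<le> t" using notin col_len_iff[OF ideal, of t j] by simp
    moreover have "t \<le> col_len N j"
    proof (cases t)
      case (Suc i)
      then have "(i, j) \<in> N" by (intro below) auto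
      then show ?thesis using col_len_iff[OF ideal, of i j] Suc by simp
    qed simp
    ultimately show ?thesis by simp
  qed
  then show "(t, j) \<in> T \<Longrightarrow> row_len N t = j" "(t, j) \<in> T \<Longrightarrow> col_len N j = t" by blast+
  show "odd_root m ` T \<subseteq> covering_roots m n (shuffle_pos m N)"
  proof (rule image_subsetI)
    fix p assume p: "p \<in> T"
    obtain t j where e: "p = (t, j)" by force
    have b: "t < m" "j < n" using sub p e by auto
    have "shuffle_pos m N (Del (Suc j)) = Suc (shuffle_pos m N (Eps (m - t)))"
      unfolding shuffle_pos_Eps[OF ideal b(1)] shuffle_pos_Del[OF ideal] using lens p e b by auto
    then have "shuffle_pos m N (Eps (m - t)) < shuffle_pos m N (Del (Suc j))"
      "\<not> (shuffle_pos m N (Eps (m - t)) < shuffle_pos m N c \<and> shuffle_pos m N c < shuffle_pos m N (Del (Suc j)))" for c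
      by linarith+
    moreover have "Eps (m - t) \<in> idxs m n" "Del (Suc j) \<in> idxs m n" using b by auto
    ultimately show "odd_root m p \<in> covering_roots m n (shuffle_pos m N)"
      unfolding covering_roots_def odd_root_def e fst_conv snd_conv by blast
  qed
qed

text \<open>A base never contains a root together with its negative, so forgetting signs is
  injective on \<open>S\<close> and yields an antichain. Conversely, \<open>antichain_simple\<close>
  provides a base for any antichain.\<close>

lemma s_value_eq:
  "s_value m n \<nu> = Max {card T | T. T \<in> antichains m n \<and>
     (\<forall>(t, j)\<in>T. \<nu> (Eps (m - t)) + \<nu> (Del (Suc j)) = 0)}"
proof -
  let ?I = "{..<m} \<times> {..<n}"
  have "{card S | S. S \<subseteq> odd_roots m n \<and> wt.independent S \<and>
     (\<forall>\<alpha>\<in>S. \<forall>\<beta>\<in>S. bil m n \<alpha> \<beta> = 0) \<and> (\<forall>\<alpha>\<in>S. bil m n \<alpha> \<nu> = 0) \<and>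
     (\<exists>\<Sigma>'\<in>bases m n. S \<subseteq> \<Sigma>')} =
    {card T | T. T \<in> antichains m n \<and> (\<forall>(t, j)\<in>T. \<nu> (Eps (m - t)) + \<nu> (Del (Suc j)) = 0)}" (is "?L = ?R")
  proof (intro equalityI subsetI)
    fix k assume "k \<in> ?L"
    then obtain S \<Sigma> where S: "k = card S" "S \<subseteq> odd_roots m n" "\<forall>\<alpha>\<in>S. \<forall>\<beta>\<in>S. bil m n \<alpha> \<beta> = 0"
      "\<forall>\<alpha>\<in>S. bil m n \<alpha> \<nu> = 0" "\<Sigma> \<in> bases m n" "S \<subseteq> \<Sigma>" by blast
    note base = bases_is_base[OF S(5)]
    let ?T = "{p \<in> ?I. odd_root m p \<in> S \<or> - odd_root m p \<in> S}"
    let ?g = "\<lambda>p. if odd_root m p \<in> S then odd_root m p else - odd_root m p"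
    have excl: "- \<alpha> \<notin> S" if "\<alpha> \<in> S" for \<alpha>
      using that S(6) base_positive[OF base] uminus_positive_root[OF base] by blast
    have img: "?g ` ?T = S"
    proof (intro equalityI subsetI)
      fix \<alpha> assume a: "\<alpha> \<in> S"
      then consider p where "p \<in> ?I" "\<alpha> = odd_root m p" | p where "p \<in> ?I" "\<alpha> = - odd_root m p"
        using S(2) unfolding odd_roots_def right_odd_roots_image by blast
      then show "\<alpha> \<in> ?g ` ?T"
      proof cases
        case (1 p)
        then show ?thesis using a by (intro image_eqI[of _ _ p]) auto
      next
        case (2 p)
        then have "odd_root m p \<notin> S" using excl[OF a] by simp
        then show ?thesis using 2 a by (intro image_eqI[of _ _ p]) auto
      qed
    qed auto
    have inj: "inj_on ?g ?T"
    proof (rule inj_onI)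
      fix p q assume pq: "p \<in> ?T" "q \<in> ?T" "?g p = ?g q"
      obtain t j t' j' where e: "p = (t, j)" "q = (t', j')" by (metis surj_pair)
      have "odd_root m p = odd_root m q \<or> odd_root m p = - odd_root m q"
        using pq(3) by (auto split: if_splits simp: minus_equation_iff[of "odd_root m p"])
      moreover have "odd_root m p \<noteq> - odd_root m q"
        unfolding odd_root_def e by (auto simp: unit_diff_eq_iff)
      ultimately have "odd_root m p = odd_root m q" by blast
      then show "p = q" using pq(1,2) inj_onD[OF odd_root_inj[of m n]] by blast
    qed
    have bil0: "bil m n (odd_root m p) (odd_root m q) = 0" if "p \<in> ?T" "q \<in> ?T" for p q
      using that S(3) bil_uminus by (metis (no_types, lifting) mem_Collect_eq neg_equal_0_iff_equal)
    have "?T \<in> antichains m n"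
    proof (rule antichainsI)
      fix t j t' j' assume *: "(t, j) \<in> ?T" "(t', j') \<in> ?T" "t \<le> t'" "j \<le> j'"
      have "bil m n (odd_root m (t, j)) (odd_root m (t', j')) = 0" by (rule bil0[OF *(1,2)])
      then show "(t, j) = (t', j')"
        using orthogonal_simple_odd_roots[OF S(5), of t j t' j'] * S(6) by blast
    qed blast
    moreover have "\<forall>(t, j)\<in>?T. \<nu> (Eps (m - t)) + \<nu> (Del (Suc j)) = 0"
    proof -
      have "\<nu> (Eps (m - t)) + \<nu> (Del (Suc j)) = 0" if tj: "(t, j) \<in> ?T" for t j
      proof -
        have "bil m n (odd_root m (t, j)) \<nu> = 0"
          using tj S(4) bil_uminus(1)[of m n "odd_root m (t, j)" \<nu>] by force
        then show ?thesis using bil_odd_root[of t m j n \<nu>] tj by simp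
      qed
      then show ?thesis by blast
    qed
    moreover have "k = card ?T" using S(1) img card_image[OF inj] by simp
    ultimately show "k \<in> ?R" by blast
  next
    fix k assume "k \<in> ?R"
    then obtain T where T: "k = card T" "T \<in> antichains m n"
      "\<forall>(t, j)\<in>T. \<nu> (Eps (m - t)) + \<nu> (Del (Suc j)) = 0" by blast
    have sub: "T \<subseteq> ?I" using T(2) unfolding antichains_def by blast
    have anti: "(t, j) = (t', j')" if "(t, j) \<in> T" "(t', j') \<in> T" "t \<le> t'" "j \<le> j'" for t j t' j'
      using T(2) that unfolding antichains_def by blast
    define N where "N = {p \<in> ?I. \<not> (\<exists>q\<in>T. fst q \<le> fst p \<and> snd q \<le> snd p)}"
    note N = antichain_simple[OF T(2), folded N_def]
    have C: "covering_roots m n (shuffle_pos m N) \<in> bases m n" by (rule covering_roots_in_bases[OF N(1)])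
    let ?S = "odd_root m ` T"
    have "?S \<subseteq> odd_roots m n" unfolding odd_roots_def right_odd_roots_image using sub by blast
    moreover have "wt.independent ?S"
      using wt.independent_mono[OF base_indep[OF bases_is_base[OF C]] N(4)] .
    moreover have "\<forall>\<alpha>\<in>?S. \<forall>\<beta>\<in>?S. bil m n \<alpha> \<beta> = 0"
    proof clarify
      fix t j t' j' assume *: "(t, j) \<in> T" "(t', j') \<in> T"
      then have b: "t < m" "j < n" "t' < m" "j' < n" using sub by auto
      have "t = t' \<longleftrightarrow> j = j'" using anti[OF *] anti[OF *(2,1)] by (metis nat_le_linear order_refl prod.inject)
      then show "bil m n (odd_root m (t, j)) (odd_root m (t', j')) = 0"
        unfolding bil_odd_root[OF b(1,2)] using b by (auto simp: odd_root_def unit_wt_def)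
    qed
    moreover have "\<forall>\<alpha>\<in>?S. bil m n \<alpha> \<nu> = 0"
    proof clarify
      fix t j assume tj: "(t, j) \<in> T"
      then have "t < m" "j < n" "\<nu> (Eps (m - t)) + \<nu> (Del (Suc j)) = 0" using T(3) sub by auto
      then show "bil m n (odd_root m (t, j)) \<nu> = 0" by (simp only: bil_odd_root)
    qed
    ultimately have "card ?S \<in> ?L" using C N(4) by blast
    then show "k \<in> ?L" using T(1) card_odd_root_image[OF sub] by simp
  qed
  then show ?thesis unfolding s_value_def by simp
qed

section \<open>Integrality and monotonicity of the shifted weight\<close>

lemma rho_dist_integral: "\<exists>z. rho_dist m n c = of_int z"
proof (cases "odd (m + n)")
  case True
  then have "odd (int m + int n)" by simp
  then obtain k where k: "int m + int n = 2 * k + 1" by (rule oddE)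
  show ?thesis
  proof (cases c)
    case (Eps i)
    have "(of_nat m :: complex) = of_int (2 * k + 1 - int n)" unfolding k[symmetric] by simp
    then have "rho_dist m n c = of_int (k + 1 - int n - int i)"
      using True Eps by (simp add: rho_dist_def field_simps)
    then show ?thesis ..
  next
    case (Del j)
    have "(of_nat m :: complex) = of_int (2 * k + 1 - int n)" unfolding k[symmetric] by simp
    then have "rho_dist m n c = of_int (k + 1 - int j)"
      using True Del by (simp add: rho_dist_def field_simps)
    then show ?thesis ..
  qed
next
  case False
  then have "even (int m + int n)" by simp
  then obtain k where k: "int m + int n = 2 * k" by (rule evenE)
  show ?thesis
  proof (cases c)
    case (Eps i)
    have "(of_nat m :: complex) = of_int (2 * k - int n)" unfolding k[symmetric] by simp
    then have "rho_dist m n c = of_int (k + 1 - int n - int i)"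
      using False Eps by (simp add: rho_dist_def field_simps)
    then show ?thesis ..
  next
    case (Del j)
    have "(of_nat m :: complex) = of_int (2 * k - int n)" unfolding k[symmetric] by simp
    then have "rho_dist m n c = of_int (k - int j)"
      using False Del by (simp add: rho_dist_def field_simps)
    then show ?thesis ..
  qed
qed

lemma lam_bar_coords:
  assumes "c \<in> idxs m n"
  shows "of_int (lam_bar m n lam c) = (of_int (lam c) + rho_dist m n c :: complex)"
proof -
  have bs: "dist_base m n \<in> bases m n"
    unfolding dist_base_eq by (rule covering_roots_in_bases[OF order_ideal_empty])
  have N: "base_ideal m n (dist_base m n) = {}"
    unfolding dist_base_eq by (rule base_ideal_covering[OF order_ideal_empty])
  have "rho m n (dist_base m n) c = rho_dist m n c"
    using rho_coords[OF bs] unfolding N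
    by (rule_tac idx_cases[OF assms]) (auto simp: row_len_def col_len_def)
  moreover obtain z where "rho_dist m n c = of_int z" using rho_dist_integral by blast
  ultimately show ?thesis by (simp add: lam_bar_def weight_of_def flip: of_int_add)
qed

lemma rho_dist_diff:
  "rho_dist m n (Eps i) - rho_dist m n (Eps k) = of_nat k - of_nat i"
  "rho_dist m n (Del i) - rho_dist m n (Del k) = of_nat k - of_nat i"
  by (simp_all add: rho_dist_def diff_divide_distrib add_divide_distrib)

text \<open>Dominance gives weak monotonicity, and rho changes by one between neighbouring
  coordinates, which makes it strict.\<close>

lemma lam_bar_strict_mono:
  assumes "lam \<in> dominant m n"
  shows "strict_mono_on {..<m} (mirrored_eps m (lam_bar m n lam))"
    and "strict_mono_on {..<n} (neg_del (lam_bar m n lam))"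
proof -
  let ?x = "lam_bar m n lam"
  show "strict_mono_on {..<m} (mirrored_eps m ?x)"
  proof (rule strict_mono_onI)
    fix t u assume tu: "t \<in> {..<m}" "u \<in> {..<m}" "t < u"
    have "of_int (?x (Eps (m - u)) - ?x (Eps (m - t)))
        = (of_int (lam (Eps (m - u)) - lam (Eps (m - t)) + (int u - int t)) :: complex)"
      using tu lam_bar_coords[of "Eps (m - u)" m n lam] lam_bar_coords[of "Eps (m - t)" m n lam]
        rho_dist_diff(1)[of m n "m - u" "m - t"]
      by (simp add: of_nat_diff algebra_simps)
    then have "?x (Eps (m - u)) - ?x (Eps (m - t)) = lam (Eps (m - u)) - lam (Eps (m - t)) + (int u - int t)"
      by (simp only: of_int_eq_iff)
    moreover have "1 \<le> m - u \<and> m - u \<le> m - t \<and> m - t \<le> m" using tu by auto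
    then have "lam (Eps (m - u)) \<ge> lam (Eps (m - t))" using assms unfolding dominant_def by blast
    ultimately show "mirrored_eps m ?x t < mirrored_eps m ?x u" using tu by (simp add: mirrored_eps_def)
  qed
  show "strict_mono_on {..<n} (neg_del ?x)"
  proof (rule strict_mono_onI)
    fix j k assume jk: "j \<in> {..<n}" "k \<in> {..<n}" "j < k"
    have "of_int (?x (Del (Suc j)) - ?x (Del (Suc k)))
        = (of_int (lam (Del (Suc j)) - lam (Del (Suc k)) + (int k - int j)) :: complex)"
      using jk lam_bar_coords[of "Del (Suc j)" m n lam] lam_bar_coords[of "Del (Suc k)" m n lam]
        rho_dist_diff(2)[of m n "Suc j" "Suc k"]
      by (simp add: algebra_simps)
    then have "?x (Del (Suc j)) - ?x (Del (Suc k)) = lam (Del (Suc j)) - lam (Del (Suc k)) + (int k - int j)"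
      by (simp only: of_int_eq_iff)
    moreover have "lam (Del (Suc j)) \<ge> lam (Del (Suc k))" using assms jk unfolding dominant_def by auto
    ultimately show "neg_del ?x j < neg_del ?x k" using jk by (simp add: neg_del_def)
  qed
qed

text \<open>The description by \<open>THE\<close> is settled by \<open>hwv_weight_unique\<close> on
  \<open>idxs m n\<close> and by membership in \<open>weights m n\<close> elsewhere.\<close>

lemma highest_weight_ideal:
  assumes "is_L m n lam scale V act" "\<Sigma> \<in> bases m n"
  defines "x \<equiv> lam_bar m n lam"
  shows "highest_weight m n scale act \<Sigma> =
    ideal_weight m n (mirrored_eps m x) (neg_del x) (base_ideal m n \<Sigma>)"
proof -
  interpret gl_module scale m n V act using assms(1) unfolding is_L_def by blast
  have simple: "simple_module" using assms(1) unfolding is_L_def by blast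
  let ?a = "mirrored_eps m x" and ?b = "neg_del x"
  let ?w = "ideal_weight m n ?a ?b"
  let ?N = "base_ideal m n \<Sigma>"
  note ideal = base_ideal_ideal[OF assms(2)]
  have "positive_roots m n (dist_base m n) = order_roots m n (shuffle_pos m {})"
    unfolding dist_base_eq by (rule positive_covering_roots[OF shuffle_pos_inj[OF order_ideal_empty]])
  then obtain v where v: "hwv (shuffle_pos m {}) (weight_of lam) v"
    using assms(1) has_highest_weight_iff unfolding is_L_def by blast
  have "hwv (shuffle_pos m {}) (?w {}) v"
  proof (rule hwv_cong[OF v])
    fix c assume c: "c \<in> idxs m n"
    have "of_int (x c) = (of_int (lam c) + rho_dist m n c :: complex)"
      unfolding x_def by (rule lam_bar_coords[OF c])
    then show "weight_of lam c = ?w {} c"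
      by (rule_tac idx_cases[OF c])
        (auto simp: ideal_weight_Eps ideal_weight_Del weight_of_def row_len_def col_len_def mirrored_eps_def neg_del_def)
  qed
  then obtain w where w: "hwv (shuffle_pos m ?N) (?w ?N) w" using hwv_ideal[OF simple _ ideal] by blast
  have wts: "?w ?N \<in> weights m n"
    unfolding weights_def ideal_weight_def by (auto split: idx.split)
  show ?thesis
    unfolding highest_weight_def
  proof (rule the_equality)
    show "has_highest_weight m n scale act \<Sigma> (?w ?N)"
      unfolding has_highest_weight_iff[OF positive_roots_eq[OF assms(2)]] using w wts by blast
    fix \<nu> assume "has_highest_weight m n scale act \<Sigma> \<nu>"
    then obtain u where u: "\<nu> \<in> weights m n" "hwv (shuffle_pos m ?N) \<nu> u"
      unfolding has_highest_weight_iff[OF positive_roots_eq[OF assms(2)]] by blast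
    show "\<nu> = ?w ?N"
    proof
      fix c show "\<nu> c = ?w ?N c"
      proof (cases "c \<in> idxs m n")
        case True
        then show ?thesis using hwv_weight_unique[OF simple shuffle_pos_inj[OF ideal] u(2) w] by blast
      next
        case False
        then show ?thesis using u(1) wts unfolding weights_def by simp
      qed
    qed
  qed
qed

lemma longtail_eq:
  assumes "lam \<in> dominant m n" "is_L m n lam scale V act"
  defines "x \<equiv> lam_bar m n lam"
  shows "longtail m n scale act =
    Max {card T | T. T \<in> antichains m n \<and> (\<forall>(t, j)\<in>T. hit (mirrored_eps m x) (neg_del x) t j)}"
proof -
  let ?a = "mirrored_eps m x" and ?b = "neg_del x"
  let ?H = "{card T | T. T \<in> antichains m n \<and> (\<forall>(t, j)\<in>T. hit ?a ?b t j)}"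
  note mono = lam_bar_strict_mono[OF assms(1), folded x_def]
  let ?nu = "\<lambda>\<Sigma>. highest_weight m n scale act \<Sigma> + rho m n \<Sigma>"
  let ?R = "\<lambda>\<Sigma>. {card T | T. T \<in> antichains m n \<and> (\<forall>(t, j)\<in>T. ?nu \<Sigma> (Eps (m - t)) + ?nu \<Sigma> (Del (Suc j)) = 0)}"
  have nu: "?nu \<Sigma> (Eps (m - t)) + ?nu \<Sigma> (Del (Suc j)) = 0 \<longleftrightarrow>
      run ?a ?b t (row_len (base_ideal m n \<Sigma>) t) = run ?b ?a j (col_len (base_ideal m n \<Sigma>) j)"
    if "\<Sigma> \<in> bases m n" "t < m" "j < n" for \<Sigma> t j
    using highest_weight_ideal[OF assms(2) that(1), folded x_def] rho_coords[OF that(1)] that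
    by (simp add: ideal_weight_Eps ideal_weight_Del del: of_int_diff flip: of_int_diff)
  have empty: "{} \<in> antichains m n" by (simp add: antichains_def)
  have H: "finite ?H" "?H \<noteq> {}" by (rule finite_antichain_cards) (use empty in blast)
  have R: "finite (?R \<Sigma>)" "?R \<Sigma> \<noteq> {}" for \<Sigma> by (rule finite_antichain_cards) (use empty in blast)
  \<comment> \<open>\<open>T\<close> may be simple for a base unrelated to \<open>\<Sigma>\<close>.
    \<open>run_eq_imp_hit\<close> applies nevertheless, as it relates the cell only to the row and
    column lengths of the ideal of \<open>\<Sigma>\<close>.\<close>
  have sub: "?R \<Sigma> \<subseteq> ?H" if S: "\<Sigma> \<in> bases m n" for \<Sigma>
  proof
    fix k assume "k \<in> ?R \<Sigma>"
    then obtain T where T: "k = card T" "T \<in> antichains m n"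
      "\<forall>(t, j)\<in>T. ?nu \<Sigma> (Eps (m - t)) + ?nu \<Sigma> (Del (Suc j)) = 0" by blast
    have "\<forall>(t, j)\<in>T. hit ?a ?b t j"
    proof clarify
      fix t j assume tj: "(t, j) \<in> T"
      have b: "t < m" "j < n" using T(2) tj unfolding antichains_def by auto
      note ideal = base_ideal_ideal[OF S]
      have "?nu \<Sigma> (Eps (m - t)) + ?nu \<Sigma> (Del (Suc j)) = 0" using T(3) tj by blast
      then have "run ?a ?b t (row_len (base_ideal m n \<Sigma>) t) = run ?b ?a j (col_len (base_ideal m n \<Sigma>) j)"
        using nu[OF S b] by blast
      moreover have "j < row_len (base_ideal m n \<Sigma>) t \<longleftrightarrow> t < col_len (base_ideal m n \<Sigma>) j"
        using row_len_iff[OF ideal] col_len_iff[OF ideal] by blast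
      ultimately show "hit ?a ?b t j"
        using run_eq_imp_hit[OF mono b _ _ row_len_le[OF ideal] col_len_le[OF ideal]] by blast
    qed
    then show "k \<in> ?H" using T(1,2) by blast
  qed
  have le: "Max (?R \<Sigma>) \<le> Max ?H" if "\<Sigma> \<in> bases m n" for \<Sigma>
    by (rule Max_mono[OF sub[OF that] R(2) H(1)])
  show ?thesis
    unfolding longtail_def s_value_eq
  proof (rule Max_eqI)
    show "finite ((\<lambda>\<Sigma>. Max (?R \<Sigma>)) ` bases m n)" using finite_bases by blast
    fix k assume "k \<in> (\<lambda>\<Sigma>. Max (?R \<Sigma>)) ` bases m n"
    then obtain \<Sigma> where S: "\<Sigma> \<in> bases m n" "k = Max (?R \<Sigma>)" by blast
    then show "k \<le> Max ?H" using le by simp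
  next
    obtain T where T: "Max ?H = card T" "T \<in> antichains m n" "\<forall>(t, j)\<in>T. hit ?a ?b t j"
      using Max_in[OF H] by blast
    \<comment> \<open>For the reverse inequality one base supplies both the weight and the simple
      roots. At a cell of \<open>T\<close> its lengths are \<open>j\<close> and \<open>t\<close>, so
      the values compared are exactly those of the hit.\<close>
    define N where "N = {p \<in> {..<m} \<times> {..<n}. \<not> (\<exists>q\<in>T. fst q \<le> fst p \<and> snd q \<le> snd p)}"
    note N = antichain_simple[OF T(2), folded N_def]
    let ?C = "covering_roots m n (shuffle_pos m N)"
    have C: "?C \<in> bases m n" by (rule covering_roots_in_bases[OF N(1)])
    have "\<forall>(t, j)\<in>T. ?nu ?C (Eps (m - t)) + ?nu ?C (Del (Suc j)) = 0"
    proof clarify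
      fix t j assume tj: "(t, j) \<in> T"
      have b: "t < m" "j < n" using T(2) tj unfolding antichains_def by auto
      show "?nu ?C (Eps (m - t)) + ?nu ?C (Del (Suc j)) = 0"
        unfolding nu[OF C b] base_ideal_covering[OF N(1)] N(2)[OF tj] N(3)[OF tj] using T(3) tj by blast
    qed
    then have "Max ?H \<in> ?R ?C" using T(1,2) by blast
    then have ge: "Max ?H \<le> Max (?R ?C)" using R(1) by (rule Max_ge[rotated])
    show "Max ?H \<in> (\<lambda>\<Sigma>. Max (?R \<Sigma>)) ` bases m n"
      using ge le[OF C] C by (intro image_eqI[of _ _ ?C]) auto
  qed
qed

lemma max_arrows_eq:
  assumes "strict_mono_on {..<m} (mirrored_eps m x)" "strict_mono_on {..<n} (neg_del x)"
  shows "max_arrows m n x =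
    Max {card T | T. T \<in> antichains m n \<and> (\<forall>(t, j)\<in>T. hit (mirrored_eps m x) (neg_del x) t j)}"
proof -
  let ?a = "mirrored_eps m x" and ?b = "neg_del x"
  let ?H = "{card T | T. T \<in> antichains m n \<and> (\<forall>(t, j)\<in>T. hit ?a ?b t j)}"
  let ?h = "\<lambda>r. card {t. t < m \<and> ?a t \<le> r \<and> r < run ?a ?b t n}"
  have empty: "{} \<in> antichains m n" by (simp add: antichains_def)
  have H: "finite ?H" "?H \<noteq> {}" by (rule finite_antichain_cards) (use empty in blast)
  have le: "?h r \<le> Max ?H" for r
  proof -
    obtain S where S: "S \<subseteq> {..<m} \<times> {..<n}" "\<forall>(t, j)\<in>S. hit ?a ?b t j"
      "\<forall>(t, j)\<in>S. \<forall>(t', j')\<in>S. t \<le> t' \<longrightarrow> j \<le> j' \<longrightarrow> (t, j) = (t', j')" "card S = ?h r"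
      using arrows_le_antichain_hits[OF assms, of r] by blast
    have "S \<in> antichains m n" by (rule antichainsI[OF S(1)]) (use S(3) in blast)
    then have "?h r \<in> ?H" unfolding S(4)[symmetric] using S(2) by blast
    then show ?thesis using H(1) by (rule Max_ge[rotated])
  qed
  obtain T where T: "Max ?H = card T" "T \<in> antichains m n" "\<forall>(t, j)\<in>T. hit ?a ?b t j"
    using Max_in[OF H] by blast
  have "\<exists>r. card T \<le> ?h r"
    by (rule antichain_hits_le_arrows[OF assms]) (use T(2,3) in \<open>auto simp: antichains_def\<close>)
  then obtain r where r: "card T \<le> ?h r" ..
  have "max_arrows m n x = Max (range ?h)"
    unfolding max_arrows_def card_arrows_over[OF assms] ..
  also have "\<dots> = Max ?H"
  proof (rule Max_eqI)
    have "range ?h \<subseteq> {..Max ?H}" using le by auto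
    then show "finite (range ?h)" by (rule finite_subset) simp
    show "k \<le> Max ?H" if "k \<in> range ?h" for k using that le by blast
    have "Max ?H = ?h r" using r le[of r] T(1) by simp
    then show "Max ?H \<in> range ?h" by blast
  qed
  finally show ?thesis .
qed

theorem theorem4:
  fixes m n :: nat
    and lam :: "idx \<Rightarrow> int"
    and scale :: "complex \<Rightarrow> 'v::ab_group_add \<Rightarrow> 'v"
    and V :: "bool \<Rightarrow> 'v set"
    and act :: "cmat \<Rightarrow> 'v \<Rightarrow> 'v"
  assumes "lam \<in> dominant m n"
    and "is_L m n lam scale V act"
  shows "max_incomparable m n (lam_bar m n lam) = longtail m n scale act
    \<and> max_arrows m n (lam_bar m n lam) = longtail m n scale act
    \<and> max_caps m n (lam_bar m n lam) = longtail m n scale act"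
proof -
  let ?x = "lam_bar m n lam"
  note mono = lam_bar_strict_mono[OF assms(1)]
  have "max_caps m n ?x = max_arrows m n ?x"
    unfolding max_caps_def max_arrows_def card_caps_over[OF mono] card_arrows_over[OF mono] ..
  then show ?thesis
    using longtail_eq[OF assms] max_incomparable_eq[OF mono] max_arrows_eq[OF mono] by simp
qed


end
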